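(* Let $\Omega\subset\mathbb{R}^d$ be open and $1\le p\le\infty$. Then $D(\Omega,z)=0$ for $\mathcal{H}^{d-1}$-a.e. $z\in\Gamma_{\mathrm{s}}^p$. In particular, if $A\subset\Gamma_{\mathrm{loc}}$ is a Borel set such that $\overline{D}(\Omega,z)>0$ for $\mathcal{H}^{d-1}$-a.e. $z\in A$, then the approximative trace in $W^{1,p}(\Omega)$ is unique on $A$.
   Context: $\Omega\subset\mathbb{R}^d$ is a nonempty open set (no further assumptions), $\Gamma:=\partial\Omega$ is its topological boundary, all functions are real-valued, and $\mathcal{H}^{d-1}$ is the $(d-1)$-dimensional Hausdorff measure. Set $\Gamma_{\mathrm{loc}}:=\{z\in\Gamma : \exists r>0,\ \mathcal{H}^{d-1}(\Gamma\cap B(z,r))<\infty\}$ and $\Gamma_{\mathrm{inf}}:=\Gamma\setminus\Gamma_{\mathrm{loc}}$. $L^1_{\mathrm{loc}}(\Gamma)$ denotes the space of locally integrable functions on $\Gamma$ with respect to $\mathcal{H}^{d-1}$ (modulo $\mathcal{H}^{d-1}$-null sets); it is identified with $L^1_{\mathrm{loc}}(\Gamma_{\mathrm{loc}})$, i.e. its elements vanish $\mathcal{H}^{d-1}$-a.e. on $\Gamma_{\mathrm{inf}}$ and are integrable over every compact $K\subset\Gamma_{\mathrm{loc}}$. It carries the topology given by the seminorms $\varphi\mapsto\int_K|\varphi|\,d\mathcal{H}^{d-1}$, $K\subset\Gamma_{\mathrm{loc}}$ compact. For Borel $A\subset\Gamma$, $L^1_{\mathrm{loc}}(A)$ is regarded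 as the subspace of those $\varphi\in L^1_{\mathrm{loc}}(\Gamma)$ with $\varphi=0$ a.e. on $\Gamma\setminus A$. $W^{1,p}(\Omega)\cap C(\overline\Omega)$ is the set of continuous functions on $\overline\Omega$ whose restriction to $\Omega$ is in $W^{1,p}(\Omega)$. A function $\varphi\in L^1_{\mathrm{loc}}(\Gamma)$ is an approximative trace of $u\in W^{1,p}(\Omega)$ if there is a sequence $(u_n)$ in $W^{1,p}(\Omega)\cap C(\overline\Omega)$ with $u_n|_\Gamma\in L^1_{\mathrm{loc}}(\Gamma)$ for all $n$, $u_n\to u$ in $W^{1,p}(\Omega)$ and $u_n|_\Gamma\to\varphi$ in $L^1_{\mathrm{loc}}(\Gamma)$. $Z^p$ is the set of all approximative traces of the zero function in $W^{1,p}(\Omega)$. There is a Borel set $\Gamma_{\mathrm{s}}^p\subset\Gamma_{\mathrm{loc}}$, unique up to $\mathcal{H}^{d-1}$-null sets, with $Z^p=L^1_{\mathrm{loc}}(\Gamma_{\mathrm{s}}^p)$; fix such a set (for $p=\infty$ one has $Z^\infty=\{0\}$ and $\Gamma_{\mathrm s}^\infty=\emptyset$ up to null sets). For a Borel set $A\subset\Gamma_{\mathrm{loc}}$, the approximative trace in $W^{1,p}(\Omega)$ is unique on $A$ if $\mathcal{H}^{d-1}(A\cap\Gamma_{\mathrm{s}}^p)=0$. With $|\cdot|$ Lebesgue measure, $\overline{D}(\Omega,z):=\limsup_{r\to0+}\frac{|\Omega\cap B(z,r)|}{|B(z,r)|}$, $\underline{D}(\Omega,z)$ is the corresponding $\liminf$,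 and $D(\Omega,z)$ is the common value if both agree. *)

theory Defs
  imports "HOL-Analysis.Analysis" "HOL-Probability.Essential_Supremum"
begin

section \<open>Hausdorff measure\<close>

text \<open>
  Normalised so that the \<open>n\<close>-dimensional measure on \<open>n\<close>-dimensional space is Lebesgue measure.
  The exponent is a natural number because \<^term>\<open>(0::real) powr 0 = 0\<close>, whereas the
  zero-dimensional measure has to count points. Boundedness is required of the covering sets
  since \<^const>\<open>diameter\<close> has no meaning for unbounded sets.
\<close>

definition hausdorff_gauge :: "nat \<Rightarrow> 'a::metric_space set \<Rightarrow> ennreal" where
  "hausdorff_gauge s C =
     (if C = {} then 0 else ennreal (unit_ball_vol (real s) * (diameter C / 2) ^ s))"

definition hausdorff_content :: "nat \<Rightarrow> real \<Rightarrow> 'a::metric_space set \<Rightarrow> ennreal" where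
  "hausdorff_content s \<delta> A =
     (INF C\<in>{C :: nat \<Rightarrow> 'a set. A \<subseteq> (\<Union>i. C i) \<and> (\<forall>i. bounded (C i) \<and> diameter (C i) \<le> \<delta>)}.
        \<Sum>i. hausdorff_gauge s (C i))"

definition hausdorff_outer :: "nat \<Rightarrow> 'a::metric_space set \<Rightarrow> ennreal" where
  "hausdorff_outer s A = (SUP \<delta>\<in>{0<..}. hausdorff_content s \<delta> A)"

definition hausdorff_measure :: "nat \<Rightarrow> 'a::metric_space measure" where
  "hausdorff_measure s = measure_of UNIV (sets borel) (hausdorff_outer s)"

lemma sets_hausdorff_measure [simp, measurable_cong]:
  "sets (hausdorff_measure s :: 'a::metric_space measure) = sets borel"
  unfolding hausdorff_measure_def by (metis sets.sets_measure_of_eq space_borel)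

lemma space_hausdorff_measure [simp]: "space (hausdorff_measure s) = UNIV"
  unfolding hausdorff_measure_def by (simp add: space_measure_of_conv)

lemma hausdorff_content_empty: "0 \<le> \<delta> \<Longrightarrow> hausdorff_content s \<delta> {} = 0"
proof -
  assume "0 \<le> \<delta>"
  then have "hausdorff_content s \<delta> ({} :: 'a set) \<le> (\<Sum>i::nat. hausdorff_gauge s ({} :: 'a set))"
    unfolding hausdorff_content_def by (intro INF_lower) (auto simp: diameter_def)
  then show ?thesis by (simp add: hausdorff_gauge_def)
qed

lemma hausdorff_content_mono: "A \<subseteq> B \<Longrightarrow> hausdorff_content s \<delta> A \<le> hausdorff_content s \<delta> B"
  unfolding hausdorff_content_def by (rule INF_superset_mono) auto

lemma hausdorff_content_antimono:
  "\<delta> \<le> \<delta>' \<Longrightarrow> hausdorff_content s \<delta>' A \<le> hausdorff_content s \<delta> A"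
  unfolding hausdorff_content_def by (rule INF_superset_mono) (auto intro: order_trans)

lemma hausdorff_content_subadditive:
  "hausdorff_content s \<delta> (\<Union>n. A n) \<le> (\<Sum>n. hausdorff_content s \<delta> (A n))"
proof (rule ennreal_le_epsilon)
  fix e :: real
  assume fin: "(\<Sum>n. hausdorff_content s \<delta> (A n)) < top" and e: "0 < e"
  have "\<exists>C. A n \<subseteq> (\<Union>i. C i) \<and> (\<forall>i. bounded (C i) \<and> diameter (C i) \<le> \<delta>) \<and>
      (\<Sum>i. hausdorff_gauge s (C i)) \<le> hausdorff_content s \<delta> (A n) + ennreal (e * (1/2) ^ Suc n)"
    for n
  proof -
    have "hausdorff_content s \<delta> (A n) < top"
      using fin ennreal_suminf_lessD by blast
    then have "hausdorff_content s \<delta> (A n) < hausdorff_content s \<delta> (A n) + ennreal (e * (1/2) ^ Suc n)"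
      using e by (auto simp: less_top)
    then show ?thesis
      unfolding hausdorff_content_def[of s \<delta> "A n"] INF_less_iff by (auto intro: less_imp_le)
  qed
  then obtain C where C: "\<And>n. A n \<subseteq> (\<Union>i. C n i)"
    "\<And>n i. bounded (C n i)" "\<And>n i. diameter (C n i) \<le> \<delta>"
    "\<And>n. (\<Sum>i. hausdorff_gauge s (C n i)) \<le> hausdorff_content s \<delta> (A n) + ennreal (e * (1/2) ^ Suc n)"
    by metis
  define D where "D = (\<lambda>k. case prod_decode k of (n, i) \<Rightarrow> C n i)"
  have "(\<Union>n. A n) \<subseteq> (\<Union>k. D k)"
  proof
    fix x assume "x \<in> (\<Union>n. A n)"
    then obtain n i where "x \<in> C n i" using C(1) by blast
    then have "x \<in> D (prod_encode (n, i))" by (simp add: D_def)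
    then show "x \<in> (\<Union>k. D k)" by blast
  qed
  then have "hausdorff_content s \<delta> (\<Union>n. A n) \<le> (\<Sum>k. hausdorff_gauge s (D k))"
    unfolding hausdorff_content_def using C(2,3)
    by (intro INF_lower) (auto simp: D_def split: prod.split)
  also have "\<dots> = (\<Sum>n. \<Sum>i. hausdorff_gauge s (C n i))"
    using suminf_ennreal_2dimen[where f = "\<lambda>(n, i). hausdorff_gauge s (C n i)", OF refl]
    by (simp add: D_def split_def)
  also have "\<dots> \<le> (\<Sum>n. hausdorff_content s \<delta> (A n) + ennreal (e * (1/2) ^ Suc n))"
    by (intro suminf_le C(4)) auto
  also have "\<dots> = (\<Sum>n. hausdorff_content s \<delta> (A n)) + (\<Sum>n. ennreal (e * (1/2) ^ Suc n))"
    by (intro suminf_add[symmetric]) auto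
  also have "(\<Sum>n. ennreal (e * (1/2) ^ Suc n)) = ennreal e"
  proof (rule suminf_ennreal_eq)
    show "(\<lambda>n. e * (1/2) ^ Suc n) sums e"
      using sums_mult[OF power_half_series, of e] by (simp only: mult_1_right)
  qed (use e in simp)
  finally show "hausdorff_content s \<delta> (\<Union>n. A n) \<le> (\<Sum>n. hausdorff_content s \<delta> (A n)) + ennreal e" .
qed

lemma hausdorff_content_le_outer: "0 < \<delta> \<Longrightarrow> hausdorff_content s \<delta> A \<le> hausdorff_outer s A"
  unfolding hausdorff_outer_def by (rule SUP_upper) simp

lemma hausdorff_outer_empty: "hausdorff_outer s {} = 0"
  unfolding hausdorff_outer_def
  by (intro antisym SUP_least) (auto simp: hausdorff_content_empty)

lemma hausdorff_outer_mono: "A \<subseteq> B \<Longrightarrow> hausdorff_outer s A \<le> hausdorff_outer s B"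
  unfolding hausdorff_outer_def by (intro SUP_mono) (auto intro: hausdorff_content_mono)

lemma hausdorff_outer_subadditive:
  "hausdorff_outer s (\<Union>n. A n) \<le> (\<Sum>n. hausdorff_outer s (A n))"
  unfolding hausdorff_outer_def[of s "\<Union>n. A n"]
proof (rule SUP_least)
  fix \<delta> :: real assume "\<delta> \<in> {0<..}"
  then show "hausdorff_content s \<delta> (\<Union>n. A n) \<le> (\<Sum>n. hausdorff_outer s (A n))"
    by (intro order_trans[OF hausdorff_content_subadditive] suminf_le hausdorff_content_le_outer) auto
qed

lemma outer_measure_space_hausdorff_outer: "outer_measure_space (Pow UNIV) (hausdorff_outer s)"
  unfolding outer_measure_space_def positive_def increasing_def countably_subadditive_def
  by (simp add: hausdorff_outer_empty hausdorff_outer_mono hausdorff_outer_subadditive)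

lemma hausdorff_outer_Un: "hausdorff_outer s (A \<union> B) \<le> hausdorff_outer s A + hausdorff_outer s B"
proof -
  have "hausdorff_outer s (A \<union> B) \<le> (\<Sum>n. hausdorff_outer s (binaryset A B n))"
    using hausdorff_outer_subadditive[of s "binaryset A B"] by (simp add: UN_binaryset_eq)
  also have "\<dots> = hausdorff_outer s A + hausdorff_outer s B"
    by (rule suminf_binaryset_eq) (rule hausdorff_outer_empty)
  finally show ?thesis .
qed

lemma hausdorff_content_separated:
  assumes sep: "\<And>x y. x \<in> A \<Longrightarrow> y \<in> B \<Longrightarrow> e \<le> dist x y" and \<delta>: "0 \<le> \<delta>" "\<delta> < e"
  shows "hausdorff_content s \<delta> A + hausdorff_content s \<delta> B \<le> hausdorff_content s \<delta> (A \<union> B)"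
  unfolding hausdorff_content_def[of s \<delta> "A \<union> B"]
proof (rule INF_greatest)
  fix C :: "nat \<Rightarrow> 'a set"
  assume "C \<in> {C. A \<union> B \<subseteq> (\<Union>i. C i) \<and> (\<forall>i. bounded (C i) \<and> diameter (C i) \<le> \<delta>)}"
  then have cov: "A \<subseteq> (\<Union>i. C i)" "B \<subseteq> (\<Union>i. C i)"
    and C: "\<And>i. bounded (C i)" "\<And>i. diameter (C i) \<le> \<delta>" by auto
  define CA where "CA = (\<lambda>i. if C i \<inter> A = {} then {} else C i)"
  define CB where "CB = (\<lambda>i. if C i \<inter> B = {} then {} else C i)"
  have "A \<subseteq> (\<Union>i. CA i)" "B \<subseteq> (\<Union>i. CB i)"
    using cov unfolding CA_def CB_def by fastforce+
  then have "hausdorff_content s \<delta> A \<le> (\<Sum>i. hausdorff_gauge s (CA i))"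
    "hausdorff_content s \<delta> B \<le> (\<Sum>i. hausdorff_gauge s (CB i))"
    unfolding hausdorff_content_def using C \<delta>
    by (intro INF_lower; simp add: CA_def CB_def)+
  then have "hausdorff_content s \<delta> A + hausdorff_content s \<delta> B
      \<le> (\<Sum>i. hausdorff_gauge s (CA i)) + (\<Sum>i. hausdorff_gauge s (CB i))"
    by (rule add_mono)
  also have "\<dots> = (\<Sum>i. hausdorff_gauge s (CA i) + hausdorff_gauge s (CB i))"
    by (intro suminf_add) auto
  also have "\<dots> \<le> (\<Sum>i. hausdorff_gauge s (C i))"
  proof (intro suminf_le)
    fix i
    have "C i \<inter> A = {} \<or> C i \<inter> B = {}"
    proof (rule ccontr)
      assume "\<not> ?thesis"
      then obtain x y where "x \<in> C i" "x \<in> A" "y \<in> C i" "y \<in> B" by blast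
      then have "e \<le> diameter (C i)"
        using sep[of x y] diameter_bounded_bound[OF C(1)[of i], of x y] by linarith
      then show False using C(2)[of i] \<delta> by linarith
    qed
    then show "hausdorff_gauge s (CA i) + hausdorff_gauge s (CB i) \<le> hausdorff_gauge s (C i)"
      by (auto simp: CA_def CB_def hausdorff_gauge_def[of s "{}"])
  qed auto
  finally show "hausdorff_content s \<delta> A + hausdorff_content s \<delta> B \<le> (\<Sum>i. hausdorff_gauge s (C i))" .
qed

lemma hausdorff_outer_separated:
  assumes sep: "\<And>x y. x \<in> A \<Longrightarrow> y \<in> B \<Longrightarrow> e \<le> dist x y" and "0 < e"
  shows "hausdorff_outer s A + hausdorff_outer s B \<le> hausdorff_outer s (A \<union> B)"
proof -
  have *: "hausdorff_content s \<delta>1 A + hausdorff_content s \<delta>2 B \<le> hausdorff_outer s (A \<union> B)"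
    if "0 < \<delta>1" "0 < \<delta>2" for \<delta>1 \<delta>2
  proof -
    define \<delta> where "\<delta> = min (min \<delta>1 \<delta>2) (e / 2)"
    have \<delta>: "0 < \<delta>" "\<delta> \<le> \<delta>1" "\<delta> \<le> \<delta>2" "\<delta> < e" using that \<open>0 < e\<close> by (auto simp: \<delta>_def)
    have "hausdorff_content s \<delta>1 A + hausdorff_content s \<delta>2 B
        \<le> hausdorff_content s \<delta> A + hausdorff_content s \<delta> B"
      using \<delta> by (intro add_mono hausdorff_content_antimono)
    also have "\<dots> \<le> hausdorff_content s \<delta> (A \<union> B)"
      using \<delta> by (intro hausdorff_content_separated[OF sep]) auto
    also have "\<dots> \<le> hausdorff_outer s (A \<union> B)"
      using \<delta> by (intro hausdorff_content_le_outer)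
    finally show ?thesis .
  qed
  have ne: "{0::real<..} \<noteq> {}" by (metis empty_iff greaterThan_iff zero_less_one)
  have "hausdorff_content s \<delta>1 A + hausdorff_outer s B \<le> hausdorff_outer s (A \<union> B)"
    if "0 < \<delta>1" for \<delta>1
    unfolding hausdorff_outer_def[of s B] ennreal_SUP_add_right[OF ne]
    by (rule SUP_least) (simp add: * that)
  then show ?thesis
    unfolding hausdorff_outer_def[of s A] ennreal_SUP_add_left[OF ne, symmetric]
    by (intro SUP_least) simp
qed

lemma hausdorff_outer_rings:
  assumes sep: "\<And>n k x y. k < n \<Longrightarrow> x \<in> R k \<Longrightarrow> y \<in> R n \<Longrightarrow> e n \<le> dist x y"
    and e: "\<And>n. 0 < e n" and X: "\<And>k. R k \<subseteq> X"
  shows "(\<Sum>k. hausdorff_outer s (R k)) \<le> hausdorff_outer s X"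
proof (rule suminf_le_const[OF summableI])
  fix n
  have "(\<Sum>k<n. hausdorff_outer s (R k)) \<le> hausdorff_outer s (\<Union>k<n. R k)"
  proof (induction n)
    case 0
    then show ?case by simp
  next
    case (Suc n)
    have "(\<Sum>k<Suc n. hausdorff_outer s (R k)) \<le> hausdorff_outer s (\<Union>k<n. R k) + hausdorff_outer s (R n)"
      using Suc by (simp add: add_right_mono)
    also have "\<dots> \<le> hausdorff_outer s ((\<Union>k<n. R k) \<union> R n)"
      by (rule hausdorff_outer_separated[of _ _ "e n"]) (use sep e in auto)
    also have "(\<Union>k<n. R k) \<union> R n = (\<Union>k<Suc n. R k)"
      by (auto simp: less_Suc_eq)
    finally show ?case .
  qed
  also have "\<dots> \<le> hausdorff_outer s X"
    using X by (intro hausdorff_outer_mono) auto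
  finally show "(\<Sum>k<n. hausdorff_outer s (R k)) \<le> hausdorff_outer s X" .
qed

lemma ennreal_suminf_tail_tendsto_0:
  fixes f :: "nat \<Rightarrow> ennreal"
  assumes "(\<Sum>k. f k) \<noteq> top"
  shows "(\<lambda>n. \<Sum>k. f (k + n)) \<longlonglongrightarrow> 0"
proof -
  define g where "g = (\<lambda>k. enn2real (f k))"
  have "f k < top" for k
    using assms ennreal_suminf_lessD[of f top k] by (simp add: less_top)
  then have f: "f = (\<lambda>k. ennreal (g k))" by (auto simp: g_def)
  have g: "\<And>k. 0 \<le> g k" by (simp add: g_def)
  have "summable g"
    using assms g unfolding f by (intro summable_suminf_not_top) auto
  then have "(\<lambda>n. ennreal (\<Sum>k. g (k + n))) \<longlonglongrightarrow> ennreal 0"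
    by (intro tendsto_ennrealI suminf_exist_split2)
  moreover have "(\<Sum>k. f (k + n)) = ennreal (\<Sum>k. g (k + n))" for n
    unfolding f using g \<open>summable g\<close> by (intro suminf_ennreal2) auto
  ultimately show ?thesis by simp
qed

lemma hausdorff_outer_split_closed:
  fixes F :: "'a::metric_space set"
  assumes F: "closed F" "F \<noteq> {}"
  shows "hausdorff_outer s (X \<inter> F) + hausdorff_outer s (X - F) \<le> hausdorff_outer s X"
proof (cases "hausdorff_outer s X = top")
  case fin: False
  define r where "r = (\<lambda>k::nat. 1 / (real k + 1))"
  have r: "0 < r k" "r (Suc k) < r k" for k by (auto simp: r_def field_simps)
  have r_mono: "r m \<le> r k" if "k \<le> m" for k m using that by (auto simp: r_def field_simps)
  define R where "R = (\<lambda>k. {x \<in> X. r (Suc k) \<le> infdist x F \<and> infdist x F < r k})"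
  define B where "B = (\<lambda>n. {x \<in> X. r (2 * n) \<le> infdist x F})"
  define Ev where "Ev = (\<lambda>n. \<Sum>k. hausdorff_outer s (R (2 * (k + n))))"
  define Od where "Od = (\<lambda>n. \<Sum>k. hausdorff_outer s (R (2 * (k + n) + 1)))"
  have R_sub: "R k \<subseteq> X" for k by (auto simp: R_def)
  have sep: "r m - r (Suc m) \<le> dist x y" if "Suc k \<le> m" "x \<in> R k" "y \<in> R (Suc m)" for k m x y
  proof -
    have "r m \<le> infdist x F" "infdist y F < r (Suc m)"
      using that r_mono[of "Suc k" m] by (auto simp: R_def)
    then show ?thesis using infdist_triangle[of x F y] by linarith
  qed
  have "(\<Sum>k. hausdorff_outer s (R (2 * k))) \<le> hausdorff_outer s X"
  proof (rule hausdorff_outer_rings[where e = "\<lambda>n. r (2 * n - 1) - r (Suc (2 * n - 1))"])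
    fix n k :: nat and x y assume "k < n" "x \<in> R (2 * k)" "y \<in> R (2 * n)"
    then show "r (2 * n - 1) - r (Suc (2 * n - 1)) \<le> dist x y"
      by (intro sep[of "2 * k"]) auto
  qed (use r R_sub in auto)
  then have Ev: "Ev \<longlonglongrightarrow> 0"
    unfolding Ev_def using fin by (intro ennreal_suminf_tail_tendsto_0) (auto simp: top_unique)
  have "(\<Sum>k. hausdorff_outer s (R (2 * k + 1))) \<le> hausdorff_outer s X"
  proof (rule hausdorff_outer_rings[where e = "\<lambda>n. r (2 * n) - r (Suc (2 * n))"])
    fix n k :: nat and x y assume "k < n" "x \<in> R (2 * k + 1)" "y \<in> R (2 * n + 1)"
    then show "r (2 * n) - r (Suc (2 * n)) \<le> dist x y"
      by (intro sep[of "2 * k + 1"]) auto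
  qed (use r R_sub in auto)
  then have Od: "Od \<longlonglongrightarrow> 0"
    unfolding Od_def using fin
    by (intro ennreal_suminf_tail_tendsto_0[where f = "\<lambda>k. hausdorff_outer s (R (2 * k + 1))"])
      (auto simp: top_unique)
  have cover: "X - F \<subseteq> B n \<union> ((\<Union>k. R (2 * (k + n))) \<union> (\<Union>k. R (2 * (k + n) + 1)))" for n
  proof
    fix x assume x: "x \<in> X - F"
    show "x \<in> B n \<union> ((\<Union>k. R (2 * (k + n))) \<union> (\<Union>k. R (2 * (k + n) + 1)))"
    proof (cases "x \<in> B n")
      case False
      then have lt: "infdist x F < r (2 * n)" using x by (auto simp: B_def)
      have "0 < infdist x F" using F x by (intro infdist_pos_not_in_closed) auto
      then obtain m where "inverse (real (Suc m)) < infdist x F" using reals_Archimedean by blast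
      then have ex: "r m \<le> infdist x F" by (auto simp: r_def field_simps)
      define m where "m = (LEAST m. r m \<le> infdist x F)"
      have m: "r m \<le> infdist x F" unfolding m_def by (rule LeastI, rule ex)
      have "2 * n < m" using m lt r_mono[of m "2 * n"] by (cases "2 * n < m") auto
      then obtain j where j: "m = Suc j" "2 * n \<le> j" by (cases m) auto
      have "infdist x F < r j"
        using not_less_Least[of j "\<lambda>m. r m \<le> infdist x F"] j by (auto simp: m_def)
      then have xj: "x \<in> R j" using m j x by (auto simp: R_def)
      show ?thesis
      proof (cases "even j")
        case True
        then obtain i where i: "j = 2 * i" by blast
        then have "x \<in> R (2 * ((i - n) + n))" using xj j by auto
        then show ?thesis by blast
      next
        case False
        then obtain i where i: "j = 2 * i + 1" using oddE by blast
        then have "x \<in> R (2 * ((i - n) + n) + 1)" using xj j by auto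
        then show ?thesis by blast
      qed
    qed auto
  qed
  have bound: "hausdorff_outer s (X \<inter> F) + hausdorff_outer s (X - F)
      \<le> hausdorff_outer s X + (Ev n + Od n)" for n
  proof -
    have "hausdorff_outer s (X - F) \<le> hausdorff_outer s (B n) + (Ev n + Od n)"
      unfolding Ev_def Od_def
      by (intro order_trans[OF hausdorff_outer_mono[OF cover[of n]]]
          order_trans[OF hausdorff_outer_Un] add_mono order_refl hausdorff_outer_subadditive)
    then have "hausdorff_outer s (X \<inter> F) + hausdorff_outer s (X - F)
        \<le> (hausdorff_outer s (X \<inter> F) + hausdorff_outer s (B n)) + (Ev n + Od n)"
      by (simp add: add.assoc add_left_mono)
    also have "hausdorff_outer s (X \<inter> F) + hausdorff_outer s (B n) \<le> hausdorff_outer s (X \<inter> F \<union> B n)"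
    proof (rule hausdorff_outer_separated)
      fix x y assume "x \<in> X \<inter> F" "y \<in> B n"
      then show "r (2 * n) \<le> dist x y"
        using infdist_le[of x F y] by (auto simp: B_def dist_commute)
    qed (rule r)
    also have "\<dots> \<le> hausdorff_outer s X"
      by (intro hausdorff_outer_mono) (auto simp: B_def)
    finally show ?thesis by (simp add: add_right_mono)
  qed
  have "(\<lambda>n. hausdorff_outer s X + (Ev n + Od n)) \<longlonglongrightarrow> hausdorff_outer s X + (0 + 0)"
    using Ev Od by (intro tendsto_add tendsto_const)
  then show ?thesis
    using bound by (intro LIMSEQ_le_const) auto
qed auto

lemma sets_borel_subset_lambda_system:
  "sets borel \<subseteq> lambda_system UNIV (Pow UNIV) (hausdorff_outer s :: 'a::metric_space set \<Rightarrow> ennreal)"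
proof -
  interpret P: sigma_algebra UNIV "Pow UNIV :: 'a set set" by (rule sigma_algebra_Pow)
  let ?L = "lambda_system UNIV (Pow UNIV) (hausdorff_outer s :: 'a set \<Rightarrow> ennreal)"
  have "measure_space UNIV ?L (hausdorff_outer s)"
    by (rule P.caratheodory_lemma) (rule outer_measure_space_hausdorff_outer)
  then interpret L: sigma_algebra UNIV ?L by (simp add: measure_space_def)
  have "F \<in> ?L" if "closed F" for F :: "'a set"
  proof (cases "F = {}")
    case False
    show ?thesis
      unfolding P.lambda_system_eq
    proof safe
      fix X :: "'a set"
      show "hausdorff_outer s (X \<inter> F) + hausdorff_outer s (X - F) = hausdorff_outer s X"
        using hausdorff_outer_split_closed[OF that False, of s X]
          hausdorff_outer_Un[of s "X \<inter> F" "X - F"] by (simp add: Int_Diff_Un)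
    qed simp
  qed (use L.empty_sets in simp)
  then have "sigma_sets UNIV (Collect closed) \<subseteq> ?L"
    by (intro L.sigma_sets_subset) auto
  then show ?thesis by (simp add: borel_eq_closed)
qed

lemma emeasure_hausdorff_measure:
  fixes A :: "'a::metric_space set"
  assumes "A \<in> sets borel"
  shows "emeasure (hausdorff_measure s) A = hausdorff_outer s A"
  unfolding hausdorff_measure_def
proof (rule emeasure_measure_of_sigma)
  interpret P: sigma_algebra UNIV "Pow UNIV :: 'a set set" by (rule sigma_algebra_Pow)
  have "measure_space UNIV (lambda_system UNIV (Pow UNIV) (hausdorff_outer s))
      (hausdorff_outer s :: 'a set \<Rightarrow> ennreal)"
    by (rule P.caratheodory_lemma) (rule outer_measure_space_hausdorff_outer)
  then have ca: "countably_additive (lambda_system UNIV (Pow UNIV) (hausdorff_outer s))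
      (hausdorff_outer s :: 'a set \<Rightarrow> ennreal)"
    by (simp add: measure_space_def)
  show "countably_additive (sets borel) (hausdorff_outer s :: 'a set \<Rightarrow> ennreal)"
  proof (rule countably_additiveI)
    fix B :: "nat \<Rightarrow> 'a set"
    assume B: "range B \<subseteq> sets borel" "disjoint_family B" "(\<Union>i. B i) \<in> sets borel"
    show "(\<Sum>i. hausdorff_outer s (B i)) = hausdorff_outer s (\<Union>i. B i)"
    proof (rule ca[unfolded countably_additive_def, rule_format])
      show "range B \<subseteq> lambda_system UNIV (Pow UNIV) (hausdorff_outer s)"
        by (rule subset_trans[OF B(1) sets_borel_subset_lambda_system])
      show "(\<Union>i. B i) \<in> lambda_system UNIV (Pow UNIV) (hausdorff_outer s)"
        by (rule subsetD[OF sets_borel_subset_lambda_system B(3)])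
    qed (rule B)
  qed
  show "sigma_algebra UNIV (sets (borel :: 'a measure))"
    by (metis sets.sigma_algebra_axioms space_borel)
  show "positive (sets borel) (hausdorff_outer s :: 'a set \<Rightarrow> ennreal)"
    by (simp add: positive_def hausdorff_outer_empty)
qed (rule assms)

section \<open>Sobolev spaces\<close>

text \<open>\<open>Ck k f\<close>: all partial derivatives of \<open>f\<close> up to order \<open>k\<close> exist and are continuous.
  Differentiability below order \<open>k\<close> in the Frechet sense is then automatic.\<close>

primrec Ck :: "nat \<Rightarrow> ('a::euclidean_space \<Rightarrow> real) \<Rightarrow> bool" where
  "Ck 0 f \<longleftrightarrow> continuous_on UNIV f"
| "Ck (Suc k) f \<longleftrightarrow> (\<forall>x. f differentiable at x) \<and>
     (\<forall>b\<in>Basis. Ck k (\<lambda>x. frechet_derivative f (at x) b))"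

definition test_function :: "'a::euclidean_space set \<Rightarrow> ('a \<Rightarrow> real) \<Rightarrow> bool" where
  "test_function \<Omega> \<eta> \<longleftrightarrow> (\<forall>k. Ck k \<eta>) \<and>
     compact (closure {x. \<eta> x \<noteq> 0}) \<and> closure {x. \<eta> x \<noteq> 0} \<subseteq> \<Omega>"

definition locally_integrable :: "'a::euclidean_space set \<Rightarrow> ('a \<Rightarrow> real) \<Rightarrow> bool" where
  "locally_integrable \<Omega> u \<longleftrightarrow> (\<forall>K. compact K \<and> K \<subseteq> \<Omega> \<longrightarrow> set_integrable lebesgue K u)"

definition has_weak_partial ::
    "'a::euclidean_space set \<Rightarrow> 'a \<Rightarrow> ('a \<Rightarrow> real) \<Rightarrow> ('a \<Rightarrow> real) \<Rightarrow> bool" where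
  "has_weak_partial \<Omega> b u g \<longleftrightarrow> locally_integrable \<Omega> u \<and> locally_integrable \<Omega> g \<and>
     (\<forall>\<eta>. test_function \<Omega> \<eta> \<longrightarrow>
        (LINT x|lebesgue_on \<Omega>. u x * frechet_derivative \<eta> (at x) b) =
        - (LINT x|lebesgue_on \<Omega>. g x * \<eta> x))"

text \<open>Weak derivatives are determined almost everywhere only; all uses below are insensitive to
  the choice of representative.\<close>

definition weak_partial :: "'a::euclidean_space set \<Rightarrow> 'a \<Rightarrow> ('a \<Rightarrow> real) \<Rightarrow> 'a \<Rightarrow> real" where
  "weak_partial \<Omega> b u = (SOME g. has_weak_partial \<Omega> b u g)"

definition Lp_norm :: "ennreal \<Rightarrow> 'a measure \<Rightarrow> ('a \<Rightarrow> real) \<Rightarrow> ennreal" where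
  "Lp_norm p M f =
     (if p = \<infinity> then esssup M (\<lambda>x. ennreal \<bar>f x\<bar>)
      else let I = \<integral>\<^sup>+x. ennreal (\<bar>f x\<bar> powr enn2real p) \<partial>M
           in if I = \<infinity> then \<infinity> else ennreal (enn2real I powr (1 / enn2real p)))"

definition Lp :: "ennreal \<Rightarrow> 'a measure \<Rightarrow> ('a \<Rightarrow> real) set" where
  "Lp p M = {f \<in> borel_measurable M. Lp_norm p M f < \<infinity>}"

text \<open>Elements of the spaces below are functions on the whole space; only their values on
  \<open>\<Omega>\<close>, on its closure, or on its boundary, respectively, matter.\<close>

definition W1p :: "ennreal \<Rightarrow> 'a::euclidean_space set \<Rightarrow> ('a \<Rightarrow> real) set" where
  "W1p p \<Omega> = {u \<in> Lp p (lebesgue_on \<Omega>).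
     \<forall>b\<in>Basis. \<exists>g \<in> Lp p (lebesgue_on \<Omega>). has_weak_partial \<Omega> b u g}"

text \<open>The usual \<open>p\<close>-norm of the function together with its gradient is equivalent to this one;
  only the induced convergence is used.\<close>

definition W1p_norm :: "ennreal \<Rightarrow> 'a::euclidean_space set \<Rightarrow> ('a \<Rightarrow> real) \<Rightarrow> ennreal" where
  "W1p_norm p \<Omega> u = Lp_norm p (lebesgue_on \<Omega>) u +
     (\<Sum>b\<in>Basis. Lp_norm p (lebesgue_on \<Omega>) (weak_partial \<Omega> b u))"

definition W1p_cont :: "ennreal \<Rightarrow> 'a::euclidean_space set \<Rightarrow> ('a \<Rightarrow> real) set" where
  "W1p_cont p \<Omega> = {u \<in> W1p p \<Omega>. continuous_on (closure \<Omega>) u}"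

section \<open>Approximative traces\<close>

definition boundary_measure :: "'a::euclidean_space set \<Rightarrow> 'a measure" where
  "boundary_measure \<Omega> = restrict_space (hausdorff_measure (DIM('a) - 1)) (frontier \<Omega>)"

definition Gamma_loc :: "'a::euclidean_space set \<Rightarrow> 'a set" where
  "Gamma_loc \<Omega> = {z \<in> frontier \<Omega>.
     \<exists>r>0. emeasure (hausdorff_measure (DIM('a) - 1)) (frontier \<Omega> \<inter> ball z r) < \<infinity>}"

definition Gamma_inf :: "'a::euclidean_space set \<Rightarrow> 'a set" where
  "Gamma_inf \<Omega> = frontier \<Omega> - Gamma_loc \<Omega>"

text \<open>Every class of locally integrable functions has a Borel representative, since the boundary
  measure is \<open>\<sigma>\<close>-finite on \<open>Gamma_loc \<Omega>\<close>.\<close>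

definition L1loc :: "'a::euclidean_space set \<Rightarrow> ('a \<Rightarrow> real) set" where
  "L1loc \<Omega> = {\<phi> \<in> borel_measurable (boundary_measure \<Omega>).
     (AE z in boundary_measure \<Omega>. z \<in> Gamma_inf \<Omega> \<longrightarrow> \<phi> z = 0) \<and>
     (\<forall>K. compact K \<and> K \<subseteq> Gamma_loc \<Omega> \<longrightarrow> set_integrable (boundary_measure \<Omega>) K \<phi>)}"

definition L1loc_on :: "'a::euclidean_space set \<Rightarrow> 'a set \<Rightarrow> ('a \<Rightarrow> real) set" where
  "L1loc_on \<Omega> A = {\<phi> \<in> L1loc \<Omega>. AE z in boundary_measure \<Omega>. z \<notin> A \<longrightarrow> \<phi> z = 0}"

definition L1loc_tendsto ::
    "'a::euclidean_space set \<Rightarrow> (nat \<Rightarrow> 'a \<Rightarrow> real) \<Rightarrow> ('a \<Rightarrow> real) \<Rightarrow> bool" where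
  "L1loc_tendsto \<Omega> f \<phi> \<longleftrightarrow> (\<forall>K. compact K \<and> K \<subseteq> Gamma_loc \<Omega> \<longrightarrow>
     (\<lambda>n. \<integral>\<^sup>+z\<in>K. ennreal \<bar>f n z - \<phi> z\<bar> \<partial>boundary_measure \<Omega>) \<longlonglongrightarrow> 0)"

definition approx_trace ::
    "ennreal \<Rightarrow> 'a::euclidean_space set \<Rightarrow> ('a \<Rightarrow> real) \<Rightarrow> ('a \<Rightarrow> real) \<Rightarrow> bool" where
  "approx_trace p \<Omega> u \<phi> \<longleftrightarrow> u \<in> W1p p \<Omega> \<and> \<phi> \<in> L1loc \<Omega> \<and>
     (\<exists>U. (\<forall>n. U n \<in> W1p_cont p \<Omega> \<and> U n \<in> L1loc \<Omega>) \<and>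
          (\<lambda>n. W1p_norm p \<Omega> (\<lambda>x. U n x - u x)) \<longlonglongrightarrow> 0 \<and>
          L1loc_tendsto \<Omega> U \<phi>)"

definition zero_traces :: "ennreal \<Rightarrow> 'a::euclidean_space set \<Rightarrow> ('a \<Rightarrow> real) set" where
  "zero_traces p \<Omega> = {\<phi>. approx_trace p \<Omega> (\<lambda>_. 0) \<phi>}"

text \<open>\<open>singular_boundary p \<Omega> S\<close> says that \<open>S\<close> is a version of the singular part of the
  boundary, which is unique up to null sets.\<close>

definition singular_boundary :: "ennreal \<Rightarrow> 'a::euclidean_space set \<Rightarrow> 'a set \<Rightarrow> bool" where
  "singular_boundary p \<Omega> S \<longleftrightarrow>
     S \<in> sets borel \<and> S \<subseteq> Gamma_loc \<Omega> \<and> zero_traces p \<Omega> = L1loc_on \<Omega> S"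

text \<open>The dependence on \<open>p\<close> and \<open>\<Omega>\<close> is through the argument \<open>S\<close>, the chosen version of the
  singular part of the boundary; by uniqueness up to null sets the choice is immaterial.\<close>

definition trace_unique_on :: "'a::euclidean_space set \<Rightarrow> 'a set \<Rightarrow> bool" where
  "trace_unique_on S A \<longleftrightarrow> emeasure (hausdorff_measure (DIM('a) - 1)) (A \<inter> S) = 0"

section \<open>Densities\<close>

definition density_ratio :: "'a::euclidean_space set \<Rightarrow> 'a \<Rightarrow> real \<Rightarrow> ereal" where
  "density_ratio \<Omega> z r = ereal (measure lebesgue (\<Omega> \<inter> ball z r) / measure lebesgue (ball z r))"

definition upper_density :: "'a::euclidean_space set \<Rightarrow> 'a \<Rightarrow> ereal" where
  "upper_density \<Omega> z = Limsup (at_right 0) (density_ratio \<Omega> z)"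

definition lower_density :: "'a::euclidean_space set \<Rightarrow> 'a \<Rightarrow> ereal" where
  "lower_density \<Omega> z = Liminf (at_right 0) (density_ratio \<Omega> z)"

definition has_density :: "'a::euclidean_space set \<Rightarrow> 'a \<Rightarrow> ereal \<Rightarrow> bool" where
  "has_density \<Omega> z c \<longleftrightarrow> upper_density \<Omega> z = c \<and> lower_density \<Omega> z = c"

end

theory Submission
  imports Defs
begin

text \<open>
  Let \<open>A\<close> be a set of points of the singular part of the boundary at which \<open>\<Omega>\<close> has upper density
  greater than \<open>c > 0\<close>. The indicator function of the singular part is an approximative trace
  of \<open>0\<close>, so there are \<open>U n\<close> tending to \<open>0\<close> in \<open>W1p\<close> whose boundary values tend to \<open>1\<close> on \<open>A\<close> and
  to \<open>0\<close> off the singular part. Truncate \<open>U n\<close> to a function \<open>w\<close> with values in \<open>[0, 1]\<close> that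
  equals \<open>1\<close> in \<open>\<Omega>\<close> near most points of \<open>A\<close>, and extend it by zero. On almost every line parallel
  to an axis the extension can only jump at points where the line leaves \<open>\<Omega>\<close>. There \<open>U n\<close> tends
  to \<open>0\<close>, because it does so in the one-dimensional Sobolev norm of an adjacent segment; hence a
  jump occurs only where the boundary value of \<open>U n\<close> is still far from its limit. These points
  form a set of small Hausdorff measure, covered by small balls; taking the maximum of \<open>w\<close> and
  Lipschitz bumps that equal \<open>1\<close> on these balls removes all jumps at a small cost in total
  variation. The boxing inequality bounds the Hausdorff content of \<open>A\<close> by this total variation,
  so \<open>A\<close> is a null set. Neither the structure theory of sets of finite perimeter nor
  rectifiability of the boundary is needed.
\<close>

section \<open>The boxing inequality\<close>

text \<open>Of convergence in \<open>W1p\<close> only this is used: on bounded parts of \<Omega>,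
  \<open>U n\<close> and its partial derivatives become small in L1. So one argument covers every
  \<open>p\<close>. The difficulty is that two limits live off different exceptional sets. Vanishing
  at exit points holds on almost every line, along a subsequence with summable L1 norms; convergence
  to the trace holds off a null set of the boundary, which some lines may meet. Points where the
  value is still large although the sequence tends to 0 are therefore removed by bumps, including
  those in the null set. A bump of radius r has gradient 1/r on a volume of order r^d; its cost
  r^(d-1) is what the covering sum of a (d-1)-dimensional measure controls. An upper density
  provides good radii only along a sequence. This suffices, since the boxing argument starts from
  one small radius per point and doubles it until the density drops below \<open>c\<close>;
  smallness of the integral of v stops the doubling before a fixed radius. Perimeter enters only
  through averages of |1_E(x+y) - 1_E(x)| over small y: the coarea formula becomes Fubini's theorem,
  and restriction to disjoint balls is immediate.\<close>

lemma nn_integral_lborel_translate: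
  fixes f :: "'a::euclidean_space \<Rightarrow> ennreal"
  assumes [measurable]: "f \<in> borel_measurable borel"
  shows "(\<integral>\<^sup>+x. f (x + c) \<partial>lborel) = (\<integral>\<^sup>+x. f x \<partial>lborel)"
proof -
  have "(\<integral>\<^sup>+x. f x \<partial>lborel) = (\<integral>\<^sup>+x. f x \<partial>distr lborel borel ((+) c))"
    by (simp add: lborel_distr_plus)
  also have "\<dots> = (\<integral>\<^sup>+x. f (x + c) \<partial>lborel)"
    by (subst nn_integral_distr) (auto simp: add.commute)
  finally show ?thesis ..
qed

lemma AE_lborel_translate:
  fixes c :: "'a::euclidean_space"
  assumes "AE x in lborel. P x"
  shows "AE x in lborel. P (x + c)"
proof -
  from assms obtain N where N: "{x. \<not> P x} \<subseteq> N" "emeasure lborel N = 0" "N \<in> sets lborel"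
    by (auto elim!: AE_E)
  have V: "(\<lambda>x. x + c) -` N \<in> sets lborel"
    using N(3) measurable_sets_borel[of "\<lambda>x. x + c" borel N] by simp
  have "emeasure lborel ((\<lambda>x. x + c) -` N) = (\<integral>\<^sup>+x. indicator N (x + c) \<partial>lborel)"
    unfolding nn_integral_indicator[OF V, symmetric] by (intro nn_integral_cong) (simp add: indicator_def)
  also have "\<dots> = emeasure lborel N"
    using N(3) by (subst nn_integral_lborel_translate) auto
  finally have "emeasure lborel ((\<lambda>x. x + c) -` N) = 0" using N by simp
  then show ?thesis
    using N(1,3) measurable_sets_borel[of "\<lambda>x. x + c" borel N]
    by (intro AE_I'[of "(\<lambda>x. x + c) -` N"]) (auto simp: null_sets_def)
qed

lemma nn_integral_lborel_scale:
  fixes f :: "'a::euclidean_space \<Rightarrow> ennreal"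
  assumes [measurable]: "f \<in> borel_measurable borel" and c: "c > 0"
  shows "(\<integral>\<^sup>+x. f (c *\<^sub>R x) \<partial>lborel) * ennreal (c ^ DIM('a)) = (\<integral>\<^sup>+x. f x \<partial>lborel)"
proof -
  have "(\<integral>\<^sup>+x. f x \<partial>lborel) = (\<integral>\<^sup>+x. f x \<partial>density (distr lborel borel (\<lambda>x. 0 + c *\<^sub>R x)) (\<lambda>_. ennreal (\<bar>c\<bar> ^ DIM('a))))"
    using lborel_affine[of c "0::'a"] c by simp
  also have "\<dots> = (\<integral>\<^sup>+x. ennreal (c ^ DIM('a)) * f (c *\<^sub>R x) \<partial>lborel)"
    using c by (subst nn_integral_density) (auto simp: nn_integral_distr)
  also have "\<dots> = (\<integral>\<^sup>+x. f (c *\<^sub>R x) \<partial>lborel) * ennreal (c ^ DIM('a))"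
    by (subst nn_integral_cmult) (auto simp: mult.commute)
  finally show ?thesis ..
qed

text \<open>Only segments of a fixed positive length occur; the exceptional null set may depend on it.\<close>

definition line_gradient ::
    "'a::euclidean_space set \<Rightarrow> ('a \<Rightarrow> real) \<Rightarrow> ('a \<Rightarrow> ennreal) \<Rightarrow> bool" where
  "line_gradient D v g \<longleftrightarrow> (\<forall>b\<in>Basis. \<forall>h>0. AE x in lborel.
     (\<forall>\<tau>\<in>{0..h}. x + \<tau> *\<^sub>R b \<in> D) \<longrightarrow>
     ennreal \<bar>v (x + h *\<^sub>R b) - v x\<bar> \<le> (\<integral>\<^sup>+\<tau>\<in>{0..h}. g (x + \<tau> *\<^sub>R b) \<partial>lborel))"

text \<open>Fubini in the segment parameter: for each fixed \<open>\<tau>\<close>, the translate of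
  \<open>g\<close> restricted to \<open>D\<close> has the same integral as \<open>g\<close> over
  \<open>D\<close>, and \<open>\<tau>\<close> runs through an interval of length \<open>h\<close>.
  This is the usual bound of the L1 modulus of continuity by the total variation.\<close>

lemma line_gradient_translate_pos:
  fixes v :: "'a::euclidean_space \<Rightarrow> real"
  assumes lg: "line_gradient D v g" and b: "b \<in> Basis" and h: "0 < h"
    and [measurable]: "g \<in> borel_measurable borel" "D \<in> sets borel" "A \<in> sets borel"
    and A: "\<And>x \<tau>. x \<in> A \<Longrightarrow> 0 \<le> \<tau> \<Longrightarrow> \<tau> \<le> h \<Longrightarrow> x + \<tau> *\<^sub>R b \<in> D"
  shows "(\<integral>\<^sup>+x\<in>A. ennreal \<bar>v (x + h *\<^sub>R b) - v x\<bar> \<partial>lborel) \<le> ennreal h * (\<integral>\<^sup>+x\<in>D. g x \<partial>lborel)"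
proof -
  have "(\<integral>\<^sup>+x\<in>A. ennreal \<bar>v (x + h *\<^sub>R b) - v x\<bar> \<partial>lborel)
      \<le> (\<integral>\<^sup>+x. (\<integral>\<^sup>+\<tau>. g (x + \<tau> *\<^sub>R b) * indicator D (x + \<tau> *\<^sub>R b) * indicator {0..h} \<tau> \<partial>lborel) \<partial>lborel)"
  \<comment> \<open>The factor \<open>indicator D (x + \<tau> *\<^sub>R b)\<close> equals 1 on the
    segments that start in \<open>A\<close>. It makes the integrand a translate of \<open>g\<close>
    times \<open>indicator D\<close>, so that translation invariance yields an integral over
    \<open>D\<close>.\<close>
  proof (rule nn_integral_mono_AE)
    have "AE x in lborel. (\<forall>\<tau>\<in>{0..h}. x + \<tau> *\<^sub>R b \<in> D) \<longrightarrow>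
       ennreal \<bar>v (x + h *\<^sub>R b) - v x\<bar> \<le> (\<integral>\<^sup>+\<tau>\<in>{0..h}. g (x + \<tau> *\<^sub>R b) \<partial>lborel)"
      using lg b h unfolding line_gradient_def by blast
    then show "AE x in lborel. ennreal \<bar>v (x + h *\<^sub>R b) - v x\<bar> * indicator A x
        \<le> (\<integral>\<^sup>+\<tau>. g (x + \<tau> *\<^sub>R b) * indicator D (x + \<tau> *\<^sub>R b) * indicator {0..h} \<tau> \<partial>lborel)"
    proof eventually_elim
      case (elim x)
      show ?case
      proof (cases "x \<in> A")
        case True
        then have *: "\<forall>\<tau>\<in>{0..h}. x + \<tau> *\<^sub>R b \<in> D" using A by auto
        have "ennreal \<bar>v (x + h *\<^sub>R b) - v x\<bar> * indicator A x \<le> (\<integral>\<^sup>+\<tau>\<in>{0..h}. g (x + \<tau> *\<^sub>R b) \<partial>lborel)"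
          using elim * True by simp
        also have "\<dots> = (\<integral>\<^sup>+\<tau>. g (x + \<tau> *\<^sub>R b) * indicator D (x + \<tau> *\<^sub>R b) * indicator {0..h} \<tau> \<partial>lborel)"
          using * by (intro nn_integral_cong) (auto simp: indicator_def)
        finally show ?thesis .
      qed simp
    qed
  qed
  also have "\<dots> = (\<integral>\<^sup>+\<tau>. (\<integral>\<^sup>+x. g (x + \<tau> *\<^sub>R b) * indicator D (x + \<tau> *\<^sub>R b) * indicator {0..h} \<tau> \<partial>lborel) \<partial>lborel)"
    by (rule lborel_pair.Fubini') measurable
  also have "\<dots> = (\<integral>\<^sup>+\<tau>. (\<integral>\<^sup>+x\<in>D. g x \<partial>lborel) * indicator {0..h} \<tau> \<partial>lborel)"
    by (intro nn_integral_cong)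
      (simp add: nn_integral_multc nn_integral_lborel_translate[where f="\<lambda>x. g x * indicator D x"])
  also have "\<dots> = ennreal h * (\<integral>\<^sup>+x\<in>D. g x \<partial>lborel)"
    using h by (subst nn_integral_cmult) (auto simp: mult.commute)
  finally show ?thesis .
qed

lemma nn_set_integral_shift:
  fixes f :: "'a::euclidean_space \<Rightarrow> ennreal"
  assumes [measurable]: "f \<in> borel_measurable borel" "A \<in> sets borel"
  shows "(\<integral>\<^sup>+x\<in>A. f (x + c) \<partial>lborel) = (\<integral>\<^sup>+x\<in>((\<lambda>x. x - c) -` A). f x \<partial>lborel)"
  using nn_integral_lborel_translate[of "\<lambda>x. f x * indicator A (x - c)" c]
  by (simp add: indicator_vimage)

text \<open>A negative shift is a positive one seen from its endpoint, so the base points are moved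
  from \<open>A\<close> to the translate \<open>A'\<close>. The two-sided room along
  \<open>b\<close> in the hypothesis serves both signs of \<open>h\<close>.\<close>

lemma line_gradient_translate_axis:
  fixes v :: "'a::euclidean_space \<Rightarrow> real"
  assumes lg: "line_gradient D v g" and b: "b \<in> Basis"
    and [measurable]: "v \<in> borel_measurable borel" "g \<in> borel_measurable borel" "D \<in> sets borel" "A \<in> sets borel"
    and A: "\<And>x \<tau>. x \<in> A \<Longrightarrow> \<bar>\<tau>\<bar> \<le> \<bar>h\<bar> \<Longrightarrow> x + \<tau> *\<^sub>R b \<in> D"
  shows "(\<integral>\<^sup>+x\<in>A. ennreal \<bar>v (x + h *\<^sub>R b) - v x\<bar> \<partial>lborel) \<le> ennreal \<bar>h\<bar> * (\<integral>\<^sup>+x\<in>D. g x \<partial>lborel)"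
proof (cases "0 < h \<or> h = 0")
  case True
  then show ?thesis using line_gradient_translate_pos[OF lg b, of h A] A by auto
next
  case False
  then have h: "h < 0" by simp
  define A' where "A' = (\<lambda>x. x - h *\<^sub>R b) -` A"
  have [measurable]: "A' \<in> sets borel"
    unfolding A'_def by (rule measurable_sets_borel[of _ borel]) auto
  have "(\<integral>\<^sup>+x\<in>A. ennreal \<bar>v (x + h *\<^sub>R b) - v x\<bar> \<partial>lborel)
      = (\<integral>\<^sup>+x\<in>A. (\<lambda>x. ennreal \<bar>v (x + (-h) *\<^sub>R b) - v x\<bar>) (x + h *\<^sub>R b) \<partial>lborel)"
    by (intro nn_integral_cong) (simp add: abs_minus_commute)
  also have "\<dots> = (\<integral>\<^sup>+x\<in>A'. ennreal \<bar>v (x + (-h) *\<^sub>R b) - v x\<bar> \<partial>lborel)"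
    unfolding A'_def by (rule nn_set_integral_shift) measurable
  also have "\<dots> \<le> ennreal (-h) * (\<integral>\<^sup>+x\<in>D. g x \<partial>lborel)"
  proof (rule line_gradient_translate_pos[OF lg b])
    fix x \<tau> assume "x \<in> A'" "0 \<le> \<tau>" "\<tau> \<le> - h"
    then show "x + \<tau> *\<^sub>R b \<in> D"
      using A[of "x - h *\<^sub>R b" "\<tau> + h"] h by (auto simp: A'_def algebra_simps)
  qed (use h in auto)
  finally show ?thesis using h by simp
qed

text \<open>The displacement is carried out one coordinate at a time, because
  \<open>line_gradient\<close> speaks of axis-parallel segments only. Each of the
  \<open>DIM('a)\<close> steps has length at most \<open>norm y\<close>; this gives both the factor
  and the radius of a ball that contains all intermediate points.\<close>

lemma line_gradient_translate:
  fixes v :: "'a::euclidean_space \<Rightarrow> real"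
  assumes lg: "line_gradient D v g"
    and [measurable]: "v \<in> borel_measurable borel" "g \<in> borel_measurable borel" "D \<in> sets borel" "A \<in> sets borel"
    and A: "\<And>x. x \<in> A \<Longrightarrow> cball x (DIM('a) * norm y) \<subseteq> D"
  shows "(\<integral>\<^sup>+x\<in>A. ennreal \<bar>v (x + y) - v x\<bar> \<partial>lborel) \<le> ennreal (DIM('a) * norm y) * (\<integral>\<^sup>+x\<in>D. g x \<partial>lborel)"
proof -
  define G where "G = (\<integral>\<^sup>+x\<in>D. g x \<partial>lborel)"
  \<comment> \<open>Induction over the set \<open>J\<close> of coordinates already moved; the next
    step starts at the shifted points, hence on \<open>A'\<close>.\<close>
  have *: "(\<integral>\<^sup>+x\<in>A. ennreal \<bar>v (x + (\<Sum>b\<in>J. (y \<bullet> b) *\<^sub>R b)) - v x\<bar> \<partial>lborel) \<le> ennreal (card J * norm y) * G"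
    if "finite J" "J \<subseteq> Basis" for J
    using that
  proof (induction J rule: finite_induct)
    case empty
    then show ?case by simp
  next
    case (insert b J)
    define c where "c = (\<Sum>b\<in>J. (y \<bullet> b) *\<^sub>R b)"
    define A' where "A' = (\<lambda>x. x - c) -` A"
    have [measurable]: "A' \<in> sets borel"
      unfolding A'_def by (rule measurable_sets_borel[of _ borel]) auto
    have cn: "norm c \<le> card J * norm y"
      unfolding c_def using insert.prems
      by (intro sum_norm_bound) (auto simp: Basis_le_norm subset_iff)
    have cd: "card J + 1 \<le> DIM('a)"
      using insert.hyps insert.prems card_mono[of Basis "insert b J"] by simp
    have "(\<integral>\<^sup>+x\<in>A. ennreal \<bar>v (x + (\<Sum>b\<in>insert b J. (y \<bullet> b) *\<^sub>R b)) - v x\<bar> \<partial>lborel)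
      \<le> (\<integral>\<^sup>+x. ennreal \<bar>v (x + c + (y \<bullet> b) *\<^sub>R b) - v (x + c)\<bar> * indicator A x
            + ennreal \<bar>v (x + c) - v x\<bar> * indicator A x \<partial>lborel)"
      using insert.hyps unfolding c_def
      by (intro nn_integral_mono) (auto simp: indicator_def ennreal_plus[symmetric] algebra_simps simp del: ennreal_plus intro!: ennreal_leI)
    also have "\<dots> = (\<integral>\<^sup>+x\<in>A. (\<lambda>x. ennreal \<bar>v (x + (y \<bullet> b) *\<^sub>R b) - v x\<bar>) (x + c) \<partial>lborel)
         + (\<integral>\<^sup>+x\<in>A. ennreal \<bar>v (x + c) - v x\<bar> \<partial>lborel)"
      by (subst nn_integral_add) auto
    also have "(\<integral>\<^sup>+x\<in>A. (\<lambda>x. ennreal \<bar>v (x + (y \<bullet> b) *\<^sub>R b) - v x\<bar>) (x + c) \<partial>lborel)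
        = (\<integral>\<^sup>+x\<in>A'. ennreal \<bar>v (x + (y \<bullet> b) *\<^sub>R b) - v x\<bar> \<partial>lborel)"
      unfolding A'_def by (rule nn_set_integral_shift) measurable
    also have "\<dots> \<le> ennreal \<bar>y \<bullet> b\<bar> * G"
      unfolding G_def
    proof (rule line_gradient_translate_axis[OF lg])
      fix x \<tau> assume x: "x \<in> A'" "\<bar>\<tau>\<bar> \<le> \<bar>y \<bullet> b\<bar>"
      have "norm (c + \<tau> *\<^sub>R b) \<le> card J * norm y + norm y"
        using cn x Basis_le_norm[of b y] insert.prems
        by (intro order_trans[OF norm_triangle_ineq] add_mono) auto
      also have "\<dots> = (card J + 1) * norm y" by (simp add: algebra_simps)
      also have "\<dots> \<le> DIM('a) * norm y"
        using cd by (intro mult_right_mono) (linarith | simp)+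
      finally have "norm (c + \<tau> *\<^sub>R b) \<le> DIM('a) * norm y" .
      moreover have "dist (x - c) (x + \<tau> *\<^sub>R b) = norm (c + \<tau> *\<^sub>R b)"
        unfolding dist_norm using norm_minus_cancel[of "c + \<tau> *\<^sub>R b"] by (simp add: algebra_simps)
      ultimately have "x + \<tau> *\<^sub>R b \<in> cball (x - c) (DIM('a) * norm y)" by simp
      then show "x + \<tau> *\<^sub>R b \<in> D" using A[of "x - c"] x by (auto simp: A'_def)
    qed (use insert.prems in auto)
    also have "\<dots> \<le> ennreal (norm y) * G"
      using Basis_le_norm[of b y] insert.prems by (intro mult_right_mono ennreal_leI) auto
    also have "(\<integral>\<^sup>+x\<in>A. ennreal \<bar>v (x + c) - v x\<bar> \<partial>lborel) \<le> ennreal (card J * norm y) * G"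
      using insert unfolding c_def by auto
    also have "ennreal (norm y) * G + ennreal (card J * norm y) * G = ennreal (card (insert b J) * norm y) * G"
      using insert.hyps by (simp add: ring_distribs[symmetric] ennreal_plus[symmetric] algebra_simps del: ennreal_plus)
    finally show ?case by (simp add: add_mono)
  qed
  show ?thesis using *[of Basis] by (simp add: euclidean_representation G_def)
qed

section \<open>Perimeter measured by small translations\<close>

lemma borel_ball [measurable]: "ball z r \<in> sets (borel :: 'a::metric_space measure)"
  by simp

text \<open>A finite-difference substitute for the perimeter of \<open>E\<close> in
  \<open>A\<close>. Shifts of length below \<open>\<epsilon>\<close> move a volume of order
  \<open>\<epsilon>\<close> times the perimeter, and the ball of shifts has volume of order
  \<open>\<epsilon> ^ DIM('a)\<close>; the natural normalisation is therefore division by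
  \<open>\<epsilon> ^ (DIM('a) + 1)\<close>.\<close>

definition shift_variation :: "'a::euclidean_space set \<Rightarrow> 'a set \<Rightarrow> real \<Rightarrow> ennreal" where
  "shift_variation E A \<epsilon> =
     (\<integral>\<^sup>+y\<in>ball 0 \<epsilon>. (\<integral>\<^sup>+x\<in>A. ennreal \<bar>indicat_real E (x + y) - indicat_real E x\<bar> \<partial>lborel) \<partial>lborel)"

text \<open>Superadditivity in the region: it lets the disjoint balls of a Vitali family share a
  single global bound.\<close>

lemma shift_variation_sum_le:
  fixes E :: "'a::euclidean_space set"
  assumes [measurable]: "E \<in> sets borel" and F: "finite F"
    and B[measurable]: "\<And>i. i \<in> F \<Longrightarrow> B i \<in> sets borel" and disj: "disjoint_family_on B F"
    and sub: "\<And>i. i \<in> F \<Longrightarrow> B i \<subseteq> A" and [measurable]: "A \<in> sets borel"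
  shows "(\<Sum>i\<in>F. shift_variation E (B i) \<epsilon>) \<le> shift_variation E A \<epsilon>"
proof -
  have ind: "(\<Sum>i\<in>F. indicator (B i) x) \<le> (indicator A x :: ennreal)" for x
  proof -
    have "(\<Sum>i\<in>F. indicator (B i) x) = (indicator (\<Union>i\<in>F. B i) x :: ennreal)"
      using F disj by (simp add: indicator_UN_disjoint)
    also have "\<dots> \<le> indicator A x" using sub by (auto simp: indicator_def)
    finally show ?thesis .
  qed
  have "(\<Sum>i\<in>F. shift_variation E (B i) \<epsilon>)
     = (\<integral>\<^sup>+y. (\<integral>\<^sup>+x. ennreal \<bar>indicat_real E (x + y) - indicat_real E x\<bar> * (\<Sum>i\<in>F. indicator (B i) x) \<partial>lborel) * indicator (ball 0 \<epsilon>) y \<partial>lborel)"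
    unfolding shift_variation_def sum_distrib_left
    by (subst nn_integral_sum[symmetric], measurable)
      (auto simp: nn_integral_sum sum_distrib_right intro!: nn_integral_cong)
  also have "\<dots> \<le> shift_variation E A \<epsilon>"
    unfolding shift_variation_def
    by (intro nn_integral_mono mult_mono order_refl ind) auto
  finally show ?thesis .
qed

text \<open>A long shift telescopes into \<open>n\<close> short ones, each of which costs at most
  the short shift over the larger region \<open>A'\<close>. This is how the variation at a tiny
  scale controls the geometry at a large scale.\<close>

lemma shift_steps:
  fixes E :: "'a::euclidean_space set"
  assumes [measurable]: "E \<in> sets borel" "A \<in> sets borel" "A' \<in> sets borel"
    and sub: "\<And>x i. x \<in> A \<Longrightarrow> i < n \<Longrightarrow> x + real i *\<^sub>R u \<in> A'"
  shows "(\<integral>\<^sup>+x\<in>A. ennreal \<bar>indicat_real E (x + real n *\<^sub>R u) - indicat_real E x\<bar> \<partial>lborel)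
    \<le> of_nat n * (\<integral>\<^sup>+x\<in>A'. ennreal \<bar>indicat_real E (x + u) - indicat_real E x\<bar> \<partial>lborel)"
  using sub
proof (induction n)
  case 0
  then show ?case by simp
next
  case (Suc n)
  let ?f = "indicat_real E" and ?c = "real n *\<^sub>R u"
  have "(\<integral>\<^sup>+x\<in>A. ennreal \<bar>?f (x + real (Suc n) *\<^sub>R u) - ?f x\<bar> \<partial>lborel)
    \<le> (\<integral>\<^sup>+x. ennreal \<bar>?f (x + ?c + u) - ?f (x + ?c)\<bar> * indicator A x + ennreal \<bar>?f (x + ?c) - ?f x\<bar> * indicator A x \<partial>lborel)"
    by (intro nn_integral_mono)
      (auto simp: ennreal_plus[symmetric] algebra_simps simp del: ennreal_plus split: split_indicator intro!: ennreal_leI)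
  also have "\<dots> = (\<integral>\<^sup>+x\<in>A. ennreal \<bar>?f (x + ?c + u) - ?f (x + ?c)\<bar> \<partial>lborel) + (\<integral>\<^sup>+x\<in>A. ennreal \<bar>?f (x + ?c) - ?f x\<bar> \<partial>lborel)"
    by (subst nn_integral_add) auto
  also have "(\<integral>\<^sup>+x\<in>A. ennreal \<bar>?f (x + ?c + u) - ?f (x + ?c)\<bar> \<partial>lborel)
    \<le> (\<integral>\<^sup>+x. (\<lambda>x. ennreal \<bar>?f (x + u) - ?f x\<bar> * indicator A' x) (x + ?c) \<partial>lborel)"
    using Suc.prems[of _ n] by (intro nn_integral_mono) (auto split: split_indicator)
  also have "\<dots> = (\<integral>\<^sup>+x\<in>A'. ennreal \<bar>?f (x + u) - ?f x\<bar> \<partial>lborel)"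
    by (rule nn_integral_lborel_translate) measurable
  finally show ?case
    using Suc.IH Suc.prems by (simp add: distrib_right add_mono order_trans[OF _ add_left_mono])
qed

text \<open>Dilating the displacement \<open>y\<close> by an integer factor turns the scale \<open>\<epsilon>\<close> into a scale comparable
  with \<open>r\<close>.\<close>

lemma relative_isoperimetric:
  fixes E :: "'a::euclidean_space set"
  assumes [measurable]: "E \<in> sets borel" and \<epsilon>: "0 < \<epsilon>" "\<epsilon> \<le> r"
  shows "emeasure lborel (E \<inter> ball z r) * emeasure lborel (ball z r - E)
     \<le> ennreal ((3 * r / \<epsilon>) ^ (DIM('a) + 1)) * shift_variation E (ball z (4 * r)) \<epsilon>"
proof -
  let ?f = "indicat_real E" and ?d = "DIM('a)"
  \<comment> \<open>The number of steps is such that a shift shorter than \<open>2 * r\<close>,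
    divided by \<open>N\<close>, is shorter than \<open>\<epsilon>\<close>. Rounding up costs at
    most 1, and \<open>\<epsilon> \<le> r\<close> gives
    \<open>N \<le> 3 * r / \<epsilon>\<close>.\<close>
  define N where "N = nat \<lceil>2 * r / \<epsilon>\<rceil>"
  have "0 < 2 * r / \<epsilon>" using \<epsilon> by simp
  then have N: "2 * r / \<epsilon> \<le> N" "real N \<le> 2 * r / \<epsilon> + 1" "0 < N" unfolding N_def by linarith+
  have N3: "real N \<le> 3 * r / \<epsilon>" using N(2) \<epsilon> by (simp add: field_simps)
  define \<Phi> where "\<Phi> = (\<lambda>u. \<integral>\<^sup>+x\<in>ball z (4 * r). ennreal \<bar>?f (x + u) - ?f x\<bar> \<partial>lborel)"
  have SV: "shift_variation E (ball z (4 * r)) \<epsilon> = (\<integral>\<^sup>+y\<in>ball 0 \<epsilon>. \<Phi> y \<partial>lborel)"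
    by (simp add: shift_variation_def \<Phi>_def)
  have [measurable]: "\<Phi> \<in> borel_measurable borel" unfolding \<Phi>_def by measurable
  \<comment> \<open>The product of the volumes measures the pairs (x, x + y) in the ball with x
    inside \<open>E\<close> and x + y outside; such a \<open>y\<close> is shorter than
    \<open>2 * r\<close>.\<close>
  have "emeasure lborel (E \<inter> ball z r) * emeasure lborel (ball z r - E)
    = (\<integral>\<^sup>+x. indicator (E \<inter> ball z r) x * (\<integral>\<^sup>+y. indicator (ball z r - E) y \<partial>lborel) \<partial>lborel)"
    by (subst nn_integral_multc) auto
  also have "\<dots> = (\<integral>\<^sup>+x. indicator (E \<inter> ball z r) x * (\<integral>\<^sup>+y. indicator (ball z r - E) (y + x) \<partial>lborel) \<partial>lborel)"
    by (subst nn_integral_lborel_translate) auto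
  also have "\<dots> = (\<integral>\<^sup>+x. (\<integral>\<^sup>+y. indicator (E \<inter> ball z r) x * indicator (ball z r - E) (y + x) \<partial>lborel) \<partial>lborel)"
    by (subst nn_integral_cmult) auto
  also have "\<dots> \<le> (\<integral>\<^sup>+x. (\<integral>\<^sup>+y. ennreal \<bar>?f (x + y) - ?f x\<bar> * indicator (ball z r) x * indicator (ball 0 (2 * r)) y \<partial>lborel) \<partial>lborel)"
  proof (intro nn_integral_mono)
    fix x y :: 'a
    have "y \<in> ball 0 (2 * r)" if "x \<in> ball z r" "y + x \<in> ball z r"
      using that norm_triangle_ineq4[of "y + x - z" "x - z"]
      by (simp add: dist_norm norm_minus_commute[of z])
    then show "indicator (E \<inter> ball z r) x * indicator (ball z r - E) (y + x)
      \<le> ennreal \<bar>?f (x + y) - ?f x\<bar> * indicator (ball z r) x * indicator (ball 0 (2 * r)) y"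
      by (auto simp: add.commute split: split_indicator)
  qed
  also have "\<dots> = (\<integral>\<^sup>+y. (\<integral>\<^sup>+x. ennreal \<bar>?f (x + y) - ?f x\<bar> * indicator (ball z r) x * indicator (ball 0 (2 * r)) y \<partial>lborel) \<partial>lborel)"
    by (rule lborel_pair.Fubini') measurable
  also have "\<dots> = (\<integral>\<^sup>+y\<in>ball 0 (2 * r). (\<integral>\<^sup>+x\<in>ball z r. ennreal \<bar>?f (x + y) - ?f x\<bar> \<partial>lborel) \<partial>lborel)"
    by (subst nn_integral_multc) auto
  also have "\<dots> \<le> (\<integral>\<^sup>+y. of_nat N * (\<Phi> (y /\<^sub>R N) * indicator (ball 0 \<epsilon>) (y /\<^sub>R N)) \<partial>lborel)"
  proof (intro nn_integral_mono)
    fix y :: 'a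
    show "(\<integral>\<^sup>+x\<in>ball z r. ennreal \<bar>?f (x + y) - ?f x\<bar> \<partial>lborel) * indicator (ball 0 (2 * r)) y
      \<le> of_nat N * (\<Phi> (y /\<^sub>R N) * indicator (ball 0 \<epsilon>) (y /\<^sub>R N))"
    proof (cases "y \<in> ball 0 (2 * r)")
      case True
      then have y: "norm y < 2 * r" by simp
      also have "\<dots> \<le> N * \<epsilon>" using N(1) \<epsilon> by (simp add: field_simps)
      finally have "y /\<^sub>R N \<in> ball 0 \<epsilon>" using N(3) by (simp add: field_simps)
      moreover have "(\<integral>\<^sup>+x\<in>ball z r. ennreal \<bar>?f (x + real N *\<^sub>R (y /\<^sub>R N)) - ?f x\<bar> \<partial>lborel) \<le> of_nat N * \<Phi> (y /\<^sub>R N)"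
        unfolding \<Phi>_def
      proof (rule shift_steps)
        fix x i assume x: "x \<in> ball z r" and i: "i < N"
        have "norm (real i *\<^sub>R (y /\<^sub>R N)) = (real i / real N) * norm y" by (simp add: divide_inverse)
        also have "\<dots> \<le> 1 * norm y" using i by (intro mult_right_mono) auto
        finally have "norm (real i *\<^sub>R (y /\<^sub>R N)) < 2 * r" using y by simp
        then have "dist z (x + real i *\<^sub>R (y /\<^sub>R N)) < r + 2 * r"
          using x norm_triangle_ineq4[of "z - x" "real i *\<^sub>R (y /\<^sub>R N)"]
          by (simp add: dist_norm algebra_simps)
        then show "x + real i *\<^sub>R (y /\<^sub>R N) \<in> ball z (4 * r)" using \<epsilon> by simp
      qed auto
      ultimately show ?thesis using N(3) True by simp
    qed simp
  qed
  also have "\<dots> = of_nat N * (\<integral>\<^sup>+y. \<Phi> (y /\<^sub>R N) * indicator (ball 0 \<epsilon>) (y /\<^sub>R N) \<partial>lborel)"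
    by (rule nn_integral_cmult) measurable
  also have "(\<integral>\<^sup>+y. \<Phi> (y /\<^sub>R N) * indicator (ball 0 \<epsilon>) (y /\<^sub>R N) \<partial>lborel) = shift_variation E (ball z (4 * r)) \<epsilon> * ennreal (real N ^ ?d)"
    unfolding SV using N(3) nn_integral_lborel_scale[of "\<lambda>y. \<Phi> (y /\<^sub>R N) * indicator (ball 0 \<epsilon>) (y /\<^sub>R N)" "real N"]
    by simp
  \<comment> \<open>The substitution of \<open>y /\<^sub>R N\<close> for the shift contributes
    \<open>N ^ DIM('a)\<close>, the telescoping one more factor \<open>N\<close>. Together they give
    the exponent of the normalisation of \<open>shift_variation\<close>.\<close>
  also have "of_nat N * (shift_variation E (ball z (4 * r)) \<epsilon> * ennreal (real N ^ ?d))
    = ennreal (real N ^ (?d + 1)) * shift_variation E (ball z (4 * r)) \<epsilon>"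
    by (simp add: ennreal_of_nat_eq_real_of_nat ennreal_mult mult_ac)
  also have "\<dots> \<le> ennreal ((3 * r / \<epsilon>) ^ (?d + 1)) * shift_variation E (ball z (4 * r)) \<epsilon>"
    using N3 by (intro mult_right_mono ennreal_leI power_mono) auto
  finally show ?thesis .
qed

section \<open>Coarea formula and choice of a level\<close>

lemma nn_integral_superlevel_difference:
  fixes a b :: real
  assumes "0 \<le> a" "a \<le> 1" "0 \<le> b" "b \<le> 1"
  shows "(\<integral>\<^sup>+t\<in>{0..1}. ennreal \<bar>(if t < a then 1 else 0) - (if t < b then 1 else 0 :: real)\<bar> \<partial>lborel) = ennreal \<bar>a - b\<bar>"
proof -
  have "(\<integral>\<^sup>+t\<in>{0..1}. ennreal \<bar>(if t < a then 1 else 0) - (if t < b then 1 else 0 :: real)\<bar> \<partial>lborel)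
    = (\<integral>\<^sup>+t. indicator {min a b..<max a b} t \<partial>lborel)"
    using assms by (intro nn_integral_cong) (auto split: split_indicator)
  also have "\<dots> = ennreal \<bar>a - b\<bar>" by (auto simp: min_def max_def)
  finally show ?thesis .
qed

text \<open>Integrating over the level first turns the differences of indicators into |v(x+y) -
  v(x)|. The integral of these over \<open>A\<close> is at most \<open>DIM('a) * \<epsilon>\<close>
  times the integral of \<open>g\<close>, and the ball of shifts contributes its volume.\<close>

lemma coarea_shift_variation:
  fixes v :: "'a::euclidean_space \<Rightarrow> real" and \<epsilon> :: real
  assumes lg: "line_gradient D v g"
    and [measurable]: "v \<in> borel_measurable borel" "g \<in> borel_measurable borel" "D \<in> sets borel" "A \<in> sets borel"
    and v: "\<And>x. 0 \<le> v x" "\<And>x. v x \<le> 1"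
    and A: "\<And>x. x \<in> A \<Longrightarrow> cball x (DIM('a) * \<epsilon>) \<subseteq> D" and \<epsilon>: "0 < \<epsilon>"
  shows "(\<integral>\<^sup>+t\<in>{0..1}. shift_variation {x. t < v x} A \<epsilon> \<partial>lborel)
    \<le> ennreal (unit_ball_vol DIM('a) * DIM('a) * \<epsilon> ^ (DIM('a) + 1)) * (\<integral>\<^sup>+x\<in>D. g x \<partial>lborel)"
proof -
  let ?G = "\<integral>\<^sup>+x\<in>D. g x \<partial>lborel" and ?d = "DIM('a)"
  let ?k = "\<lambda>t y x. ennreal \<bar>(if t < v (x + y) then 1 else 0) - (if t < v x then 1 else 0 :: real)\<bar>"
  have "(\<integral>\<^sup>+t\<in>{0..1}. shift_variation {x. t < v x} A \<epsilon> \<partial>lborel)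
    = (\<integral>\<^sup>+t. (\<integral>\<^sup>+y. (\<integral>\<^sup>+x. ?k t y x * indicator A x * indicator (ball 0 \<epsilon>) y * indicator {0..1} t \<partial>lborel) \<partial>lborel) \<partial>lborel)"
    unfolding shift_variation_def
    by (intro nn_integral_cong) (simp add: nn_integral_multc indicator_def of_bool_def)
  also have "\<dots> = (\<integral>\<^sup>+y. (\<integral>\<^sup>+t. (\<integral>\<^sup>+x. ?k t y x * indicator A x * indicator (ball 0 \<epsilon>) y * indicator {0..1} t \<partial>lborel) \<partial>lborel) \<partial>lborel)"
    by (rule lborel_pair.Fubini') measurable
  also have "\<dots> = (\<integral>\<^sup>+y. (\<integral>\<^sup>+x. (\<integral>\<^sup>+t. ?k t y x * indicator A x * indicator (ball 0 \<epsilon>) y * indicator {0..1} t \<partial>lborel) \<partial>lborel) \<partial>lborel)"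
    by (intro nn_integral_cong, rule lborel_pair.Fubini') measurable
  also have "\<dots> = (\<integral>\<^sup>+y. (\<integral>\<^sup>+x. ennreal \<bar>v (x + y) - v x\<bar> * indicator A x * indicator (ball 0 \<epsilon>) y \<partial>lborel) \<partial>lborel)"
  proof (intro nn_integral_cong)
    fix y x :: 'a
    have "(\<integral>\<^sup>+t. ?k t y x * indicator A x * indicator (ball 0 \<epsilon>) y * indicator {0..1} t \<partial>lborel)
      = (\<integral>\<^sup>+t. ?k t y x * indicator {0..1} t * (indicator A x * indicator (ball 0 \<epsilon>) y) \<partial>lborel)"
      by (simp add: mult_ac)
    also have "\<dots> = ennreal \<bar>v (x + y) - v x\<bar> * (indicator A x * indicator (ball 0 \<epsilon>) y)"
      using v by (subst nn_integral_multc) (auto simp: nn_integral_superlevel_difference)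
    finally show "(\<integral>\<^sup>+t. ?k t y x * indicator A x * indicator (ball 0 \<epsilon>) y * indicator {0..1} t \<partial>lborel)
      = ennreal \<bar>v (x + y) - v x\<bar> * indicator A x * indicator (ball 0 \<epsilon>) y" by (simp add: mult_ac)
  qed
  also have "\<dots> \<le> (\<integral>\<^sup>+y. (ennreal (?d * \<epsilon>) * ?G) * indicator (ball (0::'a) \<epsilon>) y \<partial>lborel)"
  proof (intro nn_integral_mono)
    fix y :: 'a
    show "(\<integral>\<^sup>+x. ennreal \<bar>v (x + y) - v x\<bar> * indicator A x * indicator (ball 0 \<epsilon>) y \<partial>lborel)
      \<le> (ennreal (?d * \<epsilon>) * ?G) * indicator (ball (0::'a) \<epsilon>) y"
    proof (cases "y \<in> ball 0 \<epsilon>")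
      case True
      then have y: "?d * norm y \<le> ?d * \<epsilon>" by (intro mult_left_mono) auto
      have "(\<integral>\<^sup>+x\<in>A. ennreal \<bar>v (x + y) - v x\<bar> \<partial>lborel) \<le> ennreal (?d * norm y) * ?G"
      proof (rule line_gradient_translate[OF lg])
        show "cball x (?d * norm y) \<subseteq> D" if "x \<in> A" for x
          using A[OF that] subset_cball[OF y, of x] by blast
      qed measurable
      also have "\<dots> \<le> ennreal (?d * \<epsilon>) * ?G" using y by (intro mult_right_mono ennreal_leI) auto
      finally show ?thesis using True by simp
    qed simp
  qed
  also have "\<dots> = ennreal (?d * \<epsilon>) * ?G * ennreal (unit_ball_vol ?d * \<epsilon> ^ ?d)"
    using \<epsilon> by (simp add: nn_integral_cmult emeasure_ball)
  also have "\<dots> = ennreal (unit_ball_vol ?d * ?d * \<epsilon> ^ (?d + 1)) * ?G"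
    using \<epsilon> by (simp add: ennreal_mult mult_ac)
  finally show ?thesis .
qed

text \<open>If \<open>f\<close> exceeded \<open>4 * C\<close> on an interval of length 1/2, its
  integral would be at least \<open>2 * C\<close>. The interval stays away from 0, so that Chebyshev
  bounds the volume of the superlevel set, and below 1, so that the set contains all points with v =
  1.\<close>

lemma exists_level:
  fixes f :: "real \<Rightarrow> ennreal"
  assumes [measurable]: "f \<in> borel_measurable borel" and f: "(\<integral>\<^sup>+t\<in>{0..1}. f t \<partial>lborel) \<le> ennreal C" and C: "0 < C"
  shows "\<exists>t\<in>{1/4<..<3/4}. f t \<le> ennreal (4 * C)"
proof (rule ccontr)
  assume "\<not> ?thesis"
  then have *: "ennreal (4 * C) \<le> f t" if "t \<in> {1/4<..<3/4}" for t using that by (auto simp: not_le less_imp_le)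
  have "ennreal (2 * C) = (\<integral>\<^sup>+t\<in>{1/4<..<3/4::real}. ennreal (4 * C) \<partial>lborel)"
  proof -
    have "emeasure lborel {1/4<..<3/4::real} = ennreal (1/2)"
      by (subst emeasure_lborel_Ioo) auto
    then have "(\<integral>\<^sup>+t\<in>{1/4<..<3/4::real}. ennreal (4 * C) \<partial>lborel) = ennreal (4 * C) * ennreal (1/2)"
      by (subst nn_integral_cmult_indicator) auto
    also have "\<dots> = ennreal (2 * C)" using C by (subst ennreal_mult[symmetric]) auto
    finally show ?thesis by simp
  qed
  also have "\<dots> \<le> (\<integral>\<^sup>+t\<in>{0..1}. f t \<partial>lborel)"
    using * by (intro nn_integral_mono) (auto split: split_indicator)
  finally show False using f C by (auto dest: order_trans simp: ennreal_le_iff)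
qed

section \<open>Ball coverings and radii of intermediate density\<close>

lemma fmeasurable_ball: "ball (z :: 'a::euclidean_space) r \<in> fmeasurable lborel"
  using emeasure_bounded_finite[OF bounded_ball, of z r] by (intro fmeasurableI) auto

lemma diameter_cball_le:
  assumes "0 \<le> r"
  shows "diameter (cball (z :: 'a::metric_space) r) \<le> 2 * r"
proof -
  have "dist x y \<le> 2 * r" if "x \<in> cball z r" "y \<in> cball z r" for x y
    using that dist_triangle3[of x y z] by simp
  then show ?thesis using assms unfolding diameter_def by (auto intro!: cSUP_least)
qed

lemma hausdorff_content_le_countable_balls:
  fixes C :: "'a::metric_space set"
  assumes C: "countable C" and r: "\<And>z. z \<in> C \<Longrightarrow> 0 \<le> r z \<and> 2 * r z \<le> \<delta>" and \<delta>: "0 \<le> \<delta>"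
    and cov: "A \<subseteq> (\<Union>z\<in>C. cball z (r z))"
    and bd: "\<And>F. finite F \<Longrightarrow> F \<subseteq> C \<Longrightarrow> (\<Sum>z\<in>F. ennreal (unit_ball_vol (real s) * r z ^ s)) \<le> M"
  shows "hausdorff_content s \<delta> A \<le> M"
proof -
  define D where "D = (\<lambda>i. if i \<in> to_nat_on C ` C then (let z = from_nat_into C i in cball z (r z)) else {})"
  have D: "D (to_nat_on C z) = cball z (r z)" if "z \<in> C" for z using that C by (simp add: D_def)
  have "hausdorff_content s \<delta> A \<le> (\<Sum>i. hausdorff_gauge s (D i))"
    unfolding hausdorff_content_def
  proof (rule INF_lower, safe)
    fix x assume "x \<in> A"
    then obtain z where "z \<in> C" "x \<in> cball z (r z)" using cov by blast
    then show "x \<in> (\<Union>i. D i)" using D by blast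
  next
    fix i
    show "bounded (D i)" by (auto simp: D_def Let_def)
    show "diameter (D i) \<le> \<delta>"
      using C r \<delta> by (auto simp: D_def Let_def intro: order_trans[OF diameter_cball_le])
  qed
  also have "\<dots> \<le> M"
  proof (rule suminf_le_const[OF summableI])
    fix n
    define F where "F = {z \<in> C. to_nat_on C z < n}"
    have inj: "inj_on (to_nat_on C) F" using inj_on_to_nat_on[OF C] by (rule inj_on_subset) (auto simp: F_def)
    have F: "finite F" by (rule finite_imageD[OF _ inj]) (auto intro: finite_subset[of _ "{..<n}"] simp: F_def)
    have "(\<Sum>i<n. hausdorff_gauge s (D i)) = (\<Sum>i\<in>to_nat_on C ` F. hausdorff_gauge s (D i))"
      by (intro sum.mono_neutral_right) (auto simp: F_def D_def hausdorff_gauge_def)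
    also have "\<dots> = (\<Sum>z\<in>F. hausdorff_gauge s (cball z (r z)))"
      using D by (subst sum.reindex[OF inj]) (auto simp: F_def)
    also have "\<dots> \<le> (\<Sum>z\<in>F. ennreal (unit_ball_vol (real s) * r z ^ s))"
    proof (intro sum_mono)
      fix z assume "z \<in> F"
      then have "0 \<le> r z" using r by (auto simp: F_def)
      moreover have "0 \<le> diameter (cball z (r z))" by (intro diameter_ge_0) simp
      moreover have "diameter (cball z (r z)) / 2 \<le> r z" using diameter_cball_le[of "r z" z] \<open>0 \<le> r z\<close> by simp
      ultimately show "hausdorff_gauge s (cball z (r z)) \<le> ennreal (unit_ball_vol (real s) * r z ^ s)"
        unfolding hausdorff_gauge_def by (auto intro!: ennreal_leI mult_left_mono power_mono)
    qed
    also have "\<dots> \<le> M" using F by (intro bd) (auto simp: F_def)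
    finally show "(\<Sum>i<n. hausdorff_gauge s (D i)) \<le> M" .
  qed
  finally show ?thesis .
qed

text \<open>The radius \<open>\<rho>\<close> is doubled until the density of \<open>E\<close> first
  drops below \<open>c\<close>. At that radius \<open>E\<close> still fills a fraction
  \<open>c\<close> of the half ball, while the complement fills at least half of the ball;
  multiplying the two volumes gives the constant.\<close>

lemma dyadic_density_radius:
  fixes E :: "'a::euclidean_space set"
  assumes E[measurable]: "E \<in> sets borel" and c: "0 < c" "c \<le> 1/2" and \<rho>: "0 < \<rho>" "\<rho> \<le> r0 / 2"
    and big: "c * measure lborel (ball z \<rho>) \<le> measure lborel (E \<inter> ball z \<rho>)"
    and small: "measure lborel (E \<inter> ball z r0) < c * (unit_ball_vol DIM('a) * (r0 / 2) ^ DIM('a))"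
  obtains r where "0 < r" "r \<le> r0"
    "ennreal (c * unit_ball_vol DIM('a) ^ 2 / 2 ^ (DIM('a) + 1) * r ^ (2 * DIM('a)))
      \<le> emeasure lborel (E \<inter> ball z r) * emeasure lborel (ball z r - E)"
proof -
  let ?d = "DIM('a)" and ?\<omega> = "unit_ball_vol DIM('a)"
  have fm: "E \<inter> ball z r \<in> fmeasurable lborel" for r
    by (intro fmeasurableI2[OF fmeasurable_ball]) auto
  have vol: "measure lborel (ball z r) = ?\<omega> * r ^ ?d" if "0 < r" for r
    using that content_ball[of r z] by simp
  have mono: "measure lborel (E \<inter> ball z r) \<le> measure lborel (E \<inter> ball z r')" if "r \<le> r'" for r r'
    using that fm by (intro measure_mono_fmeasurable) auto
  have sm: "measure lborel (E \<inter> ball z r) < c * measure lborel (ball z r)" if "r0 / 2 < r" "r \<le> r0" for r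
  proof -
    have "0 < r" using that \<rho> by linarith
    have "(r0 / 2) ^ ?d \<le> r ^ ?d" using that \<rho> by (intro power_mono) auto
    then have "c * (?\<omega> * (r0 / 2) ^ ?d) \<le> c * measure lborel (ball z r)"
      using c \<open>0 < r\<close> by (simp add: vol mult_left_mono)
    then show ?thesis using small mono[OF that(2)] by linarith
  qed
  define P where "P = (\<lambda>j::nat. measure lborel (E \<inter> ball z (2 ^ j * \<rho>)) < c * measure lborel (ball z (2 ^ j * \<rho>)))"
  \<comment> \<open>The first doubling beyond \<open>r0 / 2\<close> is still at most
    \<open>r0\<close>, and at radii between these two values \<open>small\<close> forces a density
    below \<open>c\<close>.\<close>
  have "\<exists>j. P j \<and> 2 ^ j * \<rho> \<le> r0"
  proof -
    define i where "i = (LEAST i. r0 / 2 < 2 ^ i * \<rho>)"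
    have "\<exists>i. r0 / 2 < 2 ^ i * \<rho>"
      using real_arch_pow[of 2 "r0 / 2 / \<rho>"] \<rho> by (auto simp: field_simps)
    then have i: "r0 / 2 < 2 ^ i * \<rho>" unfolding i_def by (rule LeastI_ex)
    have "i \<noteq> 0" using i \<rho> by (intro notI) simp
    then obtain i' where i': "i = Suc i'" using not0_implies_Suc by blast
    have "\<not> r0 / 2 < 2 ^ i' * \<rho>" using not_less_Least[of i' "\<lambda>i. r0 / 2 < 2 ^ i * \<rho>"] i' by (simp add: i_def)
    then have "2 ^ i * \<rho> \<le> r0" by (simp add: i')
    then show ?thesis using sm[OF i] by (auto simp: P_def)
  qed
  then obtain j0 where j0: "P j0" "2 ^ j0 * \<rho> \<le> r0" by blast
  define j where "j = (LEAST j. P j)"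
  have j: "P j" unfolding j_def using j0(1) by (rule LeastI)
  have "j \<le> j0" unfolding j_def using j0(1) by (rule Least_le)
  have "j \<noteq> 0" using j big by (intro notI) (simp add: P_def)
  then obtain j' where j': "j = Suc j'" using not0_implies_Suc by blast
  have nP: "\<not> P j'" using not_less_Least[of j' P] j' by (simp add: j_def)
  define r where "r = 2 ^ j * \<rho>"
  have r: "0 < r" "2 ^ j' * \<rho> = r / 2" using \<rho> by (simp_all add: r_def j')
  have "r \<le> 2 ^ j0 * \<rho>" unfolding r_def using \<open>j \<le> j0\<close> \<rho> by (intro mult_right_mono power_increasing) auto
  then have "r \<le> r0" using j0 by linarith
  have "c * (?\<omega> * (r / 2) ^ ?d) \<le> measure lborel (E \<inter> ball z (r / 2))"
    using nP r vol[of "r / 2"] unfolding P_def by simp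
  also have "\<dots> \<le> measure lborel (E \<inter> ball z r)" using r by (intro mono) simp
  finally have a: "c * (?\<omega> * (r / 2) ^ ?d) \<le> measure lborel (E \<inter> ball z r)" .
  have "measure lborel (E \<inter> ball z r) < c * (?\<omega> * r ^ ?d)"
    using j r vol[of r] unfolding P_def r_def by simp
  \<comment> \<open>Here \<open>c \<le> 1/2\<close> leaves at least half of the ball to the
    complement of \<open>E\<close>.\<close>
  also have "\<dots> \<le> 1/2 * (?\<omega> * r ^ ?d)" using c r by (intro mult_right_mono) auto
  finally have "measure lborel (E \<inter> ball z r) < ?\<omega> * r ^ ?d / 2" by simp
  moreover have "measure lborel (ball z r) = measure lborel (E \<inter> ball z r) + measure lborel (ball z r - E)"
  proof -
    have "(E \<inter> ball z r) \<union> ball z r = ball z r" "ball z r - (E \<inter> ball z r) = ball z r - E" by auto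
    then show ?thesis using measure_Un2[OF fm[of r] fmeasurable_ball[of z r]] by (simp only:)
  qed
  ultimately have b: "?\<omega> * r ^ ?d / 2 \<le> measure lborel (ball z r - E)" using vol[of r] r by simp
  have alg: "c * w ^ 2 / (2 * T) * (X * X) = (c * (w * (X / T))) * (w * X / 2)" for w T X :: real
    by (simp add: power2_eq_square mult_ac)
  have pw: "2 ^ (?d + 1) = (2 * 2 ^ ?d :: real)" "r ^ (2 * ?d) = r ^ ?d * r ^ ?d"
    by (simp, simp only: mult_2 power_add)
  have "c * ?\<omega> ^ 2 / 2 ^ (?d + 1) * r ^ (2 * ?d) = (c * (?\<omega> * (r / 2) ^ ?d)) * (?\<omega> * r ^ ?d / 2)"
    unfolding power_divide pw by (rule alg)
  also have "\<dots> \<le> measure lborel (E \<inter> ball z r) * measure lborel (ball z r - E)"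
    by (rule mult_mono[OF a b]) (use r(1) in simp_all)
  finally have "ennreal (c * ?\<omega> ^ 2 / 2 ^ (?d + 1) * r ^ (2 * ?d))
      \<le> ennreal (measure lborel (E \<inter> ball z r) * measure lborel (ball z r - E))"
    by (rule ennreal_leI)
  also have "\<dots> = emeasure lborel (E \<inter> ball z r) * emeasure lborel (ball z r - E)"
    unfolding emeasure_eq_measure2[OF fm] emeasure_eq_measure2[OF fmeasurable_Diff[OF fmeasurable_ball E[folded sets_lborel]]]
    by (rule ennreal_mult) auto
  finally show ?thesis using that r(1) \<open>r \<le> r0\<close> by blast
qed

text \<open>The coarea formula selects a level \<open>t\<close> at which the perimeter of
  \<open>{v > t}\<close>, measured by \<^const>\<open>shift_variation\<close> along a sequence of scales, is controlled by the
  integral of \<open>g\<close>.\<close>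

theorem boxing_inequality:
  fixes q :: "'a::euclidean_space"
  assumes R: "0 < R" and \<delta>: "0 < \<delta>" and c: "0 < c" "c \<le> 1/2"
  obtains C \<kappa>0 where "0 < C" "0 < \<kappa>0"
    "\<And>v g A \<kappa>. \<lbrakk>v \<in> borel_measurable borel; g \<in> borel_measurable borel; line_gradient (ball q R) v g;
        \<And>x. 0 \<le> v x; \<And>x. v x \<le> 1; \<And>x. x \<in> ball q R \<Longrightarrow> ennreal (v x) \<le> g x;
        (\<integral>\<^sup>+x\<in>ball q R. g x \<partial>lborel) \<le> ennreal \<kappa>; 0 < \<kappa>; \<kappa> < \<kappa>0; A \<subseteq> ball q (R / 4);
        \<And>z \<eta>. z \<in> A \<Longrightarrow> 0 < \<eta> \<Longrightarrow> \<exists>\<rho>. 0 < \<rho> \<and> \<rho> < \<eta> \<and>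
           c * measure lborel (ball z \<rho>) \<le> measure lborel ({x. v x = 1} \<inter> ball z \<rho>)\<rbrakk>
     \<Longrightarrow> hausdorff_content (DIM('a) - 1) \<delta> A \<le> ennreal (C * \<kappa>)"
proof -
  let ?d = "DIM('a)"
  let ?\<omega> = "unit_ball_vol (real ?d)" and ?\<omega>' = "unit_ball_vol (real (?d - 1))"
  have om: "0 < ?\<omega>" "0 < ?\<omega>'" by simp_all
  \<comment> \<open>The final covering uses balls of radius at most \<open>20 * r0\<close>, whose
    diameter must not exceed \<open>\<delta>\<close>. The second bound keeps balls of radius
    \<open>4 * r0\<close> around points of \<open>A\<close> inside
    \<open>ball q (R / 2)\<close>.\<close>
  define r0 where "r0 = min (\<delta> / 40) (R / 16)"
  have r0: "0 < r0" "40 * r0 \<le> \<delta>" "16 * r0 \<le> R" using R \<delta> by (auto simp: r0_def)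
  \<comment> \<open>At a level above 1/4, Chebyshev bounds the volume of the superlevel set by
    \<open>4 * \<kappa>\<close>; for \<open>\<kappa> < \<kappa>0\<close> this is the upper density
    bound at radius \<open>r0\<close> that \<open>dyadic_density_radius\<close> asks for.\<close>
  define \<kappa>0 where "\<kappa>0 = c * (?\<omega> * (r0 / 2) ^ ?d) / 4"
  \<comment> \<open>The constant of \<open>dyadic_density_radius\<close>, divided by the
    \<open>3 ^ (?d + 1)\<close> lost in \<open>relative_isoperimetric\<close>.\<close>
  define a where "a = c * ?\<omega> ^ 2 / 2 ^ (?d + 1) / 3 ^ (?d + 1)"
  have a: "0 < a" unfolding a_def using c om by (intro divide_pos_pos mult_pos_pos zero_less_power) auto
  \<comment> \<open>Normalisation of the gauge, Vitali enlargement of \<open>r\<close> to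
    \<open>20 * r\<close>, and the bound at the chosen level, divided by the isoperimetric constant
    \<open>a\<close>.\<close>
  define C where "C = ?\<omega>' * 20 ^ (?d - 1) * (4 * (?\<omega> * ?d)) / a"
  have C0: "0 < C" using om a by (simp add: C_def)
  have k0: "0 < \<kappa>0" using c om r0 by (simp add: \<kappa>0_def)
  have "hausdorff_content (?d - 1) \<delta> A \<le> ennreal (C * \<kappa>)"
    if [measurable]: "v \<in> borel_measurable borel" "g \<in> borel_measurable borel" and lg: "line_gradient (ball q R) v g"
      and v: "\<And>x. 0 \<le> v x" "\<And>x. v x \<le> 1" and vg: "\<And>x. x \<in> ball q R \<Longrightarrow> ennreal (v x) \<le> g x"
      and G: "(\<integral>\<^sup>+x\<in>ball q R. g x \<partial>lborel) \<le> ennreal \<kappa>" and \<kappa>: "0 < \<kappa>" "\<kappa> < \<kappa>0" and A: "A \<subseteq> ball q (R / 4)"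
      and dens: "\<And>z \<eta>. z \<in> A \<Longrightarrow> 0 < \<eta> \<Longrightarrow> \<exists>\<rho>. 0 < \<rho> \<and> \<rho> < \<eta> \<and>
           c * measure lborel (ball z \<rho>) \<le> measure lborel ({x. v x = 1} \<inter> ball z \<rho>)"
    for v g A \<kappa>
  proof -
    \<comment> \<open>Scales that tend to 0, with \<open>?d * e k \<le> R / 4\<close> so that all
      shifts from \<open>ball q (R / 2)\<close> remain in \<open>ball q R\<close>.\<close>
    define e where "e = (\<lambda>k::nat. R / (4 * ?d) * inverse (real (Suc k)))"
    have e0: "0 < e k" for k using R by (simp add: e_def)
    have eR: "?d * e k \<le> R / 4" for k
    proof -
      have "?d * e k = R / 4 * inverse (real (Suc k))" by (simp add: e_def)
      also have "\<dots> \<le> R / 4 * 1" using R by (intro mult_left_mono) (auto simp: field_simps)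
      finally show ?thesis by simp
    qed
    have e_lim: "e \<longlonglongrightarrow> 0"
      unfolding e_def by (rule tendsto_mult_right_zero[OF LIMSEQ_inverse_real_of_nat])
    define f where "f = (\<lambda>k t. ennreal (1 / e k ^ (?d + 1)) * shift_variation {x. t < v x} (ball q (R / 2)) (e k))"
    have [measurable]: "f k \<in> borel_measurable borel" for k
      unfolding f_def shift_variation_def indicator_def by measurable
    have fk: "(\<integral>\<^sup>+t\<in>{0..1}. f k t \<partial>lborel) \<le> ennreal (?\<omega> * ?d * \<kappa>)" for k
    proof -
      have [measurable]: "(\<lambda>t. shift_variation {x. t < v x} (ball q (R / 2)) (e k)) \<in> borel_measurable borel"
        unfolding shift_variation_def indicator_def by measurable
      have "(\<integral>\<^sup>+t\<in>{0..1}. f k t \<partial>lborel) = ennreal (1 / e k ^ (?d + 1)) * (\<integral>\<^sup>+t\<in>{0..1}. shift_variation {x. t < v x} (ball q (R / 2)) (e k) \<partial>lborel)"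
        unfolding f_def by (subst nn_integral_cmult[symmetric]) (auto simp: mult.assoc)
      also have "\<dots> \<le> ennreal (1 / e k ^ (?d + 1)) * (ennreal (?\<omega> * ?d * e k ^ (?d + 1)) * (\<integral>\<^sup>+x\<in>ball q R. g x \<partial>lborel))"
      proof (intro mult_left_mono coarea_shift_variation[OF lg])
        fix x assume "x \<in> ball q (R / 2)"
        then show "cball x (?d * e k) \<subseteq> ball q R"
        proof (intro subsetI)
          fix y assume "x \<in> ball q (R / 2)" "y \<in> cball x (?d * e k)"
          then show "y \<in> ball q R" using eR[of k] R dist_triangle[of q y x] by simp
        qed
      qed (use v e0 in auto)
      also have "\<dots> \<le> ennreal (1 / e k ^ (?d + 1)) * (ennreal (?\<omega> * ?d * e k ^ (?d + 1)) * ennreal \<kappa>)"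
        by (intro mult_left_mono G) auto
      also have "\<dots> = ennreal (1 / e k ^ (?d + 1) * (?\<omega> * ?d * e k ^ (?d + 1) * \<kappa>))"
        using e0[of k] \<kappa> om by (simp add: ennreal_mult[symmetric] less_imp_le)
      also have "1 / e k ^ (?d + 1) * (?\<omega> * ?d * e k ^ (?d + 1) * \<kappa>) = ?\<omega> * ?d * \<kappa>"
        using e0[of k] by simp
      finally show ?thesis .
    qed
    have "(\<integral>\<^sup>+t\<in>{0..1}. liminf (\<lambda>k. f k t) \<partial>lborel) \<le> (\<integral>\<^sup>+t. liminf (\<lambda>k. f k t * indicator {0..1} t) \<partial>lborel)"
      by (intro nn_integral_mono) (auto split: split_indicator)
    \<comment> \<open>Fatou's lemma: choosing a level for each scale separately would give levels
      that depend on \<open>k\<close>. Working with the liminf yields one level that serves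
      arbitrarily small scales.\<close>
    also have "\<dots> \<le> liminf (\<lambda>k. \<integral>\<^sup>+t\<in>{0..1}. f k t \<partial>lborel)"
      by (rule nn_integral_liminf) measurable
    also have "\<dots> \<le> ennreal (?\<omega> * ?d * \<kappa>)"
      by (rule Liminf_le) (use fk in auto)
    finally obtain t where t: "1/4 < t" "t < 3/4" and lt: "liminf (\<lambda>k. f k t) \<le> ennreal (4 * (?\<omega> * ?d * \<kappa>))"
      using exists_level[of "\<lambda>t. liminf (\<lambda>k. f k t)" "?\<omega> * ?d * \<kappa>"] \<kappa> om by auto
    define E where "E = {x. t < v x}"
    have [measurable]: "E \<in> sets borel" unfolding E_def by measurable
    have small: "measure lborel (E \<inter> ball z r0) < c * (?\<omega> * (r0 / 2) ^ ?d)" if "z \<in> A" for z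
    proof -
      have sub: "ball z r0 \<subseteq> ball q R"
      proof
        fix y assume "y \<in> ball z r0"
        moreover have "z \<in> ball q (R / 4)" using that A by auto
        ultimately show "y \<in> ball q R" using dist_triangle[of q y z] r0 R by auto
      qed
      have "ennreal (1/4) * emeasure lborel (E \<inter> ball z r0) = (\<integral>\<^sup>+x\<in>(E \<inter> ball z r0). ennreal (1/4) \<partial>lborel)"
        by (rule nn_integral_cmult_indicator[symmetric]) simp
      also have "\<dots> \<le> (\<integral>\<^sup>+x\<in>ball q R. g x \<partial>lborel)"
      proof (intro nn_integral_mono)
        fix x
        show "ennreal (1/4) * indicator (E \<inter> ball z r0) x \<le> g x * indicator (ball q R) x"
        proof (cases "x \<in> E \<inter> ball z r0")
          case True
          then have "ennreal (1/4) \<le> ennreal (v x)" using t by (intro ennreal_leI) (auto simp: E_def)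
          also have "\<dots> \<le> g x" using True sub by (intro vg) auto
          finally show ?thesis using True sub by (auto simp: indicator_def)
        qed simp
      qed
      finally have "ennreal (1/4) * emeasure lborel (E \<inter> ball z r0) \<le> ennreal \<kappa>" using G by simp
      moreover have "E \<inter> ball z r0 \<in> fmeasurable lborel"
        by (intro fmeasurableI2[OF fmeasurable_ball]) auto
      ultimately have "ennreal (1/4 * measure lborel (E \<inter> ball z r0)) \<le> ennreal \<kappa>"
        by (subst ennreal_mult) (auto simp: emeasure_eq_measure2)
      then have "1/4 * measure lborel (E \<inter> ball z r0) \<le> \<kappa>" using \<kappa> by (subst (asm) ennreal_le_iff) auto
      then show ?thesis using \<kappa>(2) by (simp add: \<kappa>0_def)
    qed
    have "\<exists>r. 0 < r \<and> r \<le> r0 \<and> ennreal (c * ?\<omega> ^ 2 / 2 ^ (?d + 1) * r ^ (2 * ?d))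
      \<le> emeasure lborel (E \<inter> ball z r) * emeasure lborel (ball z r - E)" if z: "z \<in> A" for z
    proof -
      obtain \<rho> where \<rho>: "0 < \<rho>" "\<rho> < r0 / 2"
        "c * measure lborel (ball z \<rho>) \<le> measure lborel ({x. v x = 1} \<inter> ball z \<rho>)"
        using dens[OF z, of "r0 / 2"] r0 by auto
      have "measure lborel ({x. v x = 1} \<inter> ball z \<rho>) \<le> measure lborel (E \<inter> ball z \<rho>)"
        by (intro measure_mono_fmeasurable fmeasurableI2[OF fmeasurable_ball[of z \<rho>]]) (use t in \<open>auto simp: E_def\<close>)
      then have "c * measure lborel (ball z \<rho>) \<le> measure lborel (E \<inter> ball z \<rho>)" using \<rho> by linarith
      then show ?thesis
        using dyadic_density_radius[OF _ c \<rho>(1) _ _ small[OF z]] \<rho> by (metis less_imp_le \<open>E \<in> sets borel\<close>)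
    qed
    then obtain r where r: "\<And>z. z \<in> A \<Longrightarrow> 0 < r z" "\<And>z. z \<in> A \<Longrightarrow> r z \<le> r0"
      "\<And>z. z \<in> A \<Longrightarrow> ennreal (c * ?\<omega> ^ 2 / 2 ^ (?d + 1) * r z ^ (2 * ?d))
      \<le> emeasure lborel (E \<inter> ball z (r z)) * emeasure lborel (ball z (r z) - E)" by metis
    \<comment> \<open>The volume product is of order r^(2d) and the isoperimetric factor of order
      (r/\<epsilon>)^(d+1); the quotient leaves r^(d-1), the quantity summed in the Hausdorff
      content.\<close>
    have key: "ennreal (a * r z ^ (?d - 1)) \<le> ennreal (1 / \<epsilon> ^ (?d + 1)) * shift_variation E (ball z (4 * r z)) \<epsilon>"
      if z: "z \<in> A" and \<epsilon>: "0 < \<epsilon>" "\<epsilon> \<le> r z" for z \<epsilon>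
    proof -
      have rz: "0 < r z" by (rule r(1)[OF z])
      have "2 * ?d = (?d - 1) + (?d + 1)" using DIM_positive[where 'a='a] by linarith
      then have p1: "r z ^ (2 * ?d) = r z ^ (?d - 1) * r z ^ (?d + 1)" by (metis power_add)
      have alg: "K / T * X = 1 / (T * Y) * (K * (X * Y))" if "Y \<noteq> 0" for K T X Y :: real
        using that by simp
      have "a * r z ^ (?d - 1) = 1 / (3 * r z) ^ (?d + 1) * (c * ?\<omega> ^ 2 / 2 ^ (?d + 1) * r z ^ (2 * ?d))"
        unfolding a_def p1 power_mult_distrib by (rule alg) (use rz in simp)
      then have "ennreal (a * r z ^ (?d - 1)) = ennreal (1 / (3 * r z) ^ (?d + 1)) * ennreal (c * ?\<omega> ^ 2 / 2 ^ (?d + 1) * r z ^ (2 * ?d))"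
        using rz c by (subst ennreal_mult[symmetric]) auto
      also have "\<dots> \<le> ennreal (1 / (3 * r z) ^ (?d + 1)) * (ennreal ((3 * r z / \<epsilon>) ^ (?d + 1)) * shift_variation E (ball z (4 * r z)) \<epsilon>)"
        by (intro mult_left_mono order_trans[OF r(3)[OF z]] relative_isoperimetric \<epsilon>) auto
      also have "\<dots> = ennreal (1 / (3 * r z) ^ (?d + 1) * (3 * r z / \<epsilon>) ^ (?d + 1)) * shift_variation E (ball z (4 * r z)) \<epsilon>"
        using rz \<epsilon> by (subst ennreal_mult) (auto simp: mult.assoc)
      also have "1 / (3 * r z) ^ (?d + 1) * (3 * r z / \<epsilon>) ^ (?d + 1) = 1 / \<epsilon> ^ (?d + 1)"
        using rz \<epsilon> by (simp add: power_divide)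
      finally show ?thesis .
    qed
    \<comment> \<open>Vitali is applied to the balls of radius \<open>4 * r z\<close>, since these
      are the regions over which \<open>key\<close> measures the variation and they have to be
      disjoint.\<close>
    have "A \<subseteq> (\<Union>z\<in>A. cball z (4 * r z))" using r(1) by force
    then obtain V where V: "countable V" "V \<subseteq> A"
      "pairwise (\<lambda>i j. disjnt (cball i (4 * r i)) (cball j (4 * r j))) V"
      "A \<subseteq> (\<Union>z\<in>V. cball z (5 * (4 * r z)))"
      using Vitali_covering_lemma_cballs[where S = A and K = A and a = "\<lambda>z. z" and r = "\<lambda>z. 4 * r z" and B = "4 * r0"] r(1,2) by auto
    show ?thesis
    proof (rule hausdorff_content_le_countable_balls[OF V(1) _ _ V(4)])
      fix z assume "z \<in> V"
      then show "0 \<le> 5 * (4 * r z) \<and> 2 * (5 * (4 * r z)) \<le> \<delta>"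
        using r(1)[of z] r(2)[of z] r0 V(2) by auto
    next
      fix F assume F: "finite F" "F \<subseteq> V"
      then have FA: "F \<subseteq> A" using V by blast
      have nn: "0 \<le> r z" if "z \<in> F" for z using that FA r(1) by (auto intro: less_imp_le)
      have disj: "disjoint_family_on (\<lambda>z. ball z (4 * r z)) F"
        using V(3) F(2) unfolding disjoint_family_on_def pairwise_def disjnt_def
        by (meson ball_subset_cball disjoint_iff subsetD)
      have Fsub: "ball z (4 * r z) \<subseteq> ball q (R / 2)" if "z \<in> F" for z
      proof
        fix x assume "x \<in> ball z (4 * r z)"
        moreover have "z \<in> ball q (R / 4)" using that FA A by auto
        moreover have "4 * r z \<le> R / 4" using r(2)[of z] r0 that FA by auto
        ultimately show "x \<in> ball q (R / 2)" using dist_triangle[of q x z] by auto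
      qed
      have "ennreal (\<Sum>z\<in>F. a * r z ^ (?d - 1)) \<le> f k t" if k: "\<And>z. z \<in> F \<Longrightarrow> e k \<le> r z" for k
      proof -
        have "ennreal (\<Sum>z\<in>F. a * r z ^ (?d - 1)) = (\<Sum>z\<in>F. ennreal (a * r z ^ (?d - 1)))"
          using nn a by (intro sum_ennreal[symmetric] mult_nonneg_nonneg zero_le_power) auto
        also have "\<dots> \<le> (\<Sum>z\<in>F. ennreal (1 / e k ^ (?d + 1)) * shift_variation E (ball z (4 * r z)) (e k))"
          using FA e0 k by (intro sum_mono key) auto
        also have "\<dots> = ennreal (1 / e k ^ (?d + 1)) * (\<Sum>z\<in>F. shift_variation E (ball z (4 * r z)) (e k))"
          by (simp add: sum_distrib_left)
        also have "\<dots> \<le> ennreal (1 / e k ^ (?d + 1)) * shift_variation E (ball q (R / 2)) (e k)"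
          using F disj Fsub by (intro mult_left_mono shift_variation_sum_le) auto
        finally show ?thesis by (simp add: f_def E_def)
      qed
      \<comment> \<open>\<open>key\<close> requires the scale to be below the radius. A finite
        family has a smallest radius, so this holds for all large \<open>k\<close>, and the bound on
        the liminf then applies.\<close>
      moreover have "\<forall>\<^sub>F k in sequentially. \<forall>z\<in>F. e k \<le> r z"
      proof (intro eventually_ball_finite ballI F(1))
        fix z assume "z \<in> F"
        then have "\<forall>\<^sub>F k in sequentially. e k < r z"
          using FA r(1) by (intro order_tendstoD(2)[OF e_lim]) auto
        then show "\<forall>\<^sub>F k in sequentially. e k \<le> r z" by (rule eventually_mono) simp
      qed
      ultimately have "\<forall>\<^sub>F k in sequentially. ennreal (\<Sum>z\<in>F. a * r z ^ (?d - 1)) \<le> f k t"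
        by (auto elim!: eventually_mono)
      then have "ennreal (\<Sum>z\<in>F. a * r z ^ (?d - 1)) \<le> ennreal (4 * (?\<omega> * ?d * \<kappa>))"
        by (rule order_trans[OF Liminf_bounded lt])
      then have le: "(\<Sum>z\<in>F. a * r z ^ (?d - 1)) \<le> 4 * (?\<omega> * ?d * \<kappa>)"
        by (subst (asm) ennreal_le_iff) (use \<kappa> om in \<open>simp_all add: less_imp_le\<close>)
      have "(\<Sum>z\<in>F. ennreal (?\<omega>' * (5 * (4 * r z)) ^ (?d - 1))) = ennreal (\<Sum>z\<in>F. ?\<omega>' * (5 * (4 * r z)) ^ (?d - 1))"
        using nn om by (intro sum_ennreal mult_nonneg_nonneg zero_le_power) auto
      also have "(\<Sum>z\<in>F. ?\<omega>' * (5 * (4 * r z)) ^ (?d - 1)) = ?\<omega>' * 20 ^ (?d - 1) / a * (\<Sum>z\<in>F. a * r z ^ (?d - 1))"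
        unfolding sum_distrib_left
      proof (rule sum.cong[OF refl])
        fix z
        have "5 * (4 * r z) = 20 * r z" by simp
        then have p: "(5 * (4 * r z)) ^ (?d - 1) = 20 ^ (?d - 1) * r z ^ (?d - 1)"
          by (simp only: power_mult_distrib)
        show "?\<omega>' * (5 * (4 * r z)) ^ (?d - 1) = ?\<omega>' * 20 ^ (?d - 1) / a * (a * r z ^ (?d - 1))"
          unfolding p using a by simp
      qed
      also have "\<dots> \<le> ?\<omega>' * 20 ^ (?d - 1) / a * (4 * (?\<omega> * ?d * \<kappa>))"
        using a om by (intro mult_left_mono le) auto
      also have "\<dots> = C * \<kappa>" by (simp add: C_def)
      finally show "(\<Sum>z\<in>F. ennreal (?\<omega>' * (5 * (4 * r z)) ^ (?d - 1))) \<le> ennreal (C * \<kappa>)"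
        by (simp add: ennreal_leI)
    qed (use \<delta> in simp)
  qed
  with C0 k0 show thesis by (rule that)
qed

section \<open>Smooth bump functions\<close>

lemma Ck_Suc_imp_Ck: "Ck (Suc k) f \<Longrightarrow> Ck k f"
proof (induction k arbitrary: f)
  case 0
  then show ?case
    by (auto intro!: continuous_at_imp_continuous_on differentiable_imp_continuous_within)
next
  case (Suc k)
  then show ?case by (metis Ck.simps(2))
qed

lemma Ck_continuous: "Ck k f \<Longrightarrow> continuous_on UNIV f"
proof (induction k)
  case (Suc k)
  then show ?case using Ck_Suc_imp_Ck by blast
qed simp

lemma Ck_SucI:
  assumes "\<And>x. (f has_derivative f' x) (at x)" and "\<And>b. b \<in> Basis \<Longrightarrow> Ck k (\<lambda>x. f' x b)"
  shows "Ck (Suc k) f"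
proof -
  have *: "frechet_derivative f (at x) = f' x" for x
    using frechet_derivative_at[OF assms(1)[of x]] by simp
  show ?thesis
    using assms by (simp add: *) (auto simp: differentiable_def)
qed

lemma Ck_Suc_has_derivative:
  assumes "Ck (Suc k) f"
  shows "(f has_derivative frechet_derivative f (at x)) (at x)"
  using assms by (simp add: frechet_derivative_works)

lemma Ck_const: "Ck k (\<lambda>_. c)"
proof (induction k arbitrary: c)
  case (Suc k)
  show ?case by (rule Ck_SucI[where f' = "\<lambda>_ _. 0"]) (auto intro: Suc)
qed simp

lemma Ck_add: "Ck k f \<Longrightarrow> Ck k g \<Longrightarrow> Ck k (\<lambda>x. f x + g x)"
proof (induction k arbitrary: f g)
  case 0
  then show ?case by (simp add: continuous_on_add)
next
  case (Suc k)
  show ?case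
  proof (rule Ck_SucI)
    show "((\<lambda>x. f x + g x) has_derivative (\<lambda>b. frechet_derivative f (at x) b + frechet_derivative g (at x) b)) (at x)" for x
      by (intro has_derivative_add Ck_Suc_has_derivative[OF Suc.prems(1)] Ck_Suc_has_derivative[OF Suc.prems(2)])
    show "Ck k (\<lambda>x. frechet_derivative f (at x) b + frechet_derivative g (at x) b)" if "b \<in> Basis" for b
      using Suc.prems that by (intro Suc.IH) auto
  qed
qed

lemma Ck_mult: "Ck k f \<Longrightarrow> Ck k g \<Longrightarrow> Ck k (\<lambda>x. f x * g x)"
proof (induction k arbitrary: f g)
  case 0
  then show ?case by (simp add: continuous_on_mult)
next
  case (Suc k)
  show ?case
  proof (rule Ck_SucI)
    show "((\<lambda>x. f x * g x) has_derivative (\<lambda>b. f x * frechet_derivative g (at x) b + frechet_derivative f (at x) b * g x)) (at x)" for x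
      by (intro has_derivative_mult Ck_Suc_has_derivative[OF Suc.prems(1)] Ck_Suc_has_derivative[OF Suc.prems(2)])
    show "Ck k (\<lambda>x. f x * frechet_derivative g (at x) b + frechet_derivative f (at x) b * g x)" if "b \<in> Basis" for b
      using Suc.prems that by (intro Ck_add Suc.IH) (auto intro: Ck_Suc_imp_Ck simp del: Ck.simps, auto)
  qed
qed

lemma Ck_prod: "(\<And>i. i \<in> I \<Longrightarrow> Ck k (f i)) \<Longrightarrow> Ck k (\<lambda>x. \<Prod>i\<in>I. f i x)"
  by (induction I rule: infinite_finite_induct) (simp_all add: Ck_const Ck_mult)

text \<open>The derivative in direction \<open>b\<close> is again a one-variable function of the
  same affine form, times the constant \<open>b \<bullet> c\<close>; this closes the induction. All
  bumps below are products of such functions.\<close>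

lemma Ck_compose_affine:
  fixes f :: "real \<Rightarrow> real" and c :: "'a::euclidean_space"
  shows "Ck k f \<Longrightarrow> Ck k (\<lambda>x. f (x \<bullet> c + \<beta>))"
proof (induction k arbitrary: f)
  case 0
  have "continuous_on UNIV (f \<circ> (\<lambda>x. x \<bullet> c + \<beta>))"
    using 0 by (intro continuous_on_compose continuous_intros) (auto elim: continuous_on_subset)
  then show ?case by (simp add: o_def)
next
  case (Suc k)
  show ?case
  proof (rule Ck_SucI)
    fix x :: 'a
    have "((\<lambda>x. f (x \<bullet> c + \<beta>)) has_derivative (\<lambda>b. frechet_derivative f (at (x \<bullet> c + \<beta>)) (b \<bullet> c))) (at x)"
      by (rule has_derivative_compose[of "\<lambda>x. x \<bullet> c + \<beta>" "\<lambda>b. b \<bullet> c" x UNIV f])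
        (auto intro!: derivative_eq_intros Ck_Suc_has_derivative[OF Suc.prems])
    moreover have "frechet_derivative f (at (x \<bullet> c + \<beta>)) (b \<bullet> c) = frechet_derivative f (at (x \<bullet> c + \<beta>)) 1 * (b \<bullet> c)" for b
      using linear_cmul[OF has_derivative_linear[OF Ck_Suc_has_derivative[OF Suc.prems]], of _ "b \<bullet> c" 1]
      by (simp add: mult.commute)
    ultimately show "((\<lambda>x. f (x \<bullet> c + \<beta>)) has_derivative (\<lambda>b. frechet_derivative f (at (x \<bullet> c + \<beta>)) 1 * (b \<bullet> c))) (at x)"
      by simp
  next
    fix b :: 'a
    show "Ck k (\<lambda>x. frechet_derivative f (at (x \<bullet> c + \<beta>)) 1 * (b \<bullet> c))"
      using Suc.prems by (intro Ck_mult Ck_const Suc.IH[of "\<lambda>s. frechet_derivative f (at s) 1"]) simp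
  qed
qed

lemma Ck_real_SucI:
  fixes f :: "real \<Rightarrow> real"
  assumes "\<And>x. (f has_real_derivative f' x) (at x)" and "Ck k f'"
  shows "Ck (Suc k) f"
  by (rule Ck_SucI[OF assms(1)[unfolded has_field_derivative_def]]) (use assms(2) in simp)

text \<open>For \<open>p = 1\<close> this is the classical smooth step exp(-1/s). The polynomial in
  1/s makes the family closed under differentiation, so that smoothness of all orders follows by one
  induction.\<close>

definition exp_step :: "real poly \<Rightarrow> real \<Rightarrow> real" where
  "exp_step p s = (if 0 < s then exp (- (1 / s)) * poly p (1 / s) else 0)"

lemma exp_step_tendsto_0:
  fixes p :: "real poly"
  shows "((\<lambda>s. exp (- (1 / s)) * poly p (1 / s)) \<longlongrightarrow> 0) (at_right 0)"
proof -
  have *: "((\<lambda>x. exp (- x) * poly p x) \<longlongrightarrow> 0) at_top"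
  proof -
    have "((\<lambda>x. \<Sum>i\<le>degree p. coeff p i * (x ^ i / exp x)) \<longlongrightarrow> (\<Sum>i\<le>degree p. coeff p i * 0)) at_top"
      by (rule tendsto_sum, rule tendsto_mult[OF tendsto_const], rule tendsto_power_div_exp_0)
    then show ?thesis by (simp add: poly_altdef exp_minus sum_distrib_left field_simps)
  qed
  have "filterlim (\<lambda>s::real. 1 / s) at_top (at_right 0)"
    using filterlim_inverse_at_top_right by (simp add: inverse_eq_divide)
  from filterlim_compose[OF * this] show ?thesis by simp
qed

text \<open>Since (1/s)' = -(1/s)^2, differentiation replaces \<open>p\<close> by X^2 (p - p'), and
  \<open>[:0, 0, 1:]\<close> is X^2. At 0 the right difference quotient is exp(-1/s) times the
  polynomial X p at 1/s, which tends to 0.\<close>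

lemma exp_step_has_derivative:
  "(exp_step p has_real_derivative exp_step ([:0, 0, 1:] * (p - pderiv p)) s) (at s)"
proof -
  consider "0 < s" | "s < 0" | "s = 0" by linarith
  then show ?thesis
  proof cases
    case 1
    have "((\<lambda>s. exp (- (1 / s)) * poly p (1 / s)) has_real_derivative exp_step ([:0, 0, 1:] * (p - pderiv p)) s) (at s)"
    proof -
      have d: "((\<lambda>s. 1 / s) has_real_derivative - (1 / s\<^sup>2)) (at s)"
        using 1 by (auto intro!: derivative_eq_intros simp: power2_eq_square)
      have "((\<lambda>s. exp (- (1 / s)) * poly p (1 / s)) has_real_derivative
          exp (- (1 / s)) * - (- (1 / s\<^sup>2)) * poly p (1 / s) + poly (pderiv p) (1 / s) * - (1 / s\<^sup>2) * exp (- (1 / s))) (at s)"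
        by (intro DERIV_mult DERIV_chain2[OF poly_DERIV d] DERIV_chain2[OF DERIV_exp DERIV_minus[OF d]])
      then show ?thesis using 1 by (simp add: exp_step_def algebra_simps power2_eq_square)
    qed
    then show ?thesis
      by (rule DERIV_cong_ev[THEN iffD1, rotated -1])
        (use 1 in \<open>auto intro!: eventually_nhds_in_open[THEN eventually_mono, of "{0<..}"] simp: exp_step_def\<close>)
  next
    case 2
    have "((\<lambda>s. 0) has_real_derivative exp_step ([:0, 0, 1:] * (p - pderiv p)) s) (at s)"
      using 2 by (auto simp: exp_step_def)
    then show ?thesis
      by (rule DERIV_cong_ev[THEN iffD1, rotated -1])
        (use 2 in \<open>auto intro!: eventually_nhds_in_open[THEN eventually_mono, of "{..<0}"] simp: exp_step_def\<close>)
  next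
    case 3
    have "((\<lambda>y. (exp_step p y - exp_step p 0) / (y - 0)) \<longlongrightarrow> 0) (at_right 0)"
    proof (rule Lim_transform_eventually[OF exp_step_tendsto_0[of "[:0, 1:] * p"]])
      show "\<forall>\<^sub>F s in at_right 0. exp (- (1 / s)) * poly ([:0, 1:] * p) (1 / s) = (exp_step p s - exp_step p 0) / (s - 0)"
        by (auto simp: eventually_at_filter exp_step_def)
    qed
    moreover have "((\<lambda>y. (exp_step p y - exp_step p 0) / (y - 0)) \<longlongrightarrow> 0) (at_left 0)"
      by (rule Lim_transform_eventually[OF tendsto_const]) (auto simp: eventually_at_filter exp_step_def)
    ultimately have "((\<lambda>y. (exp_step p y - exp_step p 0) / (y - 0)) \<longlongrightarrow> 0) (at 0)"
      by (simp add: filterlim_split_at_real)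
    then show ?thesis using 3 by (simp add: has_field_derivative_iff exp_step_def)
  qed
qed

lemma Ck_exp_step: "Ck k (exp_step p)"
proof (induction k arbitrary: p)
  case 0
  show ?case
    using exp_step_has_derivative[THEN DERIV_isCont] by (auto intro: continuous_at_imp_continuous_on)
next
  case (Suc k)
  show ?case by (rule Ck_real_SucI[OF exp_step_has_derivative Suc])
qed

text \<open>Dilation by \<open>n\<close> sharpens both steps to indicators of half-lines while the
  support stays in the closed interval for every \<open>n\<close>, so the approximation of the
  indicator is from inside.\<close>

definition interval_bump :: "real \<Rightarrow> real \<Rightarrow> nat \<Rightarrow> real \<Rightarrow> real" where
  "interval_bump \<alpha> \<beta> n s = exp_step 1 (real n * (s - \<alpha>)) * exp_step 1 (real n * (\<beta> - s))"

lemma Ck_interval_bump: "Ck k (interval_bump \<alpha> \<beta> n)"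
proof -
  have "Ck k (\<lambda>s::real. exp_step 1 (s \<bullet> real n + - real n * \<alpha>) * exp_step 1 (s \<bullet> (- real n) + real n * \<beta>))"
    by (intro Ck_mult Ck_compose_affine Ck_exp_step)
  then show ?thesis by (simp add: interval_bump_def[abs_def] algebra_simps)
qed

lemma exp_step_1_bounds: "0 \<le> exp_step 1 s" "exp_step 1 s \<le> 1"
  by (auto simp: exp_step_def)

lemma interval_bump_bounds: "0 \<le> interval_bump \<alpha> \<beta> n s" "interval_bump \<alpha> \<beta> n s \<le> 1"
  unfolding interval_bump_def using exp_step_1_bounds by (auto intro: mult_le_one)

lemma interval_bump_eq_0: "s \<notin> {\<alpha><..<\<beta>} \<Longrightarrow> interval_bump \<alpha> \<beta> n s = 0"
  by (auto simp: interval_bump_def exp_step_def zero_less_mult_iff)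

lemma interval_bump_tendsto: "(\<lambda>n. interval_bump \<alpha> \<beta> n s) \<longlonglongrightarrow> indicator {\<alpha><..<\<beta>} s"
proof (cases "s \<in> {\<alpha><..<\<beta>}")
  case True
  have *: "(\<lambda>n. exp_step 1 (real n * c)) \<longlonglongrightarrow> 1" if "0 < c" for c
  proof -
    have "(\<lambda>n. exp (- ((1 / c) * inverse (real n)))) \<longlonglongrightarrow> exp (- ((1 / c) * 0))"
      by (intro tendsto_intros lim_inverse_n)
    then have "(\<lambda>n. exp (- ((1 / c) * inverse (real n)))) \<longlonglongrightarrow> 1" by simp
    then show ?thesis
      by (rule Lim_transform_eventually) (use that in \<open>auto simp: eventually_sequentially exp_step_def field_simps intro!: exI[of _ 1]\<close>)
  qed
  have "(\<lambda>n. interval_bump \<alpha> \<beta> n s) \<longlonglongrightarrow> 1 * 1"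
    unfolding interval_bump_def using True by (intro tendsto_mult *) auto
  then show ?thesis using True by simp
qed (simp add: interval_bump_eq_0)

section \<open>Weak derivatives along lines\<close>

text \<open>With \<open>F\<close> the restriction of \<open>f\<close> to the open box, the measures
  with densities F+ and F- agree on the intersection-stable system of open boxes, hence everywhere;
  uniqueness of densities gives F+ = F-. The boundary of the box is a null set.\<close>

lemma AE_zero_of_box_integrals:
  fixes f :: "'a::euclidean_space \<Rightarrow> real"
  assumes [measurable]: "f \<in> borel_measurable borel" and int: "set_integrable lborel (cbox a c) f"
    and zero: "\<And>a' c'. cbox a' c' \<subseteq> cbox a c \<Longrightarrow> (LBINT x:box a' c'. f x) = 0"
  shows "AE x in lborel. x \<in> cbox a c \<longrightarrow> f x = 0"
proof -
  define F where "F = (\<lambda>x. indicator (box a c) x * f x)"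
  have F: "integrable lborel F"
    using set_integrable_subset[OF int, of "box a c"] box_subset_cbox[of a c]
    by (simp add: set_integrable_def F_def)
  then have [measurable]: "F \<in> borel_measurable borel" by auto
  \<comment> \<open>\<open>ennreal\<close> sends negative reals to 0, so these densities are the
    positive and the negative part of \<open>F\<close>.\<close>
  have "density lborel (\<lambda>x. ennreal (F x)) = density lborel (\<lambda>x. ennreal (- F x))"
  proof (rule measure_eqI_generator_eq[where E = "range (\<lambda>(a, b). box a b)" and \<Omega> = UNIV and A = "\<lambda>n::nat. box (- (real n *\<^sub>R One)) (real n *\<^sub>R One)"])
    show "Int_stable (range (\<lambda>(a, b). box a b :: 'a set))"
      by (auto simp: Int_stable_def box_Int_box)
  next
    fix X :: "'a set" assume "X \<in> range (\<lambda>(a, b). box a b)"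
    then obtain u w where X: "X = box u w" by auto
    have i0: "integral\<^sup>L lborel (\<lambda>x. indicator X x * F x) = 0"
    proof -
      obtain u' w' where b: "box u w \<inter> box a c = box u' w'" using box_Int_box by blast
      show ?thesis
      proof (cases "box u' w' = {}")
        case True
        then have "x \<notin> box u w \<or> x \<notin> box a c" for x using b by blast
        then have "(\<lambda>x. indicator X x * F x) = (\<lambda>_. 0)"
          unfolding X F_def by (intro ext) (auto split: split_indicator)
        then show ?thesis by simp
      next
        case False
        have "box u' w' \<subseteq> cbox a c" using b box_subset_cbox[of a c] by (metis Int_lower2 order_trans)
        then have "cbox u' w' \<subseteq> cbox a c"
          using closure_minimal[of "box u' w'" "cbox a c"] closure_box[OF False] closed_cbox by metis
        from zero[OF this] have "(LBINT x:box u' w'. f x) = 0" .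
        moreover have "(\<lambda>x. indicator X x * F x) = (\<lambda>x. indicator (box u' w') x *\<^sub>R f x)"
          by (simp add: F_def X flip: b) (auto simp: indicator_def)
        ultimately show ?thesis by (simp add: set_lebesgue_integral_def)
      qed
    qed
    have XF: "integrable lborel (\<lambda>x. indicator X x * F x)"
      using integrable_mult_indicator[OF _ F, of X] X by simp
    have fin: "(\<integral>\<^sup>+x. ennreal (indicator X x * F x) \<partial>lborel) \<noteq> \<infinity>" "(\<integral>\<^sup>+x. ennreal (- (indicator X x * F x)) \<partial>lborel) \<noteq> \<infinity>"
      using XF by (auto simp: real_integrable_def)
    have "(\<integral>\<^sup>+x. ennreal (indicator X x * F x) \<partial>lborel) = (\<integral>\<^sup>+x. ennreal (- (indicator X x * F x)) \<partial>lborel)"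
    proof -
      let ?A = "\<integral>\<^sup>+x. ennreal (indicator X x * F x) \<partial>lborel" and ?B = "\<integral>\<^sup>+x. ennreal (- (indicator X x * F x)) \<partial>lborel"
      have e: "enn2real ?A = enn2real ?B"
        using i0 real_lebesgue_integral_def[OF XF] by linarith
      have "?A = ennreal (enn2real ?A)" using fin(1) by (simp add: less_top)
      also have "\<dots> = ennreal (enn2real ?B)" unfolding e ..
      also have "\<dots> = ?B" using fin(2) by (simp add: less_top)
      finally show ?thesis .
    qed
    moreover have "emeasure (density lborel (\<lambda>x. ennreal (F x))) X = (\<integral>\<^sup>+x. ennreal (indicator X x * F x) \<partial>lborel)"
      using X by (subst emeasure_density) (auto intro!: nn_integral_cong split: split_indicator)
    moreover have "emeasure (density lborel (\<lambda>x. ennreal (- F x))) X = (\<integral>\<^sup>+x. ennreal (- (indicator X x * F x)) \<partial>lborel)"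
      using X by (subst emeasure_density) (auto intro!: nn_integral_cong split: split_indicator)
    ultimately show "emeasure (density lborel (\<lambda>x. ennreal (F x))) X = emeasure (density lborel (\<lambda>x. ennreal (- F x))) X"
      by simp
  next
    show "(\<Union>n. box (- (real n *\<^sub>R One)) (real n *\<^sub>R One)) = (UNIV :: 'a set)"
      by (rule UN_box_eq_UNIV)
    show "emeasure (density lborel (\<lambda>x. ennreal (F x))) (box (- (real n *\<^sub>R One)) (real n *\<^sub>R One)) \<noteq> \<infinity>" for n
    proof -
      have "(\<integral>\<^sup>+x. ennreal (F x) * indicator (box (- (real n *\<^sub>R One)) (real n *\<^sub>R One)) x \<partial>lborel) \<le> (\<integral>\<^sup>+x. ennreal (F x) \<partial>lborel)"
        by (intro nn_integral_mono) (auto split: split_indicator)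
      also have "\<dots> < \<infinity>" using F by (auto simp: real_integrable_def less_top)
      finally show ?thesis by (simp add: emeasure_density)
    qed
  qed (auto simp: borel_eq_box)
  then have "AE x in lborel. ennreal (F x) = ennreal (- F x)"
    by (intro sigma_finite_measure.density_unique[OF sigma_finite_lborel]) auto
  moreover have "AE x in lborel. x \<notin> cbox a c - box a c"
  proof (rule AE_not_in)
    show "cbox a c - box a c \<in> null_sets lborel"
      using negligible_frontier_interval[of a c] by (simp add: negligible_iff_null_sets null_sets_completion_iff)
  qed
  ultimately show ?thesis
  proof eventually_elim
    case (elim x)
    show ?case
    proof
      assume "x \<in> cbox a c"
      then have "F x = f x" using elim by (simp add: F_def)
      moreover have "F x = 0" using elim(1) by (cases "F x" "0::real" rule: linorder_cases) (auto simp: ennreal_neg)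
      ultimately show "f x = 0" by simp
    qed
  qed
qed

lemma AE_zero_on_open:
  fixes f :: "'a::euclidean_space \<Rightarrow> real"
  assumes f: "f \<in> borel_measurable borel" and W: "open W"
    and int: "\<And>a c. cbox a c \<subseteq> W \<Longrightarrow> set_integrable lborel (cbox a c) f"
    and zero: "\<And>a c. cbox a c \<subseteq> W \<Longrightarrow> (LBINT x:box a c. f x) = 0"
  shows "AE x in lborel. x \<in> W \<longrightarrow> f x = 0"
proof -
  obtain D where D: "countable D" "D \<subseteq> Pow W" "\<And>X. X \<in> D \<Longrightarrow> \<exists>a b. X = cbox a b" "\<Union>D = W"
    using open_countable_Union_open_cbox[OF W] by metis
  have "AE x in lborel. \<forall>X\<in>D. x \<in> X \<longrightarrow> f x = 0"
    unfolding AE_ball_countable[OF D(1)]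
  proof
    fix X assume X: "X \<in> D"
    then obtain a c where Xac: "X = cbox a c" using D(3) by blast
    have "cbox a c \<subseteq> W" using X Xac D(2) by blast
    then show "AE x in lborel. x \<in> X \<longrightarrow> f x = 0"
      unfolding Xac by (intro AE_zero_of_box_integrals f int zero) (blast intro: order_trans)+
  qed
  then show ?thesis by eventually_elim (use D(4) in blast)
qed

lemma lebesgue_integral_lborel_translate:
  fixes f :: "'a::euclidean_space \<Rightarrow> real"
  assumes [measurable]: "f \<in> borel_measurable borel"
  shows "(LINT x|lborel. f (x + c)) = (LINT x|lborel. f x)"
proof -
  have "(LINT x|lborel. f x) = (LINT x|distr lborel borel ((+) c). f x)"
    by (simp add: lborel_distr_plus)
  also have "\<dots> = (LINT x|lborel. f (x + c))"
    by (subst integral_distr) (auto simp: add.commute)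
  finally show ?thesis ..
qed

definition box_bump :: "'a::euclidean_space \<Rightarrow> 'a \<Rightarrow> nat \<Rightarrow> 'a \<Rightarrow> real" where
  "box_bump a c n x = (\<Prod>i\<in>Basis. interval_bump (a \<bullet> i) (c \<bullet> i) n (x \<bullet> i))"

lemma interval_bump_measurable [measurable]: "interval_bump \<alpha> \<beta> n \<in> borel_measurable borel"
  by (intro borel_measurable_continuous_onI Ck_continuous[OF Ck_interval_bump])

lemma box_bump_measurable [measurable]: "box_bump a c n \<in> borel_measurable borel"
  unfolding box_bump_def by measurable

lemma box_bump_bounds: "0 \<le> box_bump a c n x" "box_bump a c n x \<le> 1"
  unfolding box_bump_def using interval_bump_bounds by (auto intro!: prod_nonneg prod_le_1)

lemma box_bump_eq_0: "x \<notin> box a c \<Longrightarrow> box_bump a c n x = 0"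
  unfolding box_bump_def by (auto simp: mem_box intro!: prod_zero interval_bump_eq_0)

lemma box_bump_tendsto: "(\<lambda>n. box_bump a c n x) \<longlonglongrightarrow> indicator (box a c) x"
proof -
  have "(\<lambda>n. box_bump a c n x) \<longlonglongrightarrow> (\<Prod>i\<in>Basis. indicator {a \<bullet> i<..<c \<bullet> i} (x \<bullet> i))"
    unfolding box_bump_def by (intro tendsto_prod interval_bump_tendsto)
  also have "(\<Prod>i\<in>Basis. indicator {a \<bullet> i<..<c \<bullet> i} (x \<bullet> i)) = (indicator (box a c) x :: real)"
  proof (cases "x \<in> box a c")
    case True
    then show ?thesis by (auto simp: mem_box intro!: prod.neutral)
  next
    case False
    then obtain i where "i \<in> Basis" "x \<bullet> i \<notin> {a \<bullet> i<..<c \<bullet> i}" by (auto simp: mem_box)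
    then show ?thesis using False by (subst prod_zero) (auto simp: indicator_def)
  qed
  finally show ?thesis .
qed

text \<open>The bump is averaged over the translations along \<open>b\<close>, so that the derivative of the average
  in the direction \<open>b\<close> telescopes to a difference of two translates.\<close>

lemma exists_smeared_bump:
  fixes a c b :: "'a::euclidean_space"
  assumes b: "b \<in> Basis" and h: "0 < h"
  obtains \<eta> where "\<And>k. Ck k \<eta>"
    "\<And>x. \<eta> x = (LBINT \<tau>:{0..h}. box_bump a c n (x - \<tau> *\<^sub>R b))"
    "\<And>x. frechet_derivative \<eta> (at x) b = box_bump a c n x - box_bump a c n (x - h *\<^sub>R b)"
proof -
  define \<rho> where "\<rho> = interval_bump (a \<bullet> b) (c \<bullet> b) n"
  define Q where "Q = (\<lambda>x. \<Prod>i\<in>Basis - {b}. interval_bump (a \<bullet> i) (c \<bullet> i) n (x \<bullet> i))"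
  have bb: "box_bump a c n x = Q x * \<rho> (x \<bullet> b)" for x
    unfolding box_bump_def Q_def \<rho>_def using b by (simp add: prod.remove mult.commute)
  have Q_shift: "Q (x + s *\<^sub>R b) = Q x" for x s
    unfolding Q_def using b by (intro prod.cong) (auto simp: inner_add_left inner_Basis)
  have Q_minus: "Q (x - s *\<^sub>R b) = Q x" for x s
    using Q_shift[of x "-s"] by simp
  have contU: "continuous_on UNIV \<rho>"
    unfolding \<rho>_def by (rule Ck_continuous[OF Ck_interval_bump])
  then have cont: "isCont \<rho> s" for s by (simp add: continuous_on_eq_continuous_at)
  obtain P where P: "\<And>s. (P has_vector_derivative \<rho> s) (at s)"
    using einterval_antiderivative[of "-\<infinity>" "\<infinity>" \<rho>] cont by auto
  then have P': "(P has_real_derivative \<rho> s) (at s)" for s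
    by (simp add: has_real_derivative_iff_has_vector_derivative)
  have CP: "Ck k P" for k
  proof (cases k)
    case 0
    then show ?thesis using DERIV_isCont[OF P'] by (auto intro: continuous_at_imp_continuous_on)
  next
    case (Suc j)
    then show ?thesis by (auto simp: \<rho>_def intro!: Ck_real_SucI[OF P'[unfolded \<rho>_def]] Ck_interval_bump simp del: Ck.simps)
  qed
  have CQ: "Ck k Q" for k
    unfolding Q_def
    using Ck_compose_affine[OF Ck_interval_bump, where \<beta> = 0] by (intro Ck_prod) simp
  \<comment> \<open>\<open>P\<close> is an antiderivative of the profile in direction
    \<open>b\<close>, and \<open>Q\<close> is constant along \<open>b\<close>. Averaging the bump
    over translations by 0 to \<open>h\<close> thus leaves a difference of two values of
    \<open>P\<close>, a form that is visibly smooth.\<close>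
  define \<eta> where "\<eta> = (\<lambda>x. Q x * (P (x \<bullet> b + 0) + (-1) * P (x \<bullet> b + - h)))"
  have C\<eta>: "Ck k \<eta>" for k
    unfolding \<eta>_def by (intro Ck_mult Ck_add Ck_const CQ Ck_compose_affine CP)
  show thesis
  proof (rule that[of \<eta>])
    fix x :: 'a
    have "((\<lambda>\<tau>. - P (x \<bullet> b - \<tau>)) has_real_derivative \<rho> (x \<bullet> b - \<tau>)) (at \<tau>)" for \<tau>
    proof -
      have "((\<lambda>\<tau>. x \<bullet> b - \<tau>) has_real_derivative - 1) (at \<tau>)"
        by (auto intro!: derivative_eq_intros)
      from DERIV_minus[OF DERIV_chain2[OF P' this]] show ?thesis by simp
    qed
    then have d: "((\<lambda>\<tau>. - P (x \<bullet> b - \<tau>)) has_vector_derivative \<rho> (x \<bullet> b - \<tau>)) (at \<tau> within {0..h})" for \<tau>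
      by (simp add: has_real_derivative_iff_has_vector_derivative has_vector_derivative_at_within)
    have "continuous_on {0..h} (\<lambda>\<tau>. \<rho> (x \<bullet> b - \<tau>))"
      by (rule continuous_on_compose2[OF contU]) (auto intro!: continuous_intros)
    then have "(LINT \<tau>|lborel. indicator {0..h} \<tau> *\<^sub>R \<rho> (x \<bullet> b - \<tau>)) = - P (x \<bullet> b - h) - - P (x \<bullet> b - 0)"
      using h d by (intro integral_FTC_Icc) auto
    then have "(LBINT \<tau>:{0..h}. \<rho> (x \<bullet> b - \<tau>)) = P (x \<bullet> b) - P (x \<bullet> b - h)"
      by (simp add: set_lebesgue_integral_def)
    then show "\<eta> x = (LBINT \<tau>:{0..h}. box_bump a c n (x - \<tau> *\<^sub>R b))"
      using b by (simp add: bb Q_minus \<eta>_def inner_diff_left)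
  next
    fix x :: 'a
    let ?l = "\<lambda>s. x + s *\<^sub>R b"
    have "(\<eta> has_derivative frechet_derivative \<eta> (at (?l 0))) (at (?l 0))"
      by (rule Ck_Suc_has_derivative[OF C\<eta>])
    moreover have "(?l has_derivative (\<lambda>s. s *\<^sub>R b)) (at 0)"
      by (auto intro!: derivative_eq_intros)
    ultimately have "((\<lambda>s. \<eta> (?l s)) has_derivative (\<lambda>s. frechet_derivative \<eta> (at (?l 0)) (s *\<^sub>R b))) (at 0)"
      by (rule has_derivative_compose[rotated])
    then have 1: "((\<lambda>s. \<eta> (?l s)) has_derivative (\<lambda>s. frechet_derivative \<eta> (at x) (s *\<^sub>R b))) (at 0)"
      by simp
    have l: "\<eta> (?l s) = Q x * (P (x \<bullet> b + s) - P (x \<bullet> b + s - h))" for s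
      using b by (simp add: \<eta>_def Q_shift inner_add_left)
    have "((\<lambda>s. Q x * (P (x \<bullet> b + s) - P (x \<bullet> b + s - h))) has_real_derivative Q x * (\<rho> (x \<bullet> b + 0) * 1 - \<rho> (x \<bullet> b + 0 - h) * 1)) (at 0)"
      by (intro DERIV_cmult DERIV_diff DERIV_chain2[OF P']) (auto intro!: derivative_eq_intros)
    then have 2: "((\<lambda>s. \<eta> (?l s)) has_derivative (\<lambda>s. Q x * (\<rho> (x \<bullet> b) - \<rho> (x \<bullet> b - h)) * s)) (at 0)"
      by (simp add: l has_field_derivative_def)
    have "frechet_derivative \<eta> (at x) (1 *\<^sub>R b) = Q x * (\<rho> (x \<bullet> b) - \<rho> (x \<bullet> b - h)) * 1"
      using fun_cong[OF has_derivative_unique[OF 1 2], of 1] .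
    then show "frechet_derivative \<eta> (at x) b = box_bump a c n x - box_bump a c n (x - h *\<^sub>R b)"
      using b by (simp add: bb Q_minus inner_diff_left algebra_simps)
  qed (rule C\<eta>)
qed

lemma integrable_mult_bump:
  fixes f :: "'a::euclidean_space \<Rightarrow> real"
  assumes [measurable]: "f \<in> borel_measurable borel" and "set_integrable lborel (cbox a c) f"
  shows "integrable lborel (\<lambda>x. box_bump a c n x * f x)"
proof (rule Bochner_Integration.integrable_bound[OF assms(2)[unfolded set_integrable_def]])
  show "AE x in lborel. norm (box_bump a c n x * f x) \<le> norm (indicat_real (cbox a c) x *\<^sub>R f x)"
  proof (rule AE_I2)
    fix x
    show "norm (box_bump a c n x * f x) \<le> norm (indicat_real (cbox a c) x *\<^sub>R f x)"
      using box_bump_bounds[of a c n x] box_bump_eq_0[of x a c n] box_subset_cbox[of a c]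
      by (cases "x \<in> box a c") (auto simp: abs_mult mult_left_le_one_le)
  qed
qed measurable

text \<open>Testing the weak derivative with \<^const>\<open>box_bump\<close>s smeared along \<open>b\<close> and letting them
  tend to the indicator of a box.\<close>

lemma weak_derivative_shift:
  fixes u g :: "'a::euclidean_space \<Rightarrow> real"
  assumes \<Omega>: "open \<Omega>" and b: "b \<in> Basis" and h: "0 < h"
    and [measurable]: "u \<in> borel_measurable borel" "g \<in> borel_measurable borel"
    and u: "\<And>K. compact K \<Longrightarrow> K \<subseteq> \<Omega> \<Longrightarrow> set_integrable lborel K u"
    and g: "\<And>K. compact K \<Longrightarrow> K \<subseteq> \<Omega> \<Longrightarrow> set_integrable lborel K g"
    and weak: "\<And>\<eta>. test_function \<Omega> \<eta> \<Longrightarrow>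
      (LINT x|lborel. u x * frechet_derivative \<eta> (at x) b) = - (LINT x|lborel. g x * \<eta> x)"
  shows "AE x in lborel. (\<forall>\<tau>\<in>{0..h}. x + \<tau> *\<^sub>R b \<in> \<Omega>) \<longrightarrow>
     u (x + h *\<^sub>R b) - u x - (LBINT \<tau>:{0..h}. g (x + \<tau> *\<^sub>R b)) = 0"
proof -
  define W where "W = {x. \<forall>\<tau>\<in>{0..h}. x + \<tau> *\<^sub>R b \<in> \<Omega>}"
  define G where "G = (\<lambda>x. LBINT \<tau>:{0..h}. g (x + \<tau> *\<^sub>R b))"
  define F where "F = (\<lambda>x. u (x + h *\<^sub>R b) - u x - G x)"
  have [measurable]: "G \<in> borel_measurable borel"
    unfolding G_def set_lebesgue_integral_def by measurable
  have F_meas[measurable]: "F \<in> borel_measurable borel" unfolding F_def by measurable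
  \<comment> \<open>The complement of \<open>W\<close> consists of the differences of points of the
    closed set \<open>- \<Omega>\<close> and points of a compact segment, and such a set is
    closed.\<close>
  have W: "open W"
  proof -
    have "W = - ((\<lambda>(y, \<tau>). y - \<tau> *\<^sub>R b) ` ((- \<Omega>) \<times> {0..h}))"
    proof -
      have "x \<in> (\<lambda>(y, \<tau>). y - \<tau> *\<^sub>R b) ` ((- \<Omega>) \<times> {0..h}) \<longleftrightarrow> (\<exists>\<tau>\<in>{0..h}. x + \<tau> *\<^sub>R b \<notin> \<Omega>)" for x
      proof
        assume "\<exists>\<tau>\<in>{0..h}. x + \<tau> *\<^sub>R b \<notin> \<Omega>"
        then obtain \<tau> where "\<tau> \<in> {0..h}" "x + \<tau> *\<^sub>R b \<notin> \<Omega>" by blast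
        then show "x \<in> (\<lambda>(y, \<tau>). y - \<tau> *\<^sub>R b) ` ((- \<Omega>) \<times> {0..h})"
          by (intro image_eqI[of _ _ "(x + \<tau> *\<^sub>R b, \<tau>)"]) auto
      next
        assume "x \<in> (\<lambda>(y, \<tau>). y - \<tau> *\<^sub>R b) ` ((- \<Omega>) \<times> {0..h})"
        then obtain y \<tau> where y: "y \<notin> \<Omega>" "\<tau> \<in> {0..h}" "x = y - \<tau> *\<^sub>R b" by auto
        then have "x + \<tau> *\<^sub>R b \<notin> \<Omega>" by simp
        then show "\<exists>\<tau>\<in>{0..h}. x + \<tau> *\<^sub>R b \<notin> \<Omega>" using y(2) by (rule bexI)
      qed
      then show ?thesis by (auto simp: W_def)
    qed
    moreover have "closed ((\<lambda>(y, \<tau>). y - \<tau> *\<^sub>R b) ` ((- \<Omega>) \<times> {0..h}))"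
    proof -
      have "closed (\<Union>y\<in>- \<Omega>. \<Union>z\<in>(\<lambda>\<tau>. \<tau> *\<^sub>R b) ` {0..h}. {y - z})"
        using \<Omega> by (intro closed_compact_differences closed_Compl[OF \<Omega>] compact_continuous_image) (auto intro!: continuous_intros)
      moreover have "(\<lambda>(y, \<tau>). y - \<tau> *\<^sub>R b) ` ((- \<Omega>) \<times> {0..h}) = (\<Union>y\<in>- \<Omega>. \<Union>z\<in>(\<lambda>\<tau>. \<tau> *\<^sub>R b) ` {0..h}. {y - z})"
        by (auto simp: image_iff)
      ultimately show ?thesis by simp
    qed
    ultimately show ?thesis by (simp add: open_Compl)
  qed
  have main: "set_integrable lborel (cbox a c) F \<and> (LBINT x:box a c. F x) = 0" if sub: "cbox a c \<subseteq> W" for a c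
  proof -
    \<comment> \<open>The region swept out by the box along the segments. It is a compact part of
      \<Omega> that contains the support of every smeared bump, and all integrability is taken from
      it.\<close>
    define Kc where "Kc = (\<lambda>(x, \<tau>). x + \<tau> *\<^sub>R b) ` (cbox a c \<times> {0..h})"
    have Kc: "compact Kc" unfolding Kc_def
      by (intro compact_continuous_image compact_Times) (auto intro!: continuous_intros simp: split_def)
    have KcO: "Kc \<subseteq> \<Omega>" using sub by (auto simp: Kc_def W_def)
    have [measurable]: "Kc \<in> sets borel" using Kc by (simp add: borel_compact)
    have KcI: "x + \<tau> *\<^sub>R b \<in> Kc" if "x \<in> cbox a c" "0 \<le> \<tau>" "\<tau> \<le> h" for x \<tau>
      unfolding Kc_def using that by force
    have uK: "set_integrable lborel Kc u" and gK: "set_integrable lborel Kc g"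
      using u g Kc KcO by blast+
    have c0: "cbox a c \<subseteq> Kc" using KcI[of _ 0] h by auto
    have u0: "set_integrable lborel (cbox a c) u"
      by (rule set_integrable_subset[OF uK]) (use c0 in auto)
    have u1: "set_integrable lborel (cbox a c) (\<lambda>x. u (x + h *\<^sub>R b))"
    proof -
      have "integrable lborel (\<lambda>x. indicator Kc (x + h *\<^sub>R b) *\<^sub>R u (x + h *\<^sub>R b))"
      proof -
        have "integrable (distr lborel borel ((+) (h *\<^sub>R b))) (\<lambda>x. indicator Kc x *\<^sub>R u x)"
          using uK by (simp add: lborel_distr_plus set_integrable_def)
        then show ?thesis by (subst (asm) integrable_distr_eq) (auto simp: add.commute)
      qed
      then show ?thesis
        unfolding set_integrable_def
      proof (rule Bochner_Integration.integrable_bound)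
        show "AE x in lborel. norm (indicat_real (cbox a c) x *\<^sub>R u (x + h *\<^sub>R b)) \<le> norm (indicat_real Kc (x + h *\<^sub>R b) *\<^sub>R u (x + h *\<^sub>R b))"
          using KcI[of _ h] h by (intro AE_I2) (auto split: split_indicator)
      qed measurable
    qed
    have int3: "integrable (lborel \<Otimes>\<^sub>M lborel) (\<lambda>(x, \<tau>). indicator (cbox a c) x * (indicator {0..h} \<tau> * g (x + \<tau> *\<^sub>R b)))"
    proof (rule integrableI_bounded)
      have "(\<integral>\<^sup>+p. ennreal (norm (case p of (x, \<tau>) \<Rightarrow> indicator (cbox a c) x * (indicator {0..h} \<tau> * g (x + \<tau> *\<^sub>R b)))) \<partial>(lborel \<Otimes>\<^sub>M lborel))
        = (\<integral>\<^sup>+\<tau>. (\<integral>\<^sup>+x. ennreal (norm (indicator (cbox a c) x * (indicator {0..h} \<tau> * g (x + \<tau> *\<^sub>R b)))) \<partial>lborel) \<partial>lborel)"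
        by (subst lborel_pair.nn_integral_snd[symmetric]) auto
      also have "\<dots> \<le> (\<integral>\<^sup>+\<tau>. (\<integral>\<^sup>+x. indicator {0..h} \<tau> * (\<lambda>x. ennreal (norm (indicator Kc x *\<^sub>R g x))) (x + \<tau> *\<^sub>R b) \<partial>lborel) \<partial>lborel)"
        using KcI by (intro nn_integral_mono) (auto split: split_indicator)
      also have "\<dots> = (\<integral>\<^sup>+\<tau>. indicator {0..h} \<tau> * (\<integral>\<^sup>+x. ennreal (norm (indicator Kc x *\<^sub>R g x)) \<partial>lborel) \<partial>lborel)"
        by (subst nn_integral_cmult) (auto intro!: nn_integral_cong simp: nn_integral_lborel_translate[where f = "\<lambda>x. ennreal (norm (indicator Kc x *\<^sub>R g x))", simplified])
      also have "\<dots> = ennreal h * (\<integral>\<^sup>+x. ennreal (norm (indicator Kc x *\<^sub>R g x)) \<partial>lborel)"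
        using h by (subst nn_integral_multc) auto
      also have "\<dots> < \<infinity>"
        using gK unfolding set_integrable_def integrable_iff_bounded by (auto simp: ennreal_mult_less_top)
      finally show "(\<integral>\<^sup>+p. ennreal (norm (case p of (x, \<tau>) \<Rightarrow> indicator (cbox a c) x * (indicator {0..h} \<tau> * g (x + \<tau> *\<^sub>R b)))) \<partial>(lborel \<Otimes>\<^sub>M lborel)) < \<infinity>" .
    qed measurable
    have G0: "set_integrable lborel (cbox a c) G"
      using lborel_pair.integrable_fst'[OF int3] by (simp add: set_integrable_def G_def set_lebesgue_integral_def)
    have F0: "set_integrable lborel (cbox a c) F"
      unfolding F_def by (intro set_integral_diff u0 u1 G0)
    have zero: "(LINT x|lborel. box_bump a c n x * F x) = 0" for n
    proof -
      let ?\<psi> = "box_bump a c n"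
      obtain \<eta> where \<eta>: "\<And>k. Ck k \<eta>" "\<And>x. \<eta> x = (LBINT \<tau>:{0..h}. ?\<psi> (x - \<tau> *\<^sub>R b))"
        "\<And>x. frechet_derivative \<eta> (at x) b = ?\<psi> x - ?\<psi> (x - h *\<^sub>R b)"
        using exists_smeared_bump[OF b h] by blast
      have supp: "closure {x. \<eta> x \<noteq> 0} \<subseteq> Kc"
      proof (rule closure_minimal)
        show "{x. \<eta> x \<noteq> 0} \<subseteq> Kc"
        proof (rule ccontr)
          assume "\<not> ?thesis"
          then obtain x where x: "\<eta> x \<noteq> 0" "x \<notin> Kc" by blast
          have "?\<psi> (x - \<tau> *\<^sub>R b) = 0" if "\<tau> \<in> {0..h}" for \<tau>
            using KcI[of "x - \<tau> *\<^sub>R b" \<tau>] x(2) that box_subset_cbox[of a c] by (intro box_bump_eq_0) auto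
          then have "(\<lambda>\<tau>. indicat_real {0..h} \<tau> *\<^sub>R ?\<psi> (x - \<tau> *\<^sub>R b)) = (\<lambda>_. 0)"
            by (intro ext) (auto split: split_indicator)
          then have "\<eta> x = 0" by (simp add: \<eta>(2) set_lebesgue_integral_def)
          then show False using x by simp
        qed
      qed (rule compact_imp_closed[OF Kc])
      then have "test_function \<Omega> \<eta>"
        using \<eta>(1) KcO Kc compact_Int_closed[OF Kc closed_closure, of "{x. \<eta> x \<noteq> 0}"]
        by (auto simp: test_function_def Int_absorb1)
      \<comment> \<open>Moving the translations from the bump to \<open>u\<close> (giving A) and to
        \<open>g\<close> (giving B) transforms this identity into the vanishing of the integral of
        the bump times \<open>F\<close>.\<close>
      from weak[OF this] have w: "(LINT x|lborel. u x * (?\<psi> x - ?\<psi> (x - h *\<^sub>R b))) = - (LINT x|lborel. g x * \<eta> x)"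
        by (simp add: \<eta>(3))
      have i0: "integrable lborel (\<lambda>x. ?\<psi> x * u x)" by (rule integrable_mult_bump[OF _ u0]) simp
      have i1: "integrable lborel (\<lambda>x. ?\<psi> x * u (x + h *\<^sub>R b))" by (rule integrable_mult_bump[OF _ u1]) measurable
      have i2: "integrable lborel (\<lambda>x. ?\<psi> x * G x)" by (rule integrable_mult_bump[OF _ G0]) simp
      have i1': "integrable lborel (\<lambda>x. ?\<psi> (x - h *\<^sub>R b) * u x)"
      proof -
        have "integrable (distr lborel borel ((+) (- h *\<^sub>R b))) (\<lambda>x. ?\<psi> x * u (x + h *\<^sub>R b))"
          using i1 by (simp add: lborel_distr_plus)
        then show ?thesis by (subst (asm) integrable_distr_eq) auto
      qed
      have "(LINT x|lborel. u x * (?\<psi> x - ?\<psi> (x - h *\<^sub>R b))) = (LINT x|lborel. ?\<psi> x * u x - ?\<psi> (x - h *\<^sub>R b) * u x)"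
        by (simp add: algebra_simps)
      also have "\<dots> = (LINT x|lborel. ?\<psi> x * u x) - (LINT x|lborel. ?\<psi> (x - h *\<^sub>R b) * u x)"
        by (rule Bochner_Integration.integral_diff[OF i0 i1'])
      also have "(LINT x|lborel. ?\<psi> (x - h *\<^sub>R b) * u x) = (LINT x|lborel. ?\<psi> x * u (x + h *\<^sub>R b))"
        using lebesgue_integral_lborel_translate[of "\<lambda>x. ?\<psi> (x - h *\<^sub>R b) * u x" "h *\<^sub>R b"] by simp
      finally have A: "(LINT x|lborel. u x * (?\<psi> x - ?\<psi> (x - h *\<^sub>R b))) = (LINT x|lborel. ?\<psi> x * u x) - (LINT x|lborel. ?\<psi> x * u (x + h *\<^sub>R b))" .
      have f2: "integrable (lborel \<Otimes>\<^sub>M lborel) (\<lambda>(x, \<tau>). ?\<psi> x * (indicator {0..h} \<tau> * g (x + \<tau> *\<^sub>R b)))"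
      proof (rule Bochner_Integration.integrable_bound[OF int3])
        show "AE p in lborel \<Otimes>\<^sub>M lborel. norm (case p of (x, \<tau>) \<Rightarrow> ?\<psi> x * (indicat_real {0..h} \<tau> * g (x + \<tau> *\<^sub>R b)))
          \<le> norm (case p of (x, \<tau>) \<Rightarrow> indicator (cbox a c) x * (indicator {0..h} \<tau> * g (x + \<tau> *\<^sub>R b)))"
        proof (rule AE_I2)
          fix p :: "'a \<times> real"
          obtain x \<tau> where p: "p = (x, \<tau>)" by (cases p)
          have "\<bar>?\<psi> x\<bar> \<le> \<bar>indicator (cbox a c) x :: real\<bar>"
            using box_bump_bounds[of a c n x] box_bump_eq_0[of x a c n] box_subset_cbox[of a c]
            by (cases "x \<in> box a c") auto
          then show "norm (case p of (x, \<tau>) \<Rightarrow> ?\<psi> x * (indicat_real {0..h} \<tau> * g (x + \<tau> *\<^sub>R b)))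
          \<le> norm (case p of (x, \<tau>) \<Rightarrow> indicator (cbox a c) x * (indicator {0..h} \<tau> * g (x + \<tau> *\<^sub>R b)))"
            by (simp add: p abs_mult mult_right_mono)
        qed
      qed measurable
      \<comment> \<open>For each fixed \<open>\<tau>\<close> a translation by
        \<open>\<tau> *\<^sub>R b\<close> turns this integrand into that of \<open>f2\<close>, so
        both have the same absolute integral.\<close>
      have f1: "integrable (lborel \<Otimes>\<^sub>M lborel) (\<lambda>(x, \<tau>). g x * (indicator {0..h} \<tau> * ?\<psi> (x - \<tau> *\<^sub>R b)))"
      proof (rule integrableI_bounded)
        have "(\<integral>\<^sup>+p. ennreal (norm (case p of (x, \<tau>) \<Rightarrow> g x * (indicat_real {0..h} \<tau> * ?\<psi> (x - \<tau> *\<^sub>R b)))) \<partial>(lborel \<Otimes>\<^sub>M lborel))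
          = (\<integral>\<^sup>+\<tau>. (\<integral>\<^sup>+x. ennreal (norm (g x * (indicat_real {0..h} \<tau> * ?\<psi> (x - \<tau> *\<^sub>R b)))) \<partial>lborel) \<partial>lborel)"
          by (subst lborel_pair.nn_integral_snd[symmetric]) auto
        also have "\<dots> = (\<integral>\<^sup>+\<tau>. (\<integral>\<^sup>+x. ennreal (norm (?\<psi> x * (indicat_real {0..h} \<tau> * g (x + \<tau> *\<^sub>R b)))) \<partial>lborel) \<partial>lborel)"
        proof (rule nn_integral_cong)
          fix \<tau> :: real
          have "(\<lambda>x. ennreal (norm (g x * (indicat_real {0..h} \<tau> * ?\<psi> (x - \<tau> *\<^sub>R b))))) \<in> borel_measurable borel"
            by measurable
          from nn_integral_lborel_translate[OF this, of "\<tau> *\<^sub>R b"]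
          show "(\<integral>\<^sup>+x. ennreal (norm (g x * (indicat_real {0..h} \<tau> * ?\<psi> (x - \<tau> *\<^sub>R b)))) \<partial>lborel)
            = (\<integral>\<^sup>+x. ennreal (norm (?\<psi> x * (indicat_real {0..h} \<tau> * g (x + \<tau> *\<^sub>R b)))) \<partial>lborel)"
            by (simp add: mult_ac)
        qed
        also have "\<dots> = (\<integral>\<^sup>+p. ennreal (norm (case p of (x, \<tau>) \<Rightarrow> ?\<psi> x * (indicat_real {0..h} \<tau> * g (x + \<tau> *\<^sub>R b)))) \<partial>(lborel \<Otimes>\<^sub>M lborel))"
          by (subst lborel_pair.nn_integral_snd[symmetric]) auto
        also have "\<dots> < \<infinity>" using f2 unfolding integrable_iff_bounded by blast
        finally show "(\<integral>\<^sup>+p. ennreal (norm (case p of (x, \<tau>) \<Rightarrow> g x * (indicat_real {0..h} \<tau> * ?\<psi> (x - \<tau> *\<^sub>R b)))) \<partial>(lborel \<Otimes>\<^sub>M lborel)) < \<infinity>" .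
      qed measurable
      have "(LINT x|lborel. g x * \<eta> x) = (LINT x|lborel. (LINT \<tau>|lborel. g x * (indicator {0..h} \<tau> * ?\<psi> (x - \<tau> *\<^sub>R b))))"
        by (simp add: \<eta>(2) set_lebesgue_integral_def)
      also have "\<dots> = (LINT \<tau>|lborel. (LINT x|lborel. g x * (indicator {0..h} \<tau> * ?\<psi> (x - \<tau> *\<^sub>R b))))"
        by (rule lborel_pair.Fubini_integral[symmetric, OF f1])
      also have "\<dots> = (LINT \<tau>|lborel. (LINT x|lborel. ?\<psi> x * (indicator {0..h} \<tau> * g (x + \<tau> *\<^sub>R b))))"
      proof (rule Bochner_Integration.integral_cong[OF refl])
        fix \<tau> :: real
        have "(\<lambda>x. g x * (indicator {0..h} \<tau> * ?\<psi> (x - \<tau> *\<^sub>R b))) \<in> borel_measurable borel"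
          by measurable
        from lebesgue_integral_lborel_translate[OF this, of "\<tau> *\<^sub>R b"]
        show "(LINT x|lborel. g x * (indicator {0..h} \<tau> * ?\<psi> (x - \<tau> *\<^sub>R b))) = (LINT x|lborel. ?\<psi> x * (indicator {0..h} \<tau> * g (x + \<tau> *\<^sub>R b)))"
          by (simp add: mult_ac)
      qed
      also have "\<dots> = (LINT x|lborel. (LINT \<tau>|lborel. ?\<psi> x * (indicator {0..h} \<tau> * g (x + \<tau> *\<^sub>R b))))"
        by (rule lborel_pair.Fubini_integral[OF f2])
      also have "\<dots> = (LINT x|lborel. ?\<psi> x * G x)"
        by (simp add: G_def set_lebesgue_integral_def)
      finally have B: "(LINT x|lborel. g x * \<eta> x) = (LINT x|lborel. ?\<psi> x * G x)" .
      have "(LINT x|lborel. ?\<psi> x * F x) = (LINT (x::'a)|lborel. (?\<psi> x * u (x + h *\<^sub>R b) - ?\<psi> x * u x) - ?\<psi> x * G x)"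
        by (simp add: F_def algebra_simps)
      also have "\<dots> = (LINT x|lborel. ?\<psi> x * u (x + h *\<^sub>R b)) - (LINT x|lborel. ?\<psi> x * u x) - (LINT x|lborel. ?\<psi> x * G x)"
        by (subst Bochner_Integration.integral_diff[OF Bochner_Integration.integrable_diff[OF i1 i0] i2], subst Bochner_Integration.integral_diff[OF i1 i0]) simp
      also have "\<dots> = 0" using w A B by linarith
      finally show ?thesis .
    qed
    have "(\<lambda>n. LINT x|lborel. box_bump a c n x * F x) \<longlonglongrightarrow> (LINT x|lborel. indicator (box a c) x * F x)"
    proof (rule integral_dominated_convergence)
      show "integrable lborel (\<lambda>x. indicator (cbox a c) x * \<bar>F x\<bar>)"
        using integrable_abs[OF F0[unfolded set_integrable_def]] by (simp add: abs_mult)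
      show "AE x in lborel. (\<lambda>n. box_bump a c n x * F x) \<longlonglongrightarrow> indicator (box a c) x * F x"
        by (intro AE_I2 tendsto_mult box_bump_tendsto tendsto_const)
      show "AE x in lborel. norm (box_bump a c n x * F x) \<le> indicator (cbox a c) x * \<bar>F x\<bar>" for n
      proof (rule AE_I2)
        fix x
        show "norm (box_bump a c n x * F x) \<le> indicator (cbox a c) x * \<bar>F x\<bar>"
          using box_bump_bounds[of a c n x] box_bump_eq_0[of x a c n] box_subset_cbox[of a c]
          by (cases "x \<in> box a c") (auto simp: abs_mult mult_left_le_one_le)
      qed
    qed measurable
    then have "(LINT x|lborel. indicator (box a c) x * F x) = 0"
      by (simp add: zero LIMSEQ_const_iff)
    then show ?thesis using F0 by (simp add: set_lebesgue_integral_def)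
  qed
  have "AE x in lborel. x \<in> W \<longrightarrow> F x = 0"
    by (rule AE_zero_on_open[OF F_meas W]) (use main in blast)+
  then show ?thesis by (simp add: W_def F_def G_def)
qed

section \<open>Removing the jumps at the boundary\<close>

text \<open>The exit time is the infimum of the closed set of parameters outside \<Omega>. It
  belongs to that set, and as a limit of inside parameters it is mapped to the closure, hence to the
  boundary.\<close>

lemma first_exit:
  fixes \<gamma> :: "real \<Rightarrow> 'a::euclidean_space"
  assumes \<Omega>: "open \<Omega>" and \<gamma>: "continuous_on {s..t} \<gamma>" and s: "s \<le> t" "\<gamma> s \<in> \<Omega>"
    and ex: "\<exists>\<tau>\<in>{s..t}. \<gamma> \<tau> \<notin> \<Omega>"
  obtains e where "s < e" "e \<le> t" "\<gamma> e \<notin> \<Omega>" "\<gamma> e \<in> frontier \<Omega>" "\<And>\<tau>. s \<le> \<tau> \<Longrightarrow> \<tau> < e \<Longrightarrow> \<gamma> \<tau> \<in> \<Omega>"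
proof -
  define X where "X = {s..t} \<inter> \<gamma> -` (- \<Omega>)"
  have X: "closed X" "X \<noteq> {}" "bdd_below X"
    using continuous_closed_preimage[OF \<gamma>] \<Omega> ex by (auto simp: X_def bdd_below_def intro!: closed_Compl)
  define e where "e = Inf X"
  have e: "e \<in> X" unfolding e_def by (rule closed_contains_Inf[OF X(2,3,1)])
  have e': "s \<le> e" "e \<le> t" "\<gamma> e \<notin> \<Omega>" using e by (auto simp: X_def)
  have lt: "s < e" using e' s by (cases "s = e") auto
  have ins: "\<gamma> \<tau> \<in> \<Omega>" if "s \<le> \<tau>" "\<tau> < e" for \<tau>
    using cInf_lower[OF _ X(3), of \<tau>] that e' by (force simp: X_def e_def)
  have "\<gamma> ` closure {s..<e} \<subseteq> closure \<Omega>"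
  proof (rule image_closure_subset)
    show "continuous_on (closure {s..<e}) \<gamma>"
      using lt e' by (intro continuous_on_subset[OF \<gamma>]) auto
    show "\<gamma> ` {s..<e} \<subseteq> closure \<Omega>" using ins closure_subset by fastforce
  qed simp
  then have "\<gamma> e \<in> closure \<Omega>" using lt by auto
  then have "\<gamma> e \<in> frontier \<Omega>" using e' \<Omega> by (simp add: frontier_def interior_open)
  then show thesis using that lt e' ins by blast
qed

text \<open>The estimate is known only while the path is inside \<Omega>. Continuity of
  \<open>u\<close> on the closure carries it over to the boundary point, where \<open>u\<close>
  takes its trace value.\<close>

lemma exit_limit:
  fixes \<gamma> :: "real \<Rightarrow> 'a::euclidean_space" and u :: "'a \<Rightarrow> real"
  assumes \<gamma>: "continuous_on {s..e} \<gamma>" and u: "continuous_on (closure \<Omega>) u" and se: "s < e"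
    and ins: "\<And>\<tau>. s \<le> \<tau> \<Longrightarrow> \<tau> < e \<Longrightarrow> \<gamma> \<tau> \<in> \<Omega>"
    and fr: "\<gamma> e \<in> closure \<Omega>"
    and bd: "\<And>t. s \<le> t \<Longrightarrow> t < e \<Longrightarrow> ennreal \<bar>u (\<gamma> t) - u (\<gamma> s)\<bar> \<le> (\<integral>\<^sup>+\<tau>\<in>{s..t}. a \<tau> \<partial>lborel)"
  shows "ennreal \<bar>u (\<gamma> e) - u (\<gamma> s)\<bar> \<le> (\<integral>\<^sup>+\<tau>\<in>{s..e}. a \<tau> \<partial>lborel)"
proof -
  let ?I = "\<integral>\<^sup>+\<tau>\<in>{s..e}. a \<tau> \<partial>lborel"
  have "continuous_on {s..e} (\<lambda>t. u (\<gamma> t))"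
  proof (rule continuous_on_compose2[OF u \<gamma>])
    show "\<gamma> ` {s..e} \<subseteq> closure \<Omega>"
    proof safe
      fix \<tau> assume "\<tau> \<in> {s..e}"
      then show "\<gamma> \<tau> \<in> closure \<Omega>" using ins[of \<tau>] fr closure_subset by (cases "\<tau> = e") auto
    qed
  qed
  then have "((\<lambda>t. u (\<gamma> t)) \<longlongrightarrow> u (\<gamma> e)) (at e within {s..e})"
    using se by (simp add: continuous_on_def)
  then have "((\<lambda>t. u (\<gamma> t)) \<longlongrightarrow> u (\<gamma> e)) (at_left e)"
    using se by (simp add: at_within_Icc_at_left)
  then have lim: "((\<lambda>t. ennreal \<bar>u (\<gamma> t) - u (\<gamma> s)\<bar>) \<longlongrightarrow> ennreal \<bar>u (\<gamma> e) - u (\<gamma> s)\<bar>) (at_left e)"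
    by (intro tendsto_intros)
  show ?thesis
  proof (rule tendsto_upperbound[OF lim])
    have "ennreal \<bar>u (\<gamma> t) - u (\<gamma> s)\<bar> \<le> ?I" if "s < t" "t < e" for t
    proof -
      have "ennreal \<bar>u (\<gamma> t) - u (\<gamma> s)\<bar> \<le> (\<integral>\<^sup>+\<tau>\<in>{s..t}. a \<tau> \<partial>lborel)" using that by (intro bd) auto
      also have "\<dots> \<le> ?I" using that by (intro nn_integral_mono) (auto split: split_indicator)
      finally show ?thesis .
    qed
    then show "\<forall>\<^sub>F t in at_left e. ennreal \<bar>u (\<gamma> t) - u (\<gamma> s)\<bar> \<le> ?I"
      using se by (auto simp: eventually_at_left[of s])
  qed simp
qed

lemma ennreal_le_suminf: "(f i :: ennreal) \<le> (\<Sum>i. f i)"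
  using sum_le_suminf[of f "{i}"] by (simp add: summableI)

lemma ennreal_suminf_finite_tendsto_0:
  fixes c :: "nat \<Rightarrow> ennreal"
  assumes "(\<Sum>n. c n) \<noteq> \<infinity>"
  shows "c \<longlonglongrightarrow> 0"
proof -
  have tail: "(\<lambda>n. \<Sum>k. c (k + n)) \<longlonglongrightarrow> 0"
    using assms by (intro ennreal_suminf_tail_tendsto_0) simp
  have le: "c n \<le> (\<Sum>k. c (k + n))" for n
    using ennreal_le_suminf[of "\<lambda>k. c (k + n)" 0] by simp
  show ?thesis
    by (rule tendsto_sandwich[OF _ _ tendsto_const tail]) (simp_all add: le)
qed

text \<open>The one-dimensional Sobolev inequality on [0, e]: the exit value is at most |u(\<gamma>
  s)| plus the variation, and averaging over s in [0, e) bounds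
  \<open>e * \<bar>u n (\<gamma> e)\<bar>\<close> by \<open>(e + 1) * c n\<close>. The terms
  \<open>c n\<close> of a convergent series tend to 0; as \<open>e\<close> belongs to the fixed
  path, its size is harmless.\<close>

lemma exit_values_tendsto_0:
  fixes \<gamma> :: "real \<Rightarrow> 'a::euclidean_space" and u :: "nat \<Rightarrow> 'a \<Rightarrow> real"
  assumes \<gamma>: "continuous_on {0..h} \<gamma>" and u: "\<And>n. continuous_on (closure \<Omega>) (u n)"
    and [measurable]: "\<And>n. a n \<in> borel_measurable borel" "\<And>n. f n \<in> borel_measurable borel"
    and acl: "\<And>n s t. 0 \<le> s \<Longrightarrow> s \<le> t \<Longrightarrow> t \<le> h \<Longrightarrow> (\<forall>\<tau>\<in>{s..t}. \<gamma> \<tau> \<in> \<Omega>) \<Longrightarrow>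
      ennreal \<bar>u n (\<gamma> t) - u n (\<gamma> s)\<bar> \<le> (\<integral>\<^sup>+\<tau>\<in>{s..t}. a n \<tau> \<partial>lborel)"
    and f: "\<And>n \<tau>. 0 \<le> \<tau> \<Longrightarrow> \<tau> \<le> h \<Longrightarrow> \<gamma> \<tau> \<in> \<Omega> \<Longrightarrow> ennreal \<bar>u n (\<gamma> \<tau>)\<bar> \<le> f n \<tau>"
    and fin: "(\<Sum>n. \<integral>\<^sup>+\<tau>\<in>{0..h}. a n \<tau> + f n \<tau> \<partial>lborel) \<noteq> \<infinity>"
    and e: "0 < e" "e \<le> h" "\<gamma> e \<in> closure \<Omega>" and ins: "\<And>\<tau>. 0 \<le> \<tau> \<Longrightarrow> \<tau> < e \<Longrightarrow> \<gamma> \<tau> \<in> \<Omega>"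
  shows "(\<lambda>n. u n (\<gamma> e)) \<longlonglongrightarrow> 0"
proof -
  define c where "c = (\<lambda>n. \<integral>\<^sup>+\<tau>\<in>{0..h}. a n \<tau> + f n \<tau> \<partial>lborel)"
  have c0: "c \<longlonglongrightarrow> 0"
    unfolding c_def by (rule ennreal_suminf_finite_tendsto_0[OF fin])
  have bound: "ennreal (e * \<bar>u n (\<gamma> e)\<bar>) \<le> ennreal (e + 1) * c n" for n
  proof -
    have *: "ennreal \<bar>u n (\<gamma> e)\<bar> \<le> c n + f n s" if s: "0 \<le> s" "s < e" for s
    proof -
      have "ennreal \<bar>u n (\<gamma> e)\<bar> \<le> ennreal (\<bar>u n (\<gamma> e) - u n (\<gamma> s)\<bar> + \<bar>u n (\<gamma> s)\<bar>)"
        by (intro ennreal_leI) simp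
      also have "\<dots> = ennreal \<bar>u n (\<gamma> e) - u n (\<gamma> s)\<bar> + ennreal \<bar>u n (\<gamma> s)\<bar>"
        by (rule ennreal_plus) auto
      also have "\<dots> \<le> (\<integral>\<^sup>+\<tau>\<in>{s..e}. a n \<tau> \<partial>lborel) + f n s"
      proof (intro add_mono exit_limit[where \<Omega> = \<Omega> and u = "u n" and \<gamma> = \<gamma> and s = s and e = e])
        show "continuous_on {s..e} \<gamma>" using s e by (intro continuous_on_subset[OF \<gamma>]) auto
        show "continuous_on (closure \<Omega>) (u n)" by (rule u)
      qed (use s e ins in \<open>auto intro!: acl f\<close>)
      also have "(\<integral>\<^sup>+\<tau>\<in>{s..e}. a n \<tau> \<partial>lborel) \<le> c n"
        unfolding c_def using s e by (intro nn_integral_mono) (auto split: split_indicator)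
      finally show ?thesis by (simp add: add_right_mono)
    qed
    have "ennreal (e * \<bar>u n (\<gamma> e)\<bar>) = (\<integral>\<^sup>+s\<in>{0..<e}. ennreal \<bar>u n (\<gamma> e)\<bar> \<partial>lborel)"
      using e by (subst nn_integral_cmult_indicator) (auto simp: ennreal_mult mult.commute)
    also have "\<dots> \<le> (\<integral>\<^sup>+s. c n * indicator {0..<e} s + f n s * indicator {0..h} s \<partial>lborel)"
      using * e by (intro nn_integral_mono) (auto split: split_indicator)
    also have "\<dots> = c n * ennreal e + (\<integral>\<^sup>+s\<in>{0..h}. f n s \<partial>lborel)"
      using e by (subst nn_integral_add) (auto simp: nn_integral_cmult_indicator)
    also have "(\<integral>\<^sup>+s\<in>{0..h}. f n s \<partial>lborel) \<le> c n"
      unfolding c_def by (intro nn_integral_mono) (auto split: split_indicator)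
    also have "c n * ennreal e + c n = ennreal (e + 1) * c n"
      using e by (simp add: distrib_left mult.commute)
    finally show ?thesis by (simp add: add_left_mono)
  qed
  have up: "(\<lambda>n. ennreal (e + 1) * c n) \<longlonglongrightarrow> ennreal (e + 1) * 0"
    by (intro ennreal_tendsto_cmult c0) simp
  have "(\<lambda>n. ennreal (e * \<bar>u n (\<gamma> e)\<bar>)) \<longlonglongrightarrow> ennreal 0"
    unfolding ennreal_0
    by (rule tendsto_sandwich[OF _ _ tendsto_const up[unfolded mult_zero_right]]) (use bound in simp_all)
  then have "(\<lambda>n. e * \<bar>u n (\<gamma> e)\<bar>) \<longlonglongrightarrow> 0"
    using e by (subst (asm) tendsto_ennreal_iff) auto
  from tendsto_mult_left[OF this, of "1 / e"] have "(\<lambda>n. \<bar>u n (\<gamma> e)\<bar>) \<longlonglongrightarrow> 0"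
    using e by simp
  then show ?thesis by (rule tendsto_rabs_zero_cancel)
qed

section \<open>Lipschitz bumps and truncation along a path\<close>

definition ball_bump :: "'a::metric_space \<Rightarrow> real \<Rightarrow> 'a \<Rightarrow> real" where
  "ball_bump z r x = max 0 (min 1 (2 - dist x z / r))"

lemma ball_bump_bounds: "0 \<le> ball_bump z r x" "ball_bump z r x \<le> 1"
  by (auto simp: ball_bump_def)

lemma ball_bump_eq_1: "0 < r \<Longrightarrow> x \<in> cball z r \<Longrightarrow> ball_bump z r x = 1"
  by (auto simp: ball_bump_def dist_commute field_simps)

lemma ball_bump_eq_0: "0 < r \<Longrightarrow> x \<notin> ball z (2 * r) \<Longrightarrow> ball_bump z r x = 0"
  by (auto simp: ball_bump_def dist_commute field_simps)

lemma ball_bump_Lipschitz: "0 < r \<Longrightarrow> ball_bump z r x - ball_bump z r y \<le> dist x y / r"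
proof -
  assume r: "0 < r"
  have "dist y z / r \<le> dist x y / r + dist x z / r"
    using r dist_triangle3[of y z x] by (simp add: dist_commute flip: add_divide_distrib) (simp add: divide_right_mono)
  moreover have "0 \<le> dist x y / r" using r by simp
  ultimately show ?thesis unfolding ball_bump_def by linarith
qed

lemma ball_bump_measurable [measurable]: "ball_bump (z :: 'a::euclidean_space) r \<in> borel_measurable borel"
  unfolding ball_bump_def by measurable

text \<open>Only a decrease is charged, so a path that starts outside the double ball costs nothing.
  Otherwise the path is followed up to its first exit from the double ball, where the bump is
  already 0; until then the integrand is the full Lipschitz constant.\<close>

lemma ball_bump_path:
  fixes \<gamma> :: "real \<Rightarrow> 'a::euclidean_space"
  assumes r: "0 < r" and st: "s \<le> t" and lip: "\<And>\<tau> \<tau>'. dist (\<gamma> \<tau>) (\<gamma> \<tau>') \<le> \<bar>\<tau> - \<tau>'\<bar>"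
  shows "ennreal (ball_bump z r (\<gamma> s) - ball_bump z r (\<gamma> t))
    \<le> (\<integral>\<^sup>+\<tau>\<in>{s..t}. ennreal (1 / r) * indicator (ball z (2 * r)) (\<gamma> \<tau>) \<partial>lborel)"
proof -
  have cont: "continuous_on {s..t} \<gamma>"
  proof (rule continuous_on_iff[THEN iffD2], intro ballI allI impI)
    fix x and e :: real assume "0 < e"
    then show "\<exists>d>0. \<forall>x'\<in>{s..t}. dist x' x < d \<longrightarrow> dist (\<gamma> x') (\<gamma> x) < e"
      using lip by (intro exI[of _ e]) (auto simp: dist_real_def intro: le_less_trans)
  qed
  \<comment> \<open>The endpoint \<open>e\<close> is excluded from the inclusion because
    \<open>\<gamma> e\<close> may already lie outside; a single parameter does not affect the
    integral.\<close>
  have *: "ennreal (ball_bump z r (\<gamma> s) - ball_bump z r (\<gamma> e))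
      \<le> (\<integral>\<^sup>+\<tau>\<in>{s..t}. ennreal (1 / r) * indicator (ball z (2 * r)) (\<gamma> \<tau>) \<partial>lborel)"
    if e: "s \<le> e" "e \<le> t" and ins: "\<And>\<tau>. s \<le> \<tau> \<Longrightarrow> \<tau> < e \<Longrightarrow> \<gamma> \<tau> \<in> ball z (2 * r)" for e
  proof -
    have "ball_bump z r (\<gamma> s) - ball_bump z r (\<gamma> e) \<le> dist (\<gamma> s) (\<gamma> e) / r"
      by (rule ball_bump_Lipschitz[OF r])
    also have "\<dots> \<le> 1 / r * (e - s)" using lip[of s e] e r by (simp add: divide_right_mono)
    finally have "ennreal (ball_bump z r (\<gamma> s) - ball_bump z r (\<gamma> e)) \<le> ennreal (1 / r * (e - s))"
      by (rule ennreal_leI)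
    also have "\<dots> = ennreal (1 / r) * ennreal (e - s)"
      using e r by (intro ennreal_mult) auto
    also have "\<dots> = (\<integral>\<^sup>+\<tau>\<in>{s..<e}. ennreal (1 / r) \<partial>lborel)"
      using e by (subst nn_integral_cmult_indicator) auto
    also have "\<dots> \<le> (\<integral>\<^sup>+\<tau>\<in>{s..t}. ennreal (1 / r) * indicator (ball z (2 * r)) (\<gamma> \<tau>) \<partial>lborel)"
      using ins e by (intro nn_integral_mono) (auto split: split_indicator)
    finally show ?thesis .
  qed
  show ?thesis
  proof (cases "\<forall>\<tau>\<in>{s..t}. \<gamma> \<tau> \<in> ball z (2 * r)")
    case True
    then show ?thesis using st by (intro *) auto
  next
    case False
    show ?thesis
    proof (cases "\<gamma> s \<in> ball z (2 * r)")
      case True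
      obtain e where e: "s < e" "e \<le> t" "\<gamma> e \<notin> ball z (2 * r)" "\<And>\<tau>. s \<le> \<tau> \<Longrightarrow> \<tau> < e \<Longrightarrow> \<gamma> \<tau> \<in> ball z (2 * r)"
        using first_exit[OF open_ball cont st True] False by metis
      have "ennreal (ball_bump z r (\<gamma> s) - ball_bump z r (\<gamma> t)) \<le> ennreal (ball_bump z r (\<gamma> s) - ball_bump z r (\<gamma> e))"
        using ball_bump_eq_0[OF r e(3)] ball_bump_bounds[of z r "\<gamma> t"] by (intro ennreal_leI) simp
      also have "\<dots> \<le> (\<integral>\<^sup>+\<tau>\<in>{s..t}. ennreal (1 / r) * indicator (ball z (2 * r)) (\<gamma> \<tau>) \<partial>lborel)"
        by (rule *) (use e in auto)
      finally show ?thesis .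
    next
      case False
      then show ?thesis using ball_bump_eq_0[OF r, of "\<gamma> s" z] ball_bump_bounds[of z r "\<gamma> t"] by (simp add: ennreal_neg)
    qed
  qed
qed

text \<open>The affine piece has slope 2 and runs from 0 at 1/4 to 1 at 3/4. Values within 1/4 of
  the limits 0 and 1 are thus mapped to the limits themselves.\<close>

definition clip :: "real \<Rightarrow> real" where "clip s = max 0 (min 1 (2 * s - 1 / 2))"

lemma clip_diff: "clip s - clip t \<le> 2 * \<bar>s - t\<bar>"
  using abs_ge_self[of "s - t"] abs_ge_zero[of "s - t"]
  unfolding clip_def max_def min_def by (auto split: if_splits)

lemma clip_bounds: "0 \<le> clip s" "clip s \<le> 1"
  by (auto simp: clip_def)

text \<open>A path leaves \<open>\<Omega>\<close> either where \<open>clip \<circ> u\<close> vanishes or where some \<open>\<zeta> i\<close> equals \<open>1\<close>; the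
  function \<open>v\<close> below therefore has no jump there.\<close>

lemma path_estimate:
  fixes \<gamma> :: "real \<Rightarrow> 'a::euclidean_space" and u :: "'a \<Rightarrow> real" and \<zeta> :: "nat \<Rightarrow> 'a \<Rightarrow> real"
  assumes \<Omega>: "open \<Omega>" and h: "0 < h" and \<gamma>: "continuous_on {0..h} \<gamma>" and u: "continuous_on (closure \<Omega>) u"
    and [measurable]: "a \<in> borel_measurable borel" "k \<in> borel_measurable borel"
    and acl: "\<And>s t. 0 \<le> s \<Longrightarrow> s \<le> t \<Longrightarrow> t \<le> h \<Longrightarrow> (\<forall>\<tau>\<in>{s..t}. \<gamma> \<tau> \<in> \<Omega>) \<Longrightarrow>
      ennreal \<bar>u (\<gamma> t) - u (\<gamma> s)\<bar> \<le> (\<integral>\<^sup>+\<tau>\<in>{s..t}. a \<tau> \<partial>lborel)"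
    and exit: "\<And>e. 0 < e \<Longrightarrow> e \<le> h \<Longrightarrow> \<gamma> e \<in> frontier \<Omega> \<Longrightarrow> (\<And>\<tau>. 0 \<le> \<tau> \<Longrightarrow> \<tau> < e \<Longrightarrow> \<gamma> \<tau> \<in> \<Omega>) \<Longrightarrow>
      u (\<gamma> e) \<le> 1 / 4 \<or> (\<exists>i. \<zeta> i (\<gamma> e) = 1)"
    and \<zeta>: "\<And>i x. 0 \<le> \<zeta> i x" "\<And>i x. \<zeta> i x \<le> 1"
    and \<zeta>k: "\<And>i s t. 0 \<le> s \<Longrightarrow> s \<le> t \<Longrightarrow> t \<le> h \<Longrightarrow> ennreal (\<zeta> i (\<gamma> s) - \<zeta> i (\<gamma> t)) \<le> (\<integral>\<^sup>+\<tau>\<in>{s..t}. k \<tau> \<partial>lborel)"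
    and v: "\<And>x. v x = max (if x \<in> \<Omega> then clip (u x) else 0) (SUP i. \<zeta> i x)"
  shows "ennreal (v (\<gamma> 0) - v (\<gamma> h)) \<le> (\<integral>\<^sup>+\<tau>\<in>{0..h}. 2 * a \<tau> + k \<tau> \<partial>lborel)"
proof -
  define I where "I = (\<integral>\<^sup>+\<tau>\<in>{0..h}. 2 * a \<tau> + k \<tau> \<partial>lborel)"
  have bdd: "bdd_above (range (\<lambda>i. \<zeta> i x))" for x using \<zeta>(2) by (auto simp: bdd_above_def)
  have \<zeta>v: "\<zeta> i x \<le> v x" for i x unfolding v using cSUP_upper[OF _ bdd, of i x] by auto
  have v0: "0 \<le> v x" for x using \<zeta>v[of 0 x] \<zeta>(1)[of 0 x] by linarith
  \<comment> \<open>The variation of \<open>u\<close> is charged up to the exit time and that of the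
    bumps afterwards; the two intervals share one point. The factor 2 is the slope of
    \<open>clip\<close>.\<close>
  have Ia: "2 * (\<integral>\<^sup>+\<tau>\<in>{0..t}. a \<tau> \<partial>lborel) + (\<integral>\<^sup>+\<tau>\<in>{t..h}. k \<tau> \<partial>lborel) \<le> I" if "0 \<le> t" "t \<le> h" for t
  proof -
    have "2 * (\<integral>\<^sup>+\<tau>\<in>{0..t}. a \<tau> \<partial>lborel) + (\<integral>\<^sup>+\<tau>\<in>{t..h}. k \<tau> \<partial>lborel)
      = (\<integral>\<^sup>+\<tau>. 2 * (a \<tau> * indicator {0..t} \<tau>) + k \<tau> * indicator {t..h} \<tau> \<partial>lborel)"
      by (subst nn_integral_add) (auto simp: nn_integral_cmult)
    also have "\<dots> \<le> I" unfolding I_def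
      using that by (intro nn_integral_mono) (auto split: split_indicator)
    finally show ?thesis .
  qed
  have Ik: "(\<integral>\<^sup>+\<tau>\<in>{0..h}. k \<tau> \<partial>lborel) \<le> I"
    unfolding I_def by (intro nn_integral_mono) (auto split: split_indicator)
  have w: "ennreal (clip (u (\<gamma> 0)) - v (\<gamma> h)) \<le> I" if in0: "\<gamma> 0 \<in> \<Omega>"
  proof -
    have cl: "ennreal (clip (u (\<gamma> 0)) - clip (u (\<gamma> t))) \<le> 2 * J" if "ennreal \<bar>u (\<gamma> t) - u (\<gamma> 0)\<bar> \<le> J" for t J
    proof -
      have "ennreal (clip (u (\<gamma> 0)) - clip (u (\<gamma> t))) \<le> ennreal (2 * \<bar>u (\<gamma> t) - u (\<gamma> 0)\<bar>)"
        using clip_diff[of "u (\<gamma> 0)" "u (\<gamma> t)"] by (intro ennreal_leI) (simp add: abs_minus_commute)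
      also have "\<dots> = 2 * ennreal \<bar>u (\<gamma> t) - u (\<gamma> 0)\<bar>" by (simp add: ennreal_mult)
      also have "\<dots> \<le> 2 * J" using that by (intro mult_left_mono) auto
      finally show ?thesis .
    qed
    show ?thesis
    proof (cases "\<forall>\<tau>\<in>{0..h}. \<gamma> \<tau> \<in> \<Omega>")
      case True
      have "\<gamma> h \<in> \<Omega>" using True h by auto
      then have "clip (u (\<gamma> h)) \<le> v (\<gamma> h)" by (simp add: v)
      then have "ennreal (clip (u (\<gamma> 0)) - v (\<gamma> h)) \<le> ennreal (clip (u (\<gamma> 0)) - clip (u (\<gamma> h)))"
        by (intro ennreal_leI) simp
      also have "\<dots> \<le> 2 * (\<integral>\<^sup>+\<tau>\<in>{0..h}. a \<tau> \<partial>lborel)"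
        by (rule cl, rule acl) (use h True in auto)
      also have "\<dots> \<le> 2 * (\<integral>\<^sup>+\<tau>\<in>{0..h}. a \<tau> \<partial>lborel) + (\<integral>\<^sup>+\<tau>\<in>{h..h}. k \<tau> \<partial>lborel)" by simp
      also have "\<dots> \<le> I" using h by (intro Ia) auto
      finally show ?thesis .
    next
      case False
      then have ex: "\<exists>\<tau>\<in>{0..h}. \<gamma> \<tau> \<notin> \<Omega>" by blast
      obtain e where e: "0 < e" "e \<le> h" "\<gamma> e \<in> frontier \<Omega>" and ins: "\<And>\<tau>. 0 \<le> \<tau> \<Longrightarrow> \<tau> < e \<Longrightarrow> \<gamma> \<tau> \<in> \<Omega>"
        using first_exit[OF \<Omega> \<gamma> _ in0 ex] h by (metis less_imp_le)
      have "ennreal \<bar>u (\<gamma> e) - u (\<gamma> 0)\<bar> \<le> (\<integral>\<^sup>+\<tau>\<in>{0..e}. a \<tau> \<partial>lborel)"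
      proof (rule exit_limit[OF _ u e(1) ins])
        show "continuous_on {0..e} \<gamma>" using e by (intro continuous_on_subset[OF \<gamma>]) auto
        show "\<gamma> e \<in> closure \<Omega>" using e(3) by (simp add: frontier_def)
        show "ennreal \<bar>u (\<gamma> t) - u (\<gamma> 0)\<bar> \<le> (\<integral>\<^sup>+\<tau>\<in>{0..t}. a \<tau> \<partial>lborel)" if "0 \<le> t" "t < e" for t
          using that e ins by (intro acl) auto
      qed auto
      then have c: "ennreal (clip (u (\<gamma> 0)) - clip (u (\<gamma> e))) \<le> 2 * (\<integral>\<^sup>+\<tau>\<in>{0..e}. a \<tau> \<partial>lborel)" by (rule cl)
      have ex': "u (\<gamma> e) \<le> 1 / 4 \<or> (\<exists>i. \<zeta> i (\<gamma> e) = 1)"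
        by (rule exit[OF e]) (rule ins)
      have "ennreal (clip (u (\<gamma> 0)) - v (\<gamma> h)) \<le> ennreal (clip (u (\<gamma> 0)) - clip (u (\<gamma> e))) + (\<integral>\<^sup>+\<tau>\<in>{e..h}. k \<tau> \<partial>lborel)"
        using ex'
      proof (elim disjE exE)
        assume "u (\<gamma> e) \<le> 1 / 4"
        then have "clip (u (\<gamma> e)) = 0" by (simp add: clip_def)
        then have "ennreal (clip (u (\<gamma> 0)) - v (\<gamma> h)) \<le> ennreal (clip (u (\<gamma> 0)) - clip (u (\<gamma> e)))"
          using v0[of "\<gamma> h"] by (intro ennreal_leI) simp
        then show ?thesis by (simp add: add_increasing2)
      next
        \<comment> \<open>At the exit the bump has its maximal value 1, hence dominates the clipped
          value: continuing with the bump instead of \<open>u\<close> costs nothing.\<close>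
        fix i assume "\<zeta> i (\<gamma> e) = 1"
        then have "clip (u (\<gamma> 0)) - v (\<gamma> h) \<le> max 0 (clip (u (\<gamma> 0)) - clip (u (\<gamma> e))) + max 0 (\<zeta> i (\<gamma> e) - \<zeta> i (\<gamma> h))"
          using \<zeta>v[of i "\<gamma> h"] clip_bounds(2)[of "u (\<gamma> e)"]
            max.cobounded2[of 0 "clip (u (\<gamma> 0)) - clip (u (\<gamma> e))"] max.cobounded2[of 0 "\<zeta> i (\<gamma> e) - \<zeta> i (\<gamma> h)"]
          by linarith
        then have "ennreal (clip (u (\<gamma> 0)) - v (\<gamma> h)) \<le> ennreal (max 0 (clip (u (\<gamma> 0)) - clip (u (\<gamma> e))) + max 0 (\<zeta> i (\<gamma> e) - \<zeta> i (\<gamma> h)))"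
          by (rule ennreal_leI)
        also have "\<dots> = ennreal (clip (u (\<gamma> 0)) - clip (u (\<gamma> e))) + ennreal (\<zeta> i (\<gamma> e) - \<zeta> i (\<gamma> h))"
          by (subst ennreal_plus) (auto simp: max_def ennreal_neg)
        also have "\<dots> \<le> ennreal (clip (u (\<gamma> 0)) - clip (u (\<gamma> e))) + (\<integral>\<^sup>+\<tau>\<in>{e..h}. k \<tau> \<partial>lborel)"
          using e by (intro add_left_mono \<zeta>k) auto
        finally show ?thesis .
      qed
      also have "\<dots> \<le> 2 * (\<integral>\<^sup>+\<tau>\<in>{0..e}. a \<tau> \<partial>lborel) + (\<integral>\<^sup>+\<tau>\<in>{e..h}. k \<tau> \<partial>lborel)"
        using c by (rule add_right_mono)
      also have "\<dots> \<le> I" using e by (intro Ia) auto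
      finally show ?thesis .
    qed
  qed
  have z: "ennreal (\<zeta> i (\<gamma> 0) - v (\<gamma> h)) \<le> I" for i
  proof -
    have "ennreal (\<zeta> i (\<gamma> 0) - v (\<gamma> h)) \<le> ennreal (\<zeta> i (\<gamma> 0) - \<zeta> i (\<gamma> h))"
      using \<zeta>v[of i "\<gamma> h"] by (intro ennreal_leI) simp
    also have "\<dots> \<le> (\<integral>\<^sup>+\<tau>\<in>{0..h}. k \<tau> \<partial>lborel)" using h by (intro \<zeta>k) auto
    finally show ?thesis using Ik by simp
  qed
  show ?thesis
  \<comment> \<open>For finite \<open>I\<close> the estimates become real inequalities with one
    bound for all \<open>i\<close>, and so pass to the supremum of the bumps.\<close>
  proof (cases "I = \<infinity>")
    case False
    then obtain j where j: "I = ennreal j" "0 \<le> j" by (cases I) auto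
    have "\<zeta> i (\<gamma> 0) \<le> v (\<gamma> h) + j" for i using z[of i] j by (simp add: ennreal_le_iff)
    then have "(SUP i. \<zeta> i (\<gamma> 0)) \<le> v (\<gamma> h) + j" by (intro cSUP_least) auto
    moreover have "clip (u (\<gamma> 0)) \<le> v (\<gamma> h) + j" if "\<gamma> 0 \<in> \<Omega>" using w[OF that] j by (simp add: ennreal_le_iff)
    moreover have "0 \<le> v (\<gamma> h) + j" using v0 j by simp
    ultimately have "v (\<gamma> 0) \<le> v (\<gamma> h) + j" unfolding v[of "\<gamma> 0"] by auto
    then show ?thesis using j by (simp add: I_def[symmetric] ennreal_leI)
  qed (simp add: I_def)
qed

section \<open>Absolute continuity on almost every line, and the glued function\<close>

lemma nn_integral_real_isometry:
  fixes f :: "real \<Rightarrow> ennreal"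
  assumes [measurable]: "f \<in> borel_measurable borel" and "\<bar>c\<bar> = 1"
  shows "(\<integral>\<^sup>+\<tau>. f (d + c * \<tau>) \<partial>lborel) = (\<integral>\<^sup>+\<tau>. f \<tau> \<partial>lborel)"
  using assms nn_integral_real_affine[of f c d] by fastforce

lemma nn_integral_Icc_reflect:
  fixes f :: "real \<Rightarrow> ennreal"
  assumes [measurable]: "f \<in> borel_measurable borel"
  shows "(\<integral>\<^sup>+\<tau>\<in>{s..t}. f (d - \<tau>) \<partial>lborel) = (\<integral>\<^sup>+\<tau>\<in>{d - t..d - s}. f \<tau> \<partial>lborel)"
proof -
  have "(\<integral>\<^sup>+\<tau>. (f (d + (-1) * \<tau>) * indicator {d - t..d - s} (d + (-1) * \<tau>)) \<partial>lborel) = (\<integral>\<^sup>+\<tau>\<in>{d - t..d - s}. f \<tau> \<partial>lborel)"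
    by (rule nn_integral_real_isometry) auto
  moreover have "indicator {d - t..d - s} (d + (-1) * \<tau>) = (indicator {s..t} \<tau> :: ennreal)" for \<tau>
    by (auto simp: indicator_def)
  ultimately show ?thesis by simp
qed

lemma nn_integral_Icc_shift:
  fixes f :: "real \<Rightarrow> ennreal"
  assumes [measurable]: "f \<in> borel_measurable borel"
  shows "(\<integral>\<^sup>+\<tau>\<in>{0..t - s}. f (s + \<tau>) \<partial>lborel) = (\<integral>\<^sup>+\<tau>\<in>{s..t}. f \<tau> \<partial>lborel)"
proof -
  have "(\<integral>\<^sup>+\<tau>. (f (s + 1 * \<tau>) * indicator {s..t} (s + 1 * \<tau>)) \<partial>lborel) = (\<integral>\<^sup>+\<tau>\<in>{s..t}. f \<tau> \<partial>lborel)"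
    by (rule nn_integral_real_isometry) auto
  moreover have "indicator {s..t} (s + 1 * \<tau>) = (indicator {0..t - s} \<tau> :: ennreal)" for \<tau>
    by (auto simp: indicator_def)
  ultimately show ?thesis by simp
qed

text \<open>All segments of one line are treated at once, so that an exceptional null set of
  \<open>x\<close> is independent of the segment; this is needed because the exit time varies with
  the line. As an inequality in \<open>ennreal\<close> it also makes sense where \<open>g\<close>
  fails to be integrable along the line.\<close>

definition abs_cont_lines :: "'a::euclidean_space set \<Rightarrow> 'a \<Rightarrow> ('a \<Rightarrow> real) \<Rightarrow> ('a \<Rightarrow> real) \<Rightarrow> 'a \<Rightarrow> bool" where
  "abs_cont_lines \<Omega> b u g x \<longleftrightarrow> (\<forall>s t. s \<le> t \<longrightarrow> (\<forall>\<tau>\<in>{s..t}. x + \<tau> *\<^sub>R b \<in> \<Omega>) \<longrightarrow>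
     ennreal \<bar>u (x + t *\<^sub>R b) - u (x + s *\<^sub>R b)\<bar> \<le> (\<integral>\<^sup>+\<tau>\<in>{s..t}. ennreal \<bar>g (x + \<tau> *\<^sub>R b)\<bar> \<partial>lborel))"

lemma ennreal_set_integral_bound:
  fixes f :: "real \<Rightarrow> real"
  assumes [measurable]: "f \<in> borel_measurable borel" "A \<in> sets borel"
  shows "ennreal \<bar>LBINT \<tau>:A. f \<tau>\<bar> \<le> (\<integral>\<^sup>+\<tau>\<in>A. ennreal \<bar>f \<tau>\<bar> \<partial>lborel)"
proof (cases "integrable lborel (\<lambda>\<tau>. indicator A \<tau> *\<^sub>R f \<tau>)")
  case True
  have "ennreal (norm (LINT \<tau>|lborel. indicator A \<tau> *\<^sub>R f \<tau>)) \<le> (\<integral>\<^sup>+\<tau>. ennreal (norm (indicator A \<tau> *\<^sub>R f \<tau>)) \<partial>lborel)"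
    by (rule integral_norm_bound_ennreal[OF True])
  also have "\<dots> = (\<integral>\<^sup>+\<tau>\<in>A. ennreal \<bar>f \<tau>\<bar> \<partial>lborel)"
    by (intro nn_integral_cong) (auto split: split_indicator)
  finally show ?thesis by (simp add: set_lebesgue_integral_def)
qed (simp add: set_lebesgue_integral_def not_integrable_integral_eq)

text \<open>\<open>weak_derivative_shift\<close> has a null set for each length. Rational endpoints
  leave countably many null sets, and continuity of \<open>u\<close> inside \<Omega> extends the
  bound to real endpoints by approximating them from within the segment.\<close>

lemma AE_abs_cont_lines:
  fixes u g :: "'a::euclidean_space \<Rightarrow> real"
  assumes \<Omega>: "open \<Omega>" and b: "b \<in> Basis"
    and [measurable]: "u \<in> borel_measurable borel" "g \<in> borel_measurable borel"
    and u: "\<And>K. compact K \<Longrightarrow> K \<subseteq> \<Omega> \<Longrightarrow> set_integrable lborel K u"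
    and g: "\<And>K. compact K \<Longrightarrow> K \<subseteq> \<Omega> \<Longrightarrow> set_integrable lborel K g"
    and weak: "\<And>\<eta>. test_function \<Omega> \<eta> \<Longrightarrow>
      (LINT x|lborel. u x * frechet_derivative \<eta> (at x) b) = - (LINT x|lborel. g x * \<eta> x)"
    and cont: "continuous_on \<Omega> u"
  shows "AE x in lborel. abs_cont_lines \<Omega> b u g x"
proof -
  have rat: "AE x in lborel. (\<forall>\<tau>\<in>{s..t}. x + \<tau> *\<^sub>R b \<in> \<Omega>) \<longrightarrow>
     ennreal \<bar>u (x + t *\<^sub>R b) - u (x + s *\<^sub>R b)\<bar> \<le> (\<integral>\<^sup>+\<tau>\<in>{s..t}. ennreal \<bar>g (x + \<tau> *\<^sub>R b)\<bar> \<partial>lborel)"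
    if "s < t" for s t
  proof -
    have "AE x in lborel. (\<forall>\<tau>\<in>{0..t - s}. x + \<tau> *\<^sub>R b \<in> \<Omega>) \<longrightarrow>
       u (x + (t - s) *\<^sub>R b) - u x - (LBINT \<tau>:{0..t - s}. g (x + \<tau> *\<^sub>R b)) = 0"
      using that by (intro weak_derivative_shift \<Omega> b u g weak) auto
    from AE_lborel_translate[OF this, of "s *\<^sub>R b"] show ?thesis
    proof eventually_elim
      case (elim x)
      show ?case
      proof
        assume *: "\<forall>\<tau>\<in>{s..t}. x + \<tau> *\<^sub>R b \<in> \<Omega>"
        have eq: "x + s *\<^sub>R b + \<tau> *\<^sub>R b = x + (s + \<tau>) *\<^sub>R b" for \<tau> by (simp add: algebra_simps)
        have "\<forall>\<tau>\<in>{0..t - s}. x + s *\<^sub>R b + \<tau> *\<^sub>R b \<in> \<Omega>" unfolding eq using * by auto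
        then have "u (x + t *\<^sub>R b) - u (x + s *\<^sub>R b) = (LBINT \<tau>:{0..t - s}. g (x + (s + \<tau>) *\<^sub>R b))"
          using elim unfolding eq by simp
        then have "ennreal \<bar>u (x + t *\<^sub>R b) - u (x + s *\<^sub>R b)\<bar> \<le> (\<integral>\<^sup>+\<tau>\<in>{0..t - s}. ennreal \<bar>g (x + (s + \<tau>) *\<^sub>R b)\<bar> \<partial>lborel)"
          using ennreal_set_integral_bound[of "\<lambda>\<tau>. g (x + (s + \<tau>) *\<^sub>R b)" "{0..t - s}"] by simp
        also have "\<dots> = (\<integral>\<^sup>+\<tau>\<in>{s..t}. ennreal \<bar>g (x + \<tau> *\<^sub>R b)\<bar> \<partial>lborel)"
          by (rule nn_integral_Icc_shift[where f = "\<lambda>\<tau>. ennreal \<bar>g (x + \<tau> *\<^sub>R b)\<bar>"]) measurable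
        finally show "ennreal \<bar>u (x + t *\<^sub>R b) - u (x + s *\<^sub>R b)\<bar> \<le> \<dots>" .
      qed
    qed
  qed
  have "AE x in lborel. \<forall>p\<in>{p. p \<in> \<rat> \<times> \<rat> \<and> fst p < snd p}. (\<forall>\<tau>\<in>{fst p..snd p}. x + \<tau> *\<^sub>R b \<in> \<Omega>) \<longrightarrow>
     ennreal \<bar>u (x + snd p *\<^sub>R b) - u (x + fst p *\<^sub>R b)\<bar> \<le> (\<integral>\<^sup>+\<tau>\<in>{fst p..snd p}. ennreal \<bar>g (x + \<tau> *\<^sub>R b)\<bar> \<partial>lborel)"
  proof (subst AE_ball_countable)
    show "countable {p :: real \<times> real. p \<in> \<rat> \<times> \<rat> \<and> fst p < snd p}"
      by (rule countable_subset[of _ "\<rat> \<times> \<rat>"]) (auto intro: countable_rat)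
  qed (use rat in auto)
  then show ?thesis
  proof eventually_elim
    case (elim x)
    have E: "ennreal \<bar>u (x + t *\<^sub>R b) - u (x + s *\<^sub>R b)\<bar> \<le> (\<integral>\<^sup>+\<tau>\<in>{s..t}. ennreal \<bar>g (x + \<tau> *\<^sub>R b)\<bar> \<partial>lborel)"
      if "s \<in> \<rat>" "t \<in> \<rat>" "s < t" "\<forall>\<tau>\<in>{s..t}. x + \<tau> *\<^sub>R b \<in> \<Omega>" for s t
      using bspec[OF elim, of "(s, t)"] that by simp
    show ?case
      unfolding abs_cont_lines_def
    proof (intro allI impI)
      fix s t :: real assume st: "s \<le> t" and ins: "\<forall>\<tau>\<in>{s..t}. x + \<tau> *\<^sub>R b \<in> \<Omega>"
      let ?I = "\<integral>\<^sup>+\<tau>\<in>{s..t}. ennreal \<bar>g (x + \<tau> *\<^sub>R b)\<bar> \<partial>lborel"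
      let ?f = "\<lambda>\<tau>. u (x + \<tau> *\<^sub>R b)"
      show "ennreal \<bar>?f t - ?f s\<bar> \<le> ?I"
      proof (cases "s = t")
        case False
        then have st: "s < t" using st by simp
        have cf: "continuous_on {s..t} ?f"
          by (rule continuous_on_compose2[OF cont]) (use ins in \<open>auto intro!: continuous_intros\<close>)
        show ?thesis
        proof (rule ennreal_le_epsilon)
          fix e :: real assume e: "0 < e"
          have mod: "\<exists>d>0. \<forall>\<tau>\<in>{s..t}. dist \<tau> y < d \<longrightarrow> dist (?f \<tau>) (?f y) < e / 2" if "y \<in> {s..t}" for y
            using cf[unfolded continuous_on_iff] that e by (metis half_gt_zero)
          obtain d1 where d1: "0 < d1" "\<And>\<tau>. \<tau> \<in> {s..t} \<Longrightarrow> dist \<tau> s < d1 \<Longrightarrow> dist (?f \<tau>) (?f s) < e / 2"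
            using mod[of s] st by auto
          obtain d2 where d2: "0 < d2" "\<And>\<tau>. \<tau> \<in> {s..t} \<Longrightarrow> dist \<tau> t < d2 \<Longrightarrow> dist (?f \<tau>) (?f t) < e / 2"
            using mod[of t] st by auto
          obtain s' where s': "s' \<in> \<rat>" "s < s'" "s' < min (s + d1) ((s + t) / 2)"
            using Rats_dense_in_real[of s "min (s + d1) ((s + t) / 2)"] d1(1) st by auto
          obtain t' where t': "t' \<in> \<rat>" "max (t - d2) ((s + t) / 2) < t'" "t' < t"
            using Rats_dense_in_real[of "max (t - d2) ((s + t) / 2)" t] d2(1) st by auto
          have lt: "s' < t'" using s' t' by simp
          have "dist (?f s') (?f s) < e / 2"
            by (rule d1(2)) (use s' t' st lt in \<open>auto simp: dist_real_def\<close>)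
          moreover have "dist (?f t') (?f t) < e / 2"
            by (rule d2(2)) (use s' t' st lt in \<open>auto simp: dist_real_def\<close>)
          ultimately have "\<bar>?f t - ?f s\<bar> \<le> \<bar>?f t' - ?f s'\<bar> + e" unfolding dist_real_def by linarith
          then have "ennreal \<bar>?f t - ?f s\<bar> \<le> ennreal (\<bar>?f t' - ?f s'\<bar> + e)" by (rule ennreal_leI)
          also have "\<dots> = ennreal \<bar>?f t' - ?f s'\<bar> + ennreal e" using e by (intro ennreal_plus) auto
          also have "ennreal \<bar>?f t' - ?f s'\<bar> \<le> (\<integral>\<^sup>+\<tau>\<in>{s'..t'}. ennreal \<bar>g (x + \<tau> *\<^sub>R b)\<bar> \<partial>lborel)"
            using s' t' lt ins by (intro E) auto
          also have "\<dots> \<le> ?I"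
            using s' t' by (intro nn_integral_mono) (auto split: split_indicator)
          finally show "ennreal \<bar>?f t - ?f s\<bar> \<le> ?I + ennreal e" by (simp add: add_right_mono)
        qed
      qed simp
    qed
  qed
qed

text \<open>Integrated over \<open>x\<close>, the sum is \<open>h\<close> times the sum of the full
  integrals by Fubini and translation invariance. Summable L1 norms therefore restrict to summable
  integrals on almost every segment.\<close>

lemma AE_line_sums_finite:
  fixes F :: "nat \<Rightarrow> 'a::euclidean_space \<Rightarrow> ennreal"
  assumes [measurable]: "\<And>n. F n \<in> borel_measurable borel"
    and fin: "(\<Sum>n. \<integral>\<^sup>+x. F n x \<partial>lborel) \<noteq> \<infinity>" and h: "0 < h"
  shows "AE x in lborel. (\<Sum>n. \<integral>\<^sup>+\<tau>\<in>{0..h}. F n (x + \<tau> *\<^sub>R b) \<partial>lborel) \<noteq> \<infinity>"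
proof (rule nn_integral_noteq_infinite)
  have "(\<integral>\<^sup>+x. (\<Sum>n. \<integral>\<^sup>+\<tau>\<in>{0..h}. F n (x + \<tau> *\<^sub>R b) \<partial>lborel) \<partial>lborel)
    = (\<Sum>n. \<integral>\<^sup>+x. (\<integral>\<^sup>+\<tau>\<in>{0..h}. F n (x + \<tau> *\<^sub>R b) \<partial>lborel) \<partial>lborel)"
    by (rule nn_integral_suminf) measurable
  also have "\<dots> = (\<Sum>n. ennreal h * (\<integral>\<^sup>+x. F n x \<partial>lborel))"
  proof (rule suminf_cong)
    fix n
    have "(\<integral>\<^sup>+x. (\<integral>\<^sup>+\<tau>\<in>{0..h}. F n (x + \<tau> *\<^sub>R b) \<partial>lborel) \<partial>lborel) = (\<integral>\<^sup>+\<tau>. (\<integral>\<^sup>+x. F n (x + \<tau> *\<^sub>R b) * indicator {0..h} \<tau> \<partial>lborel) \<partial>lborel)"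
      by (rule lborel_pair.Fubini') measurable
    also have "\<dots> = (\<integral>\<^sup>+\<tau>. (\<integral>\<^sup>+x. F n x \<partial>lborel) * indicator {0..h} \<tau> \<partial>lborel)"
      by (simp add: nn_integral_multc nn_integral_lborel_translate)
    also have "\<dots> = ennreal h * (\<integral>\<^sup>+x. F n x \<partial>lborel)"
      using h by (subst nn_integral_cmult) (auto simp: mult.commute)
    finally show "(\<integral>\<^sup>+x. (\<integral>\<^sup>+\<tau>\<in>{0..h}. F n (x + \<tau> *\<^sub>R b) \<partial>lborel) \<partial>lborel) = ennreal h * (\<integral>\<^sup>+x. F n x \<partial>lborel)" .
  qed
  also have "\<dots> = ennreal h * (\<Sum>n. \<integral>\<^sup>+x. F n x \<partial>lborel)" by (rule ennreal_suminf_cmult)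
  also have "\<dots> \<noteq> \<infinity>" using fin by (simp add: ennreal_mult_eq_top_iff)
  finally show "(\<integral>\<^sup>+x. (\<Sum>n. \<integral>\<^sup>+\<tau>\<in>{0..h}. F n (x + \<tau> *\<^sub>R b) \<partial>lborel) \<partial>lborel) \<noteq> \<infinity>" .
qed measurable

text \<open>The hypothesis \<open>exit\<close> concerns only boundary points at which the whole
  sequence tends to 0. On almost every line all exit points are of this kind by
  \<open>exit_values_tendsto_0\<close>, so at each of them either the clipped function vanishes or a
  bump equals 1, as \<open>path_estimate\<close> requires.\<close>

lemma line_gradient_glued:
  fixes \<Omega> :: "'a::euclidean_space set" and U :: "nat \<Rightarrow> 'a \<Rightarrow> real" and z :: "nat \<Rightarrow> 'a"
  assumes \<Omega>: "open \<Omega>" and U: "\<And>n. continuous_on (closure \<Omega>) (U n)"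
    and [measurable]: "\<And>n. f n \<in> borel_measurable borel"
    and acl: "\<And>n b. b \<in> Basis \<Longrightarrow> AE x in lborel. abs_cont_lines \<Omega> b (U n) (g n b) x"
    and Uf: "\<And>n x. x \<in> \<Omega> \<inter> D \<Longrightarrow> ennreal \<bar>U n x\<bar> \<le> f n x"
    and gf: "\<And>n b x. b \<in> Basis \<Longrightarrow> x \<in> \<Omega> \<inter> D \<Longrightarrow> ennreal \<bar>g n b x\<bar> \<le> f n x"
    and fin: "(\<Sum>n. \<integral>\<^sup>+x. f n x \<partial>lborel) \<noteq> \<infinity>"
    and r: "\<And>i. i \<in> J \<Longrightarrow> 0 < r i"
    and exit: "\<And>y. y \<in> frontier \<Omega> \<inter> D \<Longrightarrow> (\<lambda>n. U n y) \<longlonglongrightarrow> 0 \<Longrightarrow> U m y \<le> 1 / 4 \<or> (\<exists>i\<in>J. y \<in> cball (z i) (r i))"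
    and v: "\<And>x. v x = max (if x \<in> \<Omega> then clip (U m x) else 0) (SUP i. if i \<in> J then ball_bump (z i) (r i) x else 0)"
    and k: "\<And>x. k x = (\<Sum>i. if i \<in> J then ennreal (1 / r i) * indicator (ball (z i) (2 * r i)) x else 0)"
  shows "line_gradient D v (\<lambda>x. 2 * f m x + k x)"
  unfolding line_gradient_def
proof (intro ballI allI impI)
  fix b :: 'a and h :: real assume b: "b \<in> Basis" and h: "0 < h"
  define \<zeta> where "\<zeta> = (\<lambda>i x. if i \<in> J then ball_bump (z i) (r i) x else 0)"
  have k': "k = (\<lambda>x. \<Sum>i. if i \<in> J then ennreal (1 / r i) * indicator (ball (z i) (2 * r i)) x else 0)"
    by (rule ext) (rule k)
  have [measurable]: "k \<in> borel_measurable borel" unfolding k' by measurable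
  \<comment> \<open>Stated for a general 1-Lipschitz path so that it applies to the segment and to
    its reversal; the two one-sided estimates together bound the absolute difference.\<close>
  have one: "ennreal (v (\<gamma> 0) - v (\<gamma> h)) \<le> (\<integral>\<^sup>+\<tau>\<in>{0..h}. 2 * f m (\<gamma> \<tau>) + k (\<gamma> \<tau>) \<partial>lborel)"
    if lip: "\<And>\<tau> \<tau>'. dist (\<gamma> \<tau>) (\<gamma> \<tau>') \<le> \<bar>\<tau> - \<tau>'\<bar>" and \<gamma>: "continuous_on UNIV \<gamma>"
      and D: "\<And>\<tau>. \<tau> \<in> {0..h} \<Longrightarrow> \<gamma> \<tau> \<in> D"
      and ac: "\<And>n s t. 0 \<le> s \<Longrightarrow> s \<le> t \<Longrightarrow> t \<le> h \<Longrightarrow> \<forall>\<tau>\<in>{s..t}. \<gamma> \<tau> \<in> \<Omega> \<Longrightarrow>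
        ennreal \<bar>U n (\<gamma> t) - U n (\<gamma> s)\<bar> \<le> (\<integral>\<^sup>+\<tau>\<in>{s..t}. f n (\<gamma> \<tau>) \<partial>lborel)"
      and fi: "(\<Sum>n. \<integral>\<^sup>+\<tau>\<in>{0..h}. f n (\<gamma> \<tau>) + f n (\<gamma> \<tau>) \<partial>lborel) \<noteq> \<infinity>" for \<gamma>
  proof -
    have [measurable]: "\<gamma> \<in> borel_measurable borel" by (rule borel_measurable_continuous_onI[OF \<gamma>])
    have \<gamma>h: "continuous_on {0..h} \<gamma>" by (rule continuous_on_subset[OF \<gamma>]) simp
    show ?thesis
    proof (rule path_estimate[OF \<Omega> h \<gamma>h U _ _ ac, where \<zeta> = \<zeta>])
      fix e assume e: "0 < e" "e \<le> h" "\<gamma> e \<in> frontier \<Omega>" and ins: "\<And>\<tau>. 0 \<le> \<tau> \<Longrightarrow> \<tau> < e \<Longrightarrow> \<gamma> \<tau> \<in> \<Omega>"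
      have "(\<lambda>n. U n (\<gamma> e)) \<longlonglongrightarrow> 0"
      proof (rule exit_values_tendsto_0[OF \<gamma>h U _ _ ac _ fi e(1,2) _ ins])
        show "ennreal \<bar>U n (\<gamma> \<tau>)\<bar> \<le> f n (\<gamma> \<tau>)" if "0 \<le> \<tau>" "\<tau> \<le> h" "\<gamma> \<tau> \<in> \<Omega>" for n \<tau>
          using that D[of \<tau>] by (intro Uf) auto
        show "\<gamma> e \<in> closure \<Omega>" using e(3) by (simp add: frontier_def)
      qed measurable
      moreover have "\<gamma> e \<in> D" using D[of e] e by simp
      ultimately have "U m (\<gamma> e) \<le> 1 / 4 \<or> (\<exists>i\<in>J. \<gamma> e \<in> cball (z i) (r i))"
        using e by (intro exit) auto
      then show "U m (\<gamma> e) \<le> 1 / 4 \<or> (\<exists>i. \<zeta> i (\<gamma> e) = 1)"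
      proof (elim disjE bexE)
        fix i assume i: "i \<in> J" "\<gamma> e \<in> cball (z i) (r i)"
        then have "\<zeta> i (\<gamma> e) = 1" using ball_bump_eq_1[OF r[OF i(1)] i(2)] by (simp add: \<zeta>_def)
        then show ?thesis by blast
      qed simp
    next
      fix i s t assume st: "0 \<le> s" "s \<le> t" "t \<le> h"
      show "ennreal (\<zeta> i (\<gamma> s) - \<zeta> i (\<gamma> t)) \<le> (\<integral>\<^sup>+\<tau>\<in>{s..t}. k (\<gamma> \<tau>) \<partial>lborel)"
      proof (cases "i \<in> J")
        case True
        have "ennreal (\<zeta> i (\<gamma> s) - \<zeta> i (\<gamma> t)) \<le> (\<integral>\<^sup>+\<tau>\<in>{s..t}. ennreal (1 / r i) * indicator (ball (z i) (2 * r i)) (\<gamma> \<tau>) \<partial>lborel)"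
          using ball_bump_path[OF r[OF True] st(2) lip] True by (simp add: \<zeta>_def)
        also have "\<dots> \<le> (\<integral>\<^sup>+\<tau>\<in>{s..t}. k (\<gamma> \<tau>) \<partial>lborel)"
        proof (intro nn_integral_mono mult_right_mono)
          fix \<tau>
          show "ennreal (1 / r i) * indicator (ball (z i) (2 * r i)) (\<gamma> \<tau>) \<le> k (\<gamma> \<tau>)"
            unfolding k using True ennreal_le_suminf[of "\<lambda>i. if i \<in> J then ennreal (1 / r i) * indicator (ball (z i) (2 * r i)) (\<gamma> \<tau>) else 0" i]
            by simp
        qed simp
        finally show ?thesis .
      qed (simp add: \<zeta>_def)
    qed (auto simp: \<zeta>_def v ball_bump_bounds)
  qed
  have "AE x in lborel. \<forall>n. abs_cont_lines \<Omega> b (U n) (g n b) x"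
    using acl[OF b] by (simp add: AE_all_countable)
  \<comment> \<open>The majorant appears twice because \<open>exit_values_tendsto_0\<close> adds a
    bound for the derivative and a bound for the function, and \<open>f n\<close> serves as
    both.\<close>
  moreover have "AE x in lborel. (\<Sum>n. \<integral>\<^sup>+\<tau>\<in>{0..h}. f n (x + \<tau> *\<^sub>R b) + f n (x + \<tau> *\<^sub>R b) \<partial>lborel) \<noteq> \<infinity>"
  proof (rule AE_line_sums_finite[OF _ _ h])
    have "(\<Sum>n. \<integral>\<^sup>+x. f n x + f n x \<partial>lborel) = (\<Sum>n. \<integral>\<^sup>+x. f n x \<partial>lborel) + (\<Sum>n. \<integral>\<^sup>+x. f n x \<partial>lborel)"
      by (simp add: nn_integral_add suminf_add summableI)
    then show "(\<Sum>n. \<integral>\<^sup>+x. f n x + f n x \<partial>lborel) \<noteq> \<infinity>" using fin by simp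
  qed measurable
  ultimately show "AE x in lborel. (\<forall>\<tau>\<in>{0..h}. x + \<tau> *\<^sub>R b \<in> D) \<longrightarrow>
    ennreal \<bar>v (x + h *\<^sub>R b) - v x\<bar> \<le> (\<integral>\<^sup>+\<tau>\<in>{0..h}. 2 * f m (x + \<tau> *\<^sub>R b) + k (x + \<tau> *\<^sub>R b) \<partial>lborel)"
  proof eventually_elim
    case (elim x)
    show ?case
    proof
      assume D: "\<forall>\<tau>\<in>{0..h}. x + \<tau> *\<^sub>R b \<in> D"
      let ?I = "\<integral>\<^sup>+\<tau>\<in>{0..h}. 2 * f m (x + \<tau> *\<^sub>R b) + k (x + \<tau> *\<^sub>R b) \<partial>lborel"
      have ac: "ennreal \<bar>U n (x + t *\<^sub>R b) - U n (x + s *\<^sub>R b)\<bar> \<le> (\<integral>\<^sup>+\<tau>\<in>{s..t}. f n (x + \<tau> *\<^sub>R b) \<partial>lborel)"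
        if "0 \<le> s" "s \<le> t" "t \<le> h" and ins: "\<forall>\<tau>\<in>{s..t}. x + \<tau> *\<^sub>R b \<in> \<Omega>" for n s t
      proof -
        have "ennreal \<bar>U n (x + t *\<^sub>R b) - U n (x + s *\<^sub>R b)\<bar> \<le> (\<integral>\<^sup>+\<tau>\<in>{s..t}. ennreal \<bar>g n b (x + \<tau> *\<^sub>R b)\<bar> \<partial>lborel)"
          using elim(1) that by (simp add: abs_cont_lines_def)
        also have "\<dots> \<le> (\<integral>\<^sup>+\<tau>\<in>{s..t}. f n (x + \<tau> *\<^sub>R b) \<partial>lborel)"
        proof (intro nn_integral_mono)
          fix \<tau>
          show "ennreal \<bar>g n b (x + \<tau> *\<^sub>R b)\<bar> * indicator {s..t} \<tau> \<le> f n (x + \<tau> *\<^sub>R b) * indicator {s..t} \<tau>"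
            using gf[OF b, of "x + \<tau> *\<^sub>R b" n] ins D that by (cases "\<tau> \<in> {s..t}") auto
        qed
        finally show ?thesis .
      qed
      have 1: "ennreal (v (x + 0 *\<^sub>R b) - v (x + h *\<^sub>R b)) \<le> ?I"
      proof (rule one[where \<gamma> = "\<lambda>\<tau>. x + \<tau> *\<^sub>R b"])
        show "dist (x + \<tau> *\<^sub>R b) (x + \<tau>' *\<^sub>R b) \<le> \<bar>\<tau> - \<tau>'\<bar>" for \<tau> \<tau>'
          using b by (simp add: dist_norm flip: scaleR_diff_left)
      qed (use D elim(2) ac in \<open>auto intro!: continuous_intros\<close>)
      have refl: "(\<integral>\<^sup>+\<tau>\<in>{s..t}. F (x + (h - \<tau>) *\<^sub>R b) \<partial>lborel) = (\<integral>\<^sup>+\<tau>\<in>{h - t..h - s}. F (x + \<tau> *\<^sub>R b) \<partial>lborel)"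
        if [measurable]: "F \<in> borel_measurable borel" for F s t
        by (rule nn_integral_Icc_reflect[where f = "\<lambda>\<tau>. F (x + \<tau> *\<^sub>R b)"]) measurable
      have "ennreal (v (x + (h - 0) *\<^sub>R b) - v (x + (h - h) *\<^sub>R b)) \<le> (\<integral>\<^sup>+\<tau>\<in>{0..h}. 2 * f m (x + (h - \<tau>) *\<^sub>R b) + k (x + (h - \<tau>) *\<^sub>R b) \<partial>lborel)"
      proof (rule one[where \<gamma> = "\<lambda>\<tau>. x + (h - \<tau>) *\<^sub>R b"])
        show "dist (x + (h - \<tau>) *\<^sub>R b) (x + (h - \<tau>') *\<^sub>R b) \<le> \<bar>\<tau> - \<tau>'\<bar>" for \<tau> \<tau>'
          using b by (simp add: dist_norm abs_minus_commute flip: scaleR_diff_left)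
        show "continuous_on UNIV (\<lambda>\<tau>. x + (h - \<tau>) *\<^sub>R b)" by (intro continuous_intros)
        show "x + (h - \<tau>) *\<^sub>R b \<in> D" if "\<tau> \<in> {0..h}" for \<tau> using D that by auto
        show "(\<Sum>n. \<integral>\<^sup>+\<tau>\<in>{0..h}. f n (x + (h - \<tau>) *\<^sub>R b) + f n (x + (h - \<tau>) *\<^sub>R b) \<partial>lborel) \<noteq> \<infinity>"
          using elim(2) by (subst refl[where F = "\<lambda>x. f n x + f n x" for n]) simp_all
        show "ennreal \<bar>U n (x + (h - t) *\<^sub>R b) - U n (x + (h - s) *\<^sub>R b)\<bar> \<le> (\<integral>\<^sup>+\<tau>\<in>{s..t}. f n (x + (h - \<tau>) *\<^sub>R b) \<partial>lborel)"
          if st: "0 \<le> s" "s \<le> t" "t \<le> h" "\<forall>\<tau>\<in>{s..t}. x + (h - \<tau>) *\<^sub>R b \<in> \<Omega>" for n s t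
        proof -
          have "\<forall>\<tau>\<in>{h - t..h - s}. x + \<tau> *\<^sub>R b \<in> \<Omega>"
          proof
            fix \<tau> assume "\<tau> \<in> {h - t..h - s}"
            then show "x + \<tau> *\<^sub>R b \<in> \<Omega>" using bspec[OF st(4), of "h - \<tau>"] by simp
          qed
          then have "ennreal \<bar>U n (x + (h - s) *\<^sub>R b) - U n (x + (h - t) *\<^sub>R b)\<bar> \<le> (\<integral>\<^sup>+\<tau>\<in>{h - t..h - s}. f n (x + \<tau> *\<^sub>R b) \<partial>lborel)"
            using st by (intro ac) auto
          then show ?thesis by (simp add: refl abs_minus_commute)
        qed
      qed
      also have "\<dots> = (\<integral>\<^sup>+\<tau>\<in>{h - h..h - 0}. 2 * f m (x + \<tau> *\<^sub>R b) + k (x + \<tau> *\<^sub>R b) \<partial>lborel)"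
        by (rule refl[where F = "\<lambda>x. 2 * f m x + k x"]) measurable
      finally have 2: "ennreal (v (x + h *\<^sub>R b) - v x) \<le> ?I" by simp
      show "ennreal \<bar>v (x + h *\<^sub>R b) - v x\<bar> \<le> ?I"
        using 1 2 by (cases "v x \<le> v (x + h *\<^sub>R b)") auto
    qed
  qed
qed

section \<open>Coverings, norms and traces\<close>

text \<open>\<open>hausdorff_measure\<close> lives on the Borel sets, and the set in question may
  fail to be Borel. Closing the covering sets changes no diameter, so the intersection over
  \<open>k\<close> of the unions of closures is a Borel hull that is still null.\<close>

lemma hausdorff_outer_zero_imp_null:
  fixes A :: "'a::metric_space set"
  assumes "hausdorff_outer s A = 0"
  obtains N where "N \<in> null_sets (hausdorff_measure s)" "A \<subseteq> N"
proof -
  have "\<exists>C :: nat \<Rightarrow> 'a set. A \<subseteq> (\<Union>i. C i) \<and> (\<forall>i. bounded (C i) \<and> diameter (C i) \<le> 1 / Suc k) \<and>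
      (\<Sum>i. hausdorff_gauge s (C i)) < ennreal (1 / Suc k)" for k
  proof -
    have "hausdorff_content s (1 / Suc k) A \<le> hausdorff_outer s A" by (rule hausdorff_content_le_outer) simp
    then have "hausdorff_content s (1 / Suc k) A < ennreal (1 / Suc k)" using assms by simp
    then show ?thesis unfolding hausdorff_content_def INF_less_iff by blast
  qed
  then obtain C :: "nat \<Rightarrow> nat \<Rightarrow> 'a set" where C: "\<And>k. A \<subseteq> (\<Union>i. C k i)" "\<And>k i. bounded (C k i)" "\<And>k i. diameter (C k i) \<le> 1 / Suc k"
    "\<And>k. (\<Sum>i. hausdorff_gauge s (C k i)) < ennreal (1 / Suc k)" by metis
  define N where "N = (\<Inter>k. \<Union>i. closure (C k i))"
  have A: "A \<subseteq> N"
  proof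
    fix x assume x: "x \<in> A"
    have "x \<in> (\<Union>i. closure (C k i))" for k
    proof -
      obtain i where "x \<in> C k i" using C(1)[of k] x by blast
      then show ?thesis using closure_subset by blast
    qed
    then show "x \<in> N" by (simp add: N_def)
  qed
  have N: "N \<in> sets borel" unfolding N_def by (intro sets.countable_INT sets.countable_UN) auto
  have bd: "hausdorff_content s \<delta> N \<le> ennreal (1 / Suc k)" if "1 / Suc k \<le> \<delta>" for \<delta> k
  proof -
    have "hausdorff_content s \<delta> N \<le> (\<Sum>i. hausdorff_gauge s (closure (C k i)))"
      unfolding hausdorff_content_def
    proof (rule INF_lower, safe)
      fix x assume "x \<in> N"
      then show "x \<in> (\<Union>i. closure (C k i))" by (simp add: N_def)
    next
      fix i
      show "bounded (closure (C k i))" by (rule bounded_closure[OF C(2)])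
      show "diameter (closure (C k i)) \<le> \<delta>" using C(2,3)[of k i] that by (simp add: diameter_closure)
    qed
    also have "\<dots> = (\<Sum>i. hausdorff_gauge s (C k i))"
      using C(2) by (intro suminf_cong) (simp add: hausdorff_gauge_def diameter_closure)
    finally show ?thesis using C(4)[of k] by simp
  qed
  have "hausdorff_content s \<delta> N = 0" if \<delta>: "0 < \<delta>" for \<delta>
  proof -
    have lim: "(\<lambda>k. ennreal (1 / Suc k)) \<longlonglongrightarrow> ennreal 0"
      using LIMSEQ_inverse_real_of_nat by (intro tendsto_ennrealI) (simp add: inverse_eq_divide)
    obtain k0 where k0: "inverse (real (Suc k0)) < \<delta>" using reals_Archimedean[OF \<delta>] by blast
    have "\<forall>\<^sub>F k in sequentially. hausdorff_content s \<delta> N \<le> ennreal (1 / Suc k)"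
      using eventually_ge_at_top[of k0]
    proof eventually_elim
      case (elim k)
      have "1 / real (Suc k) \<le> 1 / real (Suc k0)" using elim by (simp add: field_simps)
      then show ?case using k0 by (intro bd) (simp add: inverse_eq_divide)
    qed
    then have "hausdorff_content s \<delta> N \<le> ennreal 0"
      by (intro tendsto_lowerbound[OF lim]) auto
    then show ?thesis by simp
  qed
  then have "hausdorff_outer s N = 0" unfolding hausdorff_outer_def by (auto intro!: antisym SUP_least)
  then have "N \<in> null_sets (hausdorff_measure s)"
    using N emeasure_hausdorff_measure[OF N, of s] by (simp add: null_sets_def)
  then show thesis using that A by blast
qed

text \<open>Each covering set lies in a ball about one of its points with radius slightly above its
  diameter; strict excess gives positive radii even for singletons. The factor
  \<open>2 ^ s / unit_ball_vol (real s)\<close> undoes the normalisation of the gauge, and the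
  excesses \<open>\<kappa> * (1/2) ^ Suc i\<close> add up to the extra
  \<open>\<kappa>\<close>.\<close>

lemma hausdorff_outer_ball_cover:
  fixes G :: "'a::metric_space set"
  assumes G: "hausdorff_outer s G < ennreal \<kappa>" and \<kappa>: "0 < \<kappa>" and \<delta>: "0 < \<delta>"
  obtains J :: "nat set" and z :: "nat \<Rightarrow> 'a" and r :: "nat \<Rightarrow> real"
  where "\<And>i. i \<in> J \<Longrightarrow> 0 < r i" "\<And>i. i \<in> J \<Longrightarrow> r i \<le> \<delta>" "G \<subseteq> (\<Union>i\<in>J. cball (z i) (r i))"
    "(\<Sum>i. if i \<in> J then ennreal (r i ^ s) else 0) \<le> ennreal ((2 ^ s / unit_ball_vol (real s) + 1) * \<kappa>)"
proof -
  let ?\<omega> = "unit_ball_vol (real s)"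
  have om: "0 < ?\<omega>" by simp
  \<comment> \<open>Covering at scale \<open>\<delta> / 2\<close> leaves room for radii above the
    diameters and still at most \<open>\<delta>\<close>.\<close>
  have "hausdorff_content s (\<delta> / 2) G \<le> hausdorff_outer s G"
    using \<delta> by (intro hausdorff_content_le_outer) simp
  then have "hausdorff_content s (\<delta> / 2) G < ennreal \<kappa>" using G by simp
  then obtain C :: "nat \<Rightarrow> 'a set" where C: "G \<subseteq> (\<Union>i. C i)" "\<And>i. bounded (C i)" "\<And>i. diameter (C i) \<le> \<delta> / 2"
    "(\<Sum>i. hausdorff_gauge s (C i)) < ennreal \<kappa>"
    unfolding hausdorff_content_def INF_less_iff by blast
  define J where "J = {i. C i \<noteq> {}}"
  have "\<exists>\<rho>. diameter (C i) < \<rho> \<and> \<rho> \<le> \<delta> \<and> \<rho> ^ s \<le> diameter (C i) ^ s + \<kappa> * (1/2) ^ Suc i" for i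
  proof -
    let ?D = "diameter (C i)"
    have "((\<lambda>\<rho>. \<rho> ^ s) \<longlongrightarrow> ?D ^ s) (at_right ?D)" by (intro tendsto_intros)
    then have "\<forall>\<^sub>F \<rho> in at_right ?D. \<rho> ^ s < ?D ^ s + \<kappa> * (1/2) ^ Suc i"
      using \<kappa> by (intro order_tendstoD) auto
    moreover have "\<forall>\<^sub>F \<rho> in at_right ?D. \<rho> < \<delta>"
      using C(3)[of i] \<delta> by (intro order_tendstoD(2)[OF tendsto_ident_at]) simp
    moreover have "\<forall>\<^sub>F \<rho> in at_right ?D. ?D < \<rho>" by (rule eventually_at_right_less)
    ultimately have ev: "\<forall>\<^sub>F \<rho> in at_right ?D. ?D < \<rho> \<and> \<rho> \<le> \<delta> \<and> \<rho> ^ s \<le> ?D ^ s + \<kappa> * (1/2) ^ Suc i"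
      by eventually_elim auto
    show ?thesis using eventually_happens[OF ev] by simp
  qed
  then obtain r where r: "\<And>i. diameter (C i) < r i" "\<And>i. r i \<le> \<delta>" "\<And>i. r i ^ s \<le> diameter (C i) ^ s + \<kappa> * (1/2) ^ Suc i"
    by metis
  define z where "z = (\<lambda>i. SOME x. x \<in> C i)"
  have z: "z i \<in> C i" if "i \<in> J" for i using that by (auto simp: z_def J_def intro: someI)
  show thesis
  proof (rule that[of J r z])
    show "0 < r i" for i using r(1)[of i] diameter_ge_0[OF C(2)[of i]] by linarith
    show "r i \<le> \<delta>" for i by (rule r(2))
    show "G \<subseteq> (\<Union>i\<in>J. cball (z i) (r i))"
    proof
      fix x assume "x \<in> G"
      then obtain i where i: "x \<in> C i" using C(1) by blast
      then have "i \<in> J" by (auto simp: J_def)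
      have "dist (z i) x \<le> diameter (C i)" by (rule diameter_bounded_bound[OF C(2) z[OF \<open>i \<in> J\<close>] i])
      then have "x \<in> cball (z i) (r i)" using r(1)[of i] by simp
      then show "x \<in> (\<Union>i\<in>J. cball (z i) (r i))" using \<open>i \<in> J\<close> by blast
    qed
    have "(\<Sum>i. if i \<in> J then ennreal (r i ^ s) else 0)
      \<le> (\<Sum>i. ennreal (2 ^ s / ?\<omega>) * hausdorff_gauge s (C i) + ennreal (\<kappa> * (1/2) ^ Suc i))"
    proof (intro suminf_le)
      fix i
      show "(if i \<in> J then ennreal (r i ^ s) else 0) \<le> ennreal (2 ^ s / ?\<omega>) * hausdorff_gauge s (C i) + ennreal (\<kappa> * (1/2) ^ Suc i)"
      proof (cases "i \<in> J")
        case True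
        have D: "0 \<le> diameter (C i)" by (rule diameter_ge_0[OF C(2)])
        have "ennreal (r i ^ s) \<le> ennreal (diameter (C i) ^ s + \<kappa> * (1/2) ^ Suc i)" by (intro ennreal_leI r)
        also have "\<dots> = ennreal (diameter (C i) ^ s) + ennreal (\<kappa> * (1/2) ^ Suc i)"
          using D \<kappa> by (intro ennreal_plus) auto
        also have "diameter (C i) ^ s = 2 ^ s / ?\<omega> * (?\<omega> * (diameter (C i) / 2) ^ s)"
          using less_imp_neq[OF om] by (simp add: power_divide)
        also have "ennreal \<dots> = ennreal (2 ^ s / ?\<omega>) * hausdorff_gauge s (C i)"
          using True D om by (subst ennreal_mult) (auto simp: hausdorff_gauge_def J_def)
        finally show ?thesis using True by simp
      qed simp
    qed (auto simp: summableI)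
    also have "\<dots> = ennreal (2 ^ s / ?\<omega>) * (\<Sum>i. hausdorff_gauge s (C i)) + (\<Sum>i. ennreal (\<kappa> * (1/2) ^ Suc i))"
      by (subst suminf_add[symmetric]) (auto simp: summableI)
    also have "(\<Sum>i. ennreal (\<kappa> * (1/2) ^ Suc i)) = ennreal \<kappa>"
    proof (rule suminf_ennreal_eq)
      show "(\<lambda>n. \<kappa> * (1/2) ^ Suc n) sums \<kappa>"
        using sums_mult[OF power_half_series, of \<kappa>] by (simp only: mult_1_right)
    qed (use \<kappa> in simp)
    also have "ennreal (2 ^ s / ?\<omega>) * (\<Sum>i. hausdorff_gauge s (C i)) + ennreal \<kappa> \<le> ennreal (2 ^ s / ?\<omega>) * ennreal \<kappa> + ennreal \<kappa>"
      using C(4) by (intro add_right_mono mult_left_mono) auto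
    also have "\<dots> = ennreal ((2 ^ s / ?\<omega> + 1) * \<kappa>)"
      using \<kappa> om by (subst ennreal_mult[symmetric], simp, simp, subst ennreal_plus[symmetric]) (auto simp: distrib_right)
    finally show "(\<Sum>i. if i \<in> J then ennreal (r i ^ s) else 0) \<le> ennreal ((2 ^ s / ?\<omega> + 1) * \<kappa>)" .
  qed
qed

text \<open>For finite \<open>p\<close> this uses \<open>t \<le> \<eta> + \<eta> powr (1 - p) * t powr p\<close>, valid for all \<open>t \<ge> 0\<close>
  and \<open>\<eta> > 0\<close>.\<close>

lemma Lp_norm_small_imp_L1_small:
  assumes p: "1 \<le> p" and A: "A \<in> sets M" "emeasure M A < \<infinity>" and \<epsilon>: "0 < \<epsilon>"
  obtains \<delta> where "0 < \<delta>"
    "\<And>f. f \<in> borel_measurable M \<Longrightarrow> Lp_norm p M f < ennreal \<delta> \<Longrightarrow> (\<integral>\<^sup>+x\<in>A. ennreal \<bar>f x\<bar> \<partial>M) \<le> ennreal \<epsilon>"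
proof -
  define m where "m = enn2real (emeasure M A)"
  have m: "emeasure M A = ennreal m" "0 \<le> m" using A by (auto simp: m_def less_top)
  \<comment> \<open>The constant part contributes at most half of \<open>\<epsilon>\<close> on
    \<open>A\<close>; the added 1 avoids division by 0 when \<open>A\<close> is null.\<close>
  define \<eta> where "\<eta> = \<epsilon> / (2 * (m + 1))"
  have \<eta>: "0 < \<eta>" "\<eta> * m \<le> \<epsilon> / 2" using \<epsilon> m by (auto simp: \<eta>_def field_simps)
  show thesis
  proof (cases "p = \<infinity>")
    case True
    show ?thesis
    proof (rule that[OF \<eta>(1)])
      fix f :: "'a \<Rightarrow> real" assume [measurable]: "f \<in> borel_measurable M" and f: "Lp_norm p M f < ennreal \<eta>"
      have "AE x in M. ennreal \<bar>f x\<bar> \<le> esssup M (\<lambda>x. ennreal \<bar>f x\<bar>)" by (rule esssup_AE)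
      moreover have "esssup M (\<lambda>x. ennreal \<bar>f x\<bar>) < ennreal \<eta>" using f True by (simp add: Lp_norm_def)
      ultimately have "AE x in M. ennreal \<bar>f x\<bar> * indicator A x \<le> ennreal \<eta> * indicator A x"
        by (auto elim!: eventually_mono intro!: mult_right_mono)
      then have "(\<integral>\<^sup>+x\<in>A. ennreal \<bar>f x\<bar> \<partial>M) \<le> (\<integral>\<^sup>+x. ennreal \<eta> * indicator A x \<partial>M)"
        by (rule nn_integral_mono_AE)
      also have "\<dots> = ennreal (\<eta> * m)" using A m \<eta> by (simp add: nn_integral_cmult_indicator ennreal_mult)
      also have "\<dots> \<le> ennreal \<epsilon>" using \<eta> \<epsilon> by (intro ennreal_leI) simp
      finally show "(\<integral>\<^sup>+x\<in>A. ennreal \<bar>f x\<bar> \<partial>M) \<le> ennreal \<epsilon>" .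
    qed
  next
    case False
    define P where "P = enn2real p"
    have pP: "p = ennreal P" using False by (simp add: P_def less_top)
    have P: "1 \<le> P" using p unfolding pP by (simp add: ennreal_1[symmetric] ennreal_le_iff2 del: ennreal_1)
    \<comment> \<open>Chosen so that the term with the p-th power contributes the other half of
      \<open>\<epsilon>\<close>.\<close>
    define L where "L = \<epsilon> / 2 / \<eta> powr (1 - P)"
    have L: "0 < L" using \<epsilon> \<eta> by (simp add: L_def)
    show ?thesis
    proof (rule that[of "L powr (1 / P)"])
      show "0 < L powr (1 / P)" using L by simp
      fix f :: "'a \<Rightarrow> real" assume [measurable]: "f \<in> borel_measurable M" and f: "Lp_norm p M f < ennreal (L powr (1 / P))"
      define I where "I = (\<integral>\<^sup>+x. ennreal (\<bar>f x\<bar> powr P) \<partial>M)"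
      have Lp: "Lp_norm p M f = (if I = \<infinity> then \<infinity> else ennreal (enn2real I powr (1 / P)))"
        using False by (simp add: Lp_norm_def I_def P_def Let_def)
      have I: "I \<noteq> \<infinity>" using f Lp by auto
      then have "ennreal (enn2real I powr (1 / P)) < ennreal (L powr (1 / P))" using f Lp by simp
      then have "enn2real I powr (1 / P) < L powr (1 / P)" by (subst (asm) ennreal_less_iff) auto
      then have "enn2real I \<le> L"
        using powr_mono2[of "1 / P" L "enn2real I"] L P by (cases "L \<le> enn2real I") auto
      then have IL: "I \<le> ennreal L" using I by (metis ennreal_enn2real ennreal_leI infinity_ennreal_def less_top)
      have pt: "t \<le> \<eta> + \<eta> powr (1 - P) * t powr P" if "0 \<le> t" for t
      proof (cases "t \<le> \<eta>")
        case True
        then show ?thesis by (simp add: add_increasing2)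
      next
        case False
        then have t: "\<eta> < t" "0 < t" using \<eta> by auto
        have "t powr (1 - P) * t powr P \<le> \<eta> powr (1 - P) * t powr P"
          using t P \<eta> by (intro mult_right_mono powr_mono2') auto
        then have "t \<le> \<eta> powr (1 - P) * t powr P" using t by (simp flip: powr_add)
        then show ?thesis using \<eta> by linarith
      qed
      have "(\<integral>\<^sup>+x\<in>A. ennreal \<bar>f x\<bar> \<partial>M) \<le> (\<integral>\<^sup>+x. ennreal \<eta> * indicator A x + ennreal (\<eta> powr (1 - P)) * ennreal (\<bar>f x\<bar> powr P) \<partial>M)"
      proof (intro nn_integral_mono)
        fix x
        have "ennreal \<bar>f x\<bar> \<le> ennreal (\<eta> + \<eta> powr (1 - P) * \<bar>f x\<bar> powr P)" by (intro ennreal_leI pt) simp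
        also have "\<dots> = ennreal \<eta> + ennreal (\<eta> powr (1 - P)) * ennreal (\<bar>f x\<bar> powr P)"
          using \<eta> by (subst ennreal_plus) (auto simp: ennreal_mult)
        finally show "ennreal \<bar>f x\<bar> * indicator A x \<le> ennreal \<eta> * indicator A x + ennreal (\<eta> powr (1 - P)) * ennreal (\<bar>f x\<bar> powr P)"
          by (auto split: split_indicator)
      qed
      also have "\<dots> = ennreal \<eta> * ennreal m + ennreal (\<eta> powr (1 - P)) * I"
        using A m by (subst nn_integral_add) (auto simp: nn_integral_cmult nn_integral_cmult_indicator I_def)
      also have "\<dots> \<le> ennreal \<eta> * ennreal m + ennreal (\<eta> powr (1 - P)) * ennreal L"
        by (intro add_left_mono mult_left_mono IL) auto
      also have "\<dots> = ennreal (\<eta> * m + \<eta> powr (1 - P) * L)"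
        using \<eta> m L by (simp add: ennreal_mult)
      also have "\<eta> powr (1 - P) * L = \<epsilon> / 2" using \<eta> by (simp add: L_def)
      also have "ennreal (\<eta> * m + \<epsilon> / 2) \<le> ennreal \<epsilon>" using \<eta>(2) by (intro ennreal_leI) simp
      finally show "(\<integral>\<^sup>+x\<in>A. ennreal \<bar>f x\<bar> \<partial>M) \<le> ennreal \<epsilon>" .
    qed
  qed
qed

section \<open>Borel versions and L1 majorants of Sobolev functions\<close>

lemma locally_integrable_measurable:
  fixes f :: "'a::euclidean_space \<Rightarrow> real"
  assumes \<Omega>: "open \<Omega>" and f: "locally_integrable \<Omega> f"
  shows "(\<lambda>x. indicator \<Omega> x * f x) \<in> borel_measurable lebesgue"
proof -
  obtain C where C: "\<And>n. compact (C n)" "\<And>n. C n \<subseteq> \<Omega>" "\<And>n. C n \<subseteq> interior (C (Suc n))" "\<Union>(range C) = \<Omega>"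
    using open_Union_compact_subsets[OF \<Omega>] by metis
  have inc: "incseq C" using C(3) interior_subset by (intro incseq_SucI) blast
  show ?thesis
  proof (rule borel_measurable_LIMSEQ_real)
    show "(\<lambda>x. indicator (C n) x * f x) \<in> borel_measurable lebesgue" for n
      using f C(1,2)[of n] by (auto simp: locally_integrable_def set_integrable_def dest!: borel_measurable_integrable)
    show "(\<lambda>n. indicator (C n) x * f x) \<longlonglongrightarrow> indicator \<Omega> x * f x" for x
      using LIMSEQ_indicator_UN[of C x] LIMSEQ_indicator_incseq[OF inc, of x] C(4) by (auto intro!: tendsto_intros)
  qed
qed

text \<open>The Sobolev data are Lebesgue measurable on \<Omega>, while the line lemmas use Borel
  functions on the whole space. Zero extension of \<open>u\<close> is Borel because \<open>u\<close>
  is continuous on \<Omega>, and \<open>g\<close> is a Borel version of the zero extension of the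
  weak derivative; integrals over Borel parts of \<Omega> are unchanged.\<close>

lemma W1p_cont_abs_cont_lines:
  fixes u :: "'a::euclidean_space \<Rightarrow> real"
  assumes \<Omega>: "open \<Omega>" and b: "b \<in> Basis" and u: "u \<in> W1p_cont p \<Omega>"
  obtains g where "g \<in> borel_measurable borel" "AE x in lborel. abs_cont_lines \<Omega> b u g x"
    "weak_partial \<Omega> b u \<in> borel_measurable (lebesgue_on \<Omega>)"
    "\<And>A. A \<in> sets borel \<Longrightarrow> A \<subseteq> \<Omega> \<Longrightarrow>
       (\<integral>\<^sup>+x\<in>A. ennreal \<bar>g x\<bar> \<partial>lborel) = (\<integral>\<^sup>+x\<in>A. ennreal \<bar>weak_partial \<Omega> b u x\<bar> \<partial>lebesgue_on \<Omega>)"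
proof -
  define w where "w = weak_partial \<Omega> b u"
  have "\<exists>g. has_weak_partial \<Omega> b u g" using u b by (auto simp: W1p_cont_def W1p_def)
  then have hw: "has_weak_partial \<Omega> b u w" unfolding w_def weak_partial_def by (rule someI_ex)
  then have lu: "locally_integrable \<Omega> u" and lw: "locally_integrable \<Omega> w"
    and wk: "\<And>\<eta>. test_function \<Omega> \<eta> \<Longrightarrow> (LINT x|lebesgue_on \<Omega>. u x * frechet_derivative \<eta> (at x) b) = - (LINT x|lebesgue_on \<Omega>. w x * \<eta> x)"
    by (auto simp: has_weak_partial_def)
  have OB: "\<Omega> \<in> sets borel" "\<Omega> \<in> sets lebesgue" using \<Omega> by auto
  have wm: "(\<lambda>x. indicator \<Omega> x * w x) \<in> borel_measurable lebesgue" by (rule locally_integrable_measurable[OF \<Omega> lw])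
  then obtain g where g[measurable]: "g \<in> borel_measurable lborel" and gw: "AE x in lborel. indicator \<Omega> x * w x = g x"
    using completion_ex_borel_measurable_real[of "\<lambda>x. indicator \<Omega> x * w x" lborel] by auto
  have gw': "AE x in lebesgue. indicator \<Omega> x * w x = g x" by (rule AE_completion[OF gw])
  have gb[measurable]: "g \<in> borel_measurable borel" using g by simp
  define ut where "ut = (\<lambda>x. indicator \<Omega> x * u x)"
  have cu: "continuous_on (closure \<Omega>) u" using u by (simp add: W1p_cont_def)
  then have cuO: "continuous_on \<Omega> u" by (rule continuous_on_subset) (rule closure_subset)
  have utm[measurable]: "ut \<in> borel_measurable borel"
    using borel_measurable_continuous_on_indicator[OF OB(1) cuO] by (simp add: ut_def)
  have AC: "AE x in lborel. abs_cont_lines \<Omega> b ut g x"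
  proof (rule AE_abs_cont_lines[OF \<Omega> b utm gb])
    fix K assume K: "compact K" "K \<subseteq> \<Omega>"
    have KB[measurable]: "K \<in> sets borel" using K by (simp add: borel_compact)
    have "integrable lebesgue (\<lambda>x. indicat_real K x *\<^sub>R u x)"
      using lu K by (simp add: locally_integrable_def set_integrable_def)
    moreover have "(\<lambda>x. indicat_real K x *\<^sub>R u x) = (\<lambda>x. indicat_real K x *\<^sub>R ut x)"
      using K(2) by (auto simp: ut_def fun_eq_iff split: split_indicator)
    ultimately show "set_integrable lborel K ut"
      unfolding set_integrable_def by (subst integrable_completion[symmetric]) auto
    have "integrable lebesgue (\<lambda>x. indicat_real K x *\<^sub>R w x)"
      using lw K by (simp add: locally_integrable_def set_integrable_def)
    then have "integrable lebesgue (\<lambda>x. indicat_real K x *\<^sub>R g x)"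
    proof (rule integrable_cong_AE_imp)
      show "(\<lambda>x. indicat_real K x *\<^sub>R g x) \<in> borel_measurable lebesgue"
        by (rule measurable_completion) simp
      show "AE x in lebesgue. indicat_real K x *\<^sub>R w x = indicat_real K x *\<^sub>R g x"
        using gw' by eventually_elim (use K(2) in \<open>auto split: split_indicator split_indicator_asm\<close>)
    qed
    then show "set_integrable lborel K g"
      unfolding set_integrable_def by (subst integrable_completion[symmetric]) auto
  next
    fix \<eta> :: "'a \<Rightarrow> real" assume \<eta>: "test_function \<Omega> \<eta>"
    then have C: "Ck 0 \<eta>" "Ck (Suc 0) \<eta>" unfolding test_function_def by blast+
    have [measurable]: "\<eta> \<in> borel_measurable borel"
      using C(1) by (intro borel_measurable_continuous_onI) simp
    have [measurable]: "(\<lambda>x. frechet_derivative \<eta> (at x) b) \<in> borel_measurable borel"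
      using C(2) b by (intro borel_measurable_continuous_onI) simp
    have "(LINT x|lborel. ut x * frechet_derivative \<eta> (at x) b) = (LINT x|lebesgue. ut x * frechet_derivative \<eta> (at x) b)"
      by (rule integral_completion[symmetric]) simp
    also have "\<dots> = (LINT x|lebesgue_on \<Omega>. u x * frechet_derivative \<eta> (at x) b)"
      using OB by (subst integral_restrict_space) (auto simp: ut_def mult.assoc)
    also have "\<dots> = - (LINT x|lebesgue_on \<Omega>. w x * \<eta> x)" by (rule wk[OF \<eta>])
    also have "(LINT x|lebesgue_on \<Omega>. w x * \<eta> x) = (LINT x|lebesgue. indicator \<Omega> x * w x * \<eta> x)"
      using OB by (subst integral_restrict_space) (auto simp: mult.assoc)
    also have "\<dots> = (LINT x|lebesgue. g x * \<eta> x)"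
    proof (rule integral_cong_AE)
      have e: "\<eta> \<in> borel_measurable lebesgue" "g \<in> borel_measurable lebesgue" by (rule measurable_completion, simp)+
      show "(\<lambda>x. indicator \<Omega> x * w x * \<eta> x) \<in> borel_measurable lebesgue" by (rule borel_measurable_times[OF wm e(1)])
      show "(\<lambda>x. g x * \<eta> x) \<in> borel_measurable lebesgue" by (rule borel_measurable_times[OF e(2,1)])
      show "AE x in lebesgue. indicator \<Omega> x * w x * \<eta> x = g x * \<eta> x" using gw' by eventually_elim simp
    qed
    also have "\<dots> = (LINT x|lborel. g x * \<eta> x)" by (rule integral_completion) simp
    finally show "(LINT x|lborel. ut x * frechet_derivative \<eta> (at x) b) = - (LINT x|lborel. g x * \<eta> x)" .
  next
    show "continuous_on \<Omega> ut" using cuO by (subst continuous_on_cong[OF refl, where g = u]) (auto simp: ut_def)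
  qed
  show thesis
  proof (rule that[OF gb])
    show "AE x in lborel. abs_cont_lines \<Omega> b u g x"
      using AC
    proof eventually_elim
      case (elim x)
      show ?case unfolding abs_cont_lines_def
      proof (intro allI impI)
        fix s t :: real assume st: "s \<le> t" "\<forall>\<tau>\<in>{s..t}. x + \<tau> *\<^sub>R b \<in> \<Omega>"
        then have "ut (x + t *\<^sub>R b) = u (x + t *\<^sub>R b)" "ut (x + s *\<^sub>R b) = u (x + s *\<^sub>R b)" by (auto simp: ut_def)
        moreover have "ennreal \<bar>ut (x + t *\<^sub>R b) - ut (x + s *\<^sub>R b)\<bar> \<le> (\<integral>\<^sup>+\<tau>\<in>{s..t}. ennreal \<bar>g (x + \<tau> *\<^sub>R b)\<bar> \<partial>lborel)"
          using elim st unfolding abs_cont_lines_def by blast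
        ultimately show "ennreal \<bar>u (x + t *\<^sub>R b) - u (x + s *\<^sub>R b)\<bar> \<le> (\<integral>\<^sup>+\<tau>\<in>{s..t}. ennreal \<bar>g (x + \<tau> *\<^sub>R b)\<bar> \<partial>lborel)"
          by simp
      qed
    qed
    show "weak_partial \<Omega> b u \<in> borel_measurable (lebesgue_on \<Omega>)"
      using wm OB by (subst borel_measurable_restrict_space_iff) (auto simp: w_def)
  next
    fix A assume A: "A \<in> sets borel" "A \<subseteq> \<Omega>"
    have "(\<integral>\<^sup>+x\<in>A. ennreal \<bar>g x\<bar> \<partial>lborel) = (\<integral>\<^sup>+x\<in>A. ennreal \<bar>g x\<bar> \<partial>lebesgue)"
      using A by (intro nn_integral_completion[symmetric]) 
    also have "\<dots> = (\<integral>\<^sup>+x. ennreal \<bar>w x\<bar> * indicator A x * indicator \<Omega> x \<partial>lebesgue)"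
    proof (rule nn_integral_cong_AE)
      show "AE x in lebesgue. ennreal \<bar>g x\<bar> * indicator A x = ennreal \<bar>w x\<bar> * indicator A x * indicator \<Omega> x"
        using gw' by eventually_elim (use A(2) in \<open>auto split: split_indicator split_indicator_asm\<close>)
    qed
    also have "\<dots> = (\<integral>\<^sup>+x\<in>A. ennreal \<bar>w x\<bar> \<partial>lebesgue_on \<Omega>)"
      using OB by (subst nn_integral_restrict_space) auto
    finally show "(\<integral>\<^sup>+x\<in>A. ennreal \<bar>g x\<bar> \<partial>lborel) = (\<integral>\<^sup>+x\<in>A. ennreal \<bar>weak_partial \<Omega> b u x\<bar> \<partial>lebesgue_on \<Omega>)"
      by (simp add: w_def)
  qed
qed

lemma clip_continuous: "continuous_on A f \<Longrightarrow> continuous_on A (\<lambda>x. clip (f x))"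
  unfolding clip_def by (intro continuous_intros)

lemma nn_integral_lborel_eq_lebesgue_on:
  fixes u :: "'a::euclidean_space \<Rightarrow> real"
  assumes \<Omega>: "open \<Omega>" and u: "continuous_on \<Omega> u" and A: "A \<in> sets borel" "A \<subseteq> \<Omega>"
  shows "(\<integral>\<^sup>+x\<in>A. ennreal \<bar>indicator \<Omega> x * u x\<bar> \<partial>lborel) = (\<integral>\<^sup>+x\<in>A. ennreal \<bar>u x\<bar> \<partial>lebesgue_on \<Omega>)"
proof -
  have OB: "\<Omega> \<in> sets borel" using \<Omega> by simp
  have [measurable]: "(\<lambda>x. indicator \<Omega> x * u x) \<in> borel_measurable borel"
    using borel_measurable_continuous_on_indicator[OF OB u] by simp
  have "(\<integral>\<^sup>+x\<in>A. ennreal \<bar>indicator \<Omega> x * u x\<bar> \<partial>lborel) = (\<integral>\<^sup>+x\<in>A. ennreal \<bar>indicator \<Omega> x * u x\<bar> \<partial>lebesgue)"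
    using A by (intro nn_integral_completion[symmetric])
  also have "\<dots> = (\<integral>\<^sup>+x. ennreal \<bar>u x\<bar> * indicator A x * indicator \<Omega> x \<partial>lebesgue)"
    using A(2) by (intro nn_integral_cong) (auto split: split_indicator)
  also have "\<dots> = (\<integral>\<^sup>+x\<in>A. ennreal \<bar>u x\<bar> \<partial>lebesgue_on \<Omega>)"
    using OB by (subst nn_integral_restrict_space) auto
  finally show ?thesis .
qed

text \<open>A single Borel function dominates \<open>u\<close> and all its partial derivatives on
  the bounded piece. Smallness and summability along a sequence can then be expressed for one
  function per index.\<close>

lemma W1p_norm_small_majorant:
  fixes \<Omega> :: "'a::euclidean_space set" and q :: 'a
  assumes \<Omega>: "open \<Omega>" and p: "1 \<le> p" and \<epsilon>: "0 < \<epsilon>"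
  obtains \<delta> where "0 < \<delta>"
    "\<And>u. u \<in> W1p_cont p \<Omega> \<Longrightarrow> W1p_norm p \<Omega> u < ennreal \<delta> \<Longrightarrow>
       \<exists>g f. f \<in> borel_measurable borel \<and> (\<forall>b\<in>Basis. AE x in lborel. abs_cont_lines \<Omega> b u (g b) x) \<and>
         (\<forall>x\<in>\<Omega> \<inter> ball q R. ennreal \<bar>u x\<bar> \<le> f x) \<and> (\<forall>b\<in>Basis. \<forall>x\<in>\<Omega> \<inter> ball q R. ennreal \<bar>g b x\<bar> \<le> f x) \<and>
         (\<integral>\<^sup>+x. f x \<partial>lborel) \<le> ennreal \<epsilon>"
proof -
  let ?A = "\<Omega> \<inter> ball q R"
  \<comment> \<open>The majorant is a sum of \<open>DIM('a) + 1\<close> terms, the function and its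
    partial derivatives.\<close>
  define e where "e = \<epsilon> / (DIM('a) + 1)"
  have e: "0 < e" using \<epsilon> by (simp add: e_def)
  have OB: "\<Omega> \<in> sets borel" "\<Omega> \<in> sets lebesgue" using \<Omega> by auto
  note [measurable] = OB(1)
  have A[measurable]: "?A \<in> sets borel" using OB by auto
  have AL: "?A \<in> sets (lebesgue_on \<Omega>)" using OB by (auto simp: sets_restrict_space)
  have "emeasure (lebesgue_on \<Omega>) ?A = emeasure lborel ?A"
    using OB A by (subst emeasure_restrict_space) auto
  also have "\<dots> \<le> emeasure lborel (ball q R)" by (intro emeasure_mono) auto
  also have "\<dots> < \<infinity>" using emeasure_bounded_finite[OF bounded_ball] by auto
  finally have Afin: "emeasure (lebesgue_on \<Omega>) ?A < \<infinity>" .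
  obtain \<delta> where \<delta>: "0 < \<delta>" and D: "\<And>f. f \<in> borel_measurable (lebesgue_on \<Omega>) \<Longrightarrow> Lp_norm p (lebesgue_on \<Omega>) f < ennreal \<delta> \<Longrightarrow>
      (\<integral>\<^sup>+x\<in>?A. ennreal \<bar>f x\<bar> \<partial>lebesgue_on \<Omega>) \<le> ennreal e"
    using Lp_norm_small_imp_L1_small[OF p AL Afin e] by blast
  show thesis
  proof (rule that[OF \<delta>])
    fix u assume u: "u \<in> W1p_cont p \<Omega>" and un: "W1p_norm p \<Omega> u < ennreal \<delta>"
    have um: "u \<in> borel_measurable (lebesgue_on \<Omega>)" using u by (simp add: W1p_cont_def W1p_def Lp_def)
    have cuO: "continuous_on \<Omega> u"
      using u closure_subset by (auto simp: W1p_cont_def intro: continuous_on_subset)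
    define ut where "ut = (\<lambda>x. indicator \<Omega> x * u x)"
    have [measurable]: "ut \<in> borel_measurable borel"
      using borel_measurable_continuous_on_indicator[OF OB(1) cuO] by (simp add: ut_def)
    have "\<exists>g. g \<in> borel_measurable borel \<and> (AE x in lborel. abs_cont_lines \<Omega> b u g x) \<and>
       (\<integral>\<^sup>+x\<in>?A. ennreal \<bar>g x\<bar> \<partial>lborel) \<le> ennreal e" if b: "b \<in> Basis" for b
    proof -
      obtain g where g: "g \<in> borel_measurable borel" "AE x in lborel. abs_cont_lines \<Omega> b u g x"
        "weak_partial \<Omega> b u \<in> borel_measurable (lebesgue_on \<Omega>)"
        "\<And>A. A \<in> sets borel \<Longrightarrow> A \<subseteq> \<Omega> \<Longrightarrow>
           (\<integral>\<^sup>+x\<in>A. ennreal \<bar>g x\<bar> \<partial>lborel) = (\<integral>\<^sup>+x\<in>A. ennreal \<bar>weak_partial \<Omega> b u x\<bar> \<partial>lebesgue_on \<Omega>)"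
        by (rule W1p_cont_abs_cont_lines[OF \<Omega> b u]) (rule that)
      have "Lp_norm p (lebesgue_on \<Omega>) (weak_partial \<Omega> b u) \<le> (\<Sum>b\<in>Basis. Lp_norm p (lebesgue_on \<Omega>) (weak_partial \<Omega> b u))"
        using b by (intro member_le_sum) auto
      also have "\<dots> \<le> W1p_norm p \<Omega> u" by (simp add: W1p_norm_def)
      finally have "Lp_norm p (lebesgue_on \<Omega>) (weak_partial \<Omega> b u) < ennreal \<delta>" using un by simp
      from D[OF g(3) this] show ?thesis using g(1,2) g(4)[OF A Int_lower1] by auto
    qed
    then obtain g where g: "\<And>b. b \<in> Basis \<Longrightarrow> g b \<in> borel_measurable borel"
      "\<And>b. b \<in> Basis \<Longrightarrow> AE x in lborel. abs_cont_lines \<Omega> b u (g b) x"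
      "\<And>b. b \<in> Basis \<Longrightarrow> (\<integral>\<^sup>+x\<in>?A. ennreal \<bar>g b x\<bar> \<partial>lborel) \<le> ennreal e" by metis
    have g1[measurable (raw)]: "(\<lambda>x. \<Sum>b\<in>Basis. ennreal \<bar>g b x\<bar>) \<in> borel_measurable borel"
      using g(1) by measurable
    define f where "f = (\<lambda>x. (ennreal \<bar>ut x\<bar> + (\<Sum>b\<in>Basis. ennreal \<bar>g b x\<bar>)) * indicator ?A x)"
    have fm: "f \<in> borel_measurable borel" unfolding f_def by measurable
    have uf: "ennreal \<bar>u x\<bar> \<le> f x" if "x \<in> ?A" for x using that by (simp add: f_def ut_def)
    have gf: "ennreal \<bar>g b x\<bar> \<le> f x" if "b \<in> Basis" "x \<in> ?A" for b x
    proof -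
      have "ennreal \<bar>g b x\<bar> \<le> (\<Sum>b\<in>Basis. ennreal \<bar>g b x\<bar>)" using that by (intro member_le_sum) auto
      then show ?thesis using that by (simp add: f_def add_increasing)
    qed
    have "(\<integral>\<^sup>+x\<in>?A. ennreal \<bar>ut x\<bar> \<partial>lborel) \<le> ennreal e"
    proof -
      have "Lp_norm p (lebesgue_on \<Omega>) u \<le> W1p_norm p \<Omega> u" by (simp add: W1p_norm_def)
      then have "Lp_norm p (lebesgue_on \<Omega>) u < ennreal \<delta>" using un by simp
      from D[OF um this] show ?thesis
        using nn_integral_lborel_eq_lebesgue_on[OF \<Omega> cuO A] by (simp add: ut_def)
    qed
    moreover have "(\<integral>\<^sup>+x. f x \<partial>lborel) = (\<integral>\<^sup>+x\<in>?A. ennreal \<bar>ut x\<bar> \<partial>lborel) + (\<Sum>b\<in>Basis. \<integral>\<^sup>+x\<in>?A. ennreal \<bar>g b x\<bar> \<partial>lborel)"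
    proof -
      have "(\<integral>\<^sup>+x. f x \<partial>lborel) = (\<integral>\<^sup>+x\<in>?A. ennreal \<bar>ut x\<bar> \<partial>lborel) + (\<integral>\<^sup>+x\<in>?A. (\<Sum>b\<in>Basis. ennreal \<bar>g b x\<bar>) \<partial>lborel)"
        unfolding f_def distrib_right
      proof (rule nn_integral_add)
        have i: "indicator ?A \<in> borel_measurable lborel" using A by (intro borel_measurable_indicator) simp
        show "(\<lambda>x. ennreal \<bar>ut x\<bar> * indicator ?A x) \<in> borel_measurable lborel"
          by (rule borel_measurable_times_ennreal[OF _ i]) measurable
        show "(\<lambda>x. (\<Sum>b\<in>Basis. ennreal \<bar>g b x\<bar>) * indicator ?A x) \<in> borel_measurable lborel"
          by (rule borel_measurable_times_ennreal[OF _ i]) (use g1 in simp)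
      qed
      also have "(\<integral>\<^sup>+x\<in>?A. (\<Sum>b\<in>Basis. ennreal \<bar>g b x\<bar>) \<partial>lborel) = (\<Sum>b\<in>Basis. \<integral>\<^sup>+x\<in>?A. ennreal \<bar>g b x\<bar> \<partial>lborel)"
        unfolding sum_distrib_right
      proof (rule nn_integral_sum)
        fix b :: 'a assume "b \<in> Basis"
        note [measurable] = g(1)[OF this]
        show "(\<lambda>x. ennreal \<bar>g b x\<bar> * indicator ?A x) \<in> borel_measurable lborel" by measurable
      qed
      finally show ?thesis .
    qed
    moreover have "(\<Sum>b\<in>Basis. \<integral>\<^sup>+x\<in>?A. ennreal \<bar>g b x\<bar> \<partial>lborel) \<le> (\<Sum>b\<in>(Basis::'a set). ennreal e)"
      by (rule sum_mono) (rule g(3))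
    ultimately have "(\<integral>\<^sup>+x. f x \<partial>lborel) \<le> ennreal e + (\<Sum>b\<in>(Basis::'a set). ennreal e)"
      by (simp only: add_mono)
    also have "\<dots> = ennreal (e + DIM('a) * e)"
      using e by (simp add: ennreal_mult ennreal_of_nat_eq_real_of_nat)
    also have "e + DIM('a) * e = (DIM('a) + 1) * e" by (simp add: distrib_right)
    also have "\<dots> = \<epsilon>" unfolding e_def times_divide_eq_right by (rule nonzero_mult_div_cancel_left) (simp del: of_nat_add)
    finally show "\<exists>g f. f \<in> borel_measurable borel \<and> (\<forall>b\<in>Basis. AE x in lborel. abs_cont_lines \<Omega> b u (g b) x) \<and>
         (\<forall>x\<in>\<Omega> \<inter> ball q R. ennreal \<bar>u x\<bar> \<le> f x) \<and> (\<forall>b\<in>Basis. \<forall>x\<in>\<Omega> \<inter> ball q R. ennreal \<bar>g b x\<bar> \<le> f x) \<and>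
         (\<integral>\<^sup>+x. f x \<partial>lborel) \<le> ennreal \<epsilon>"
      using fm g(2) uf gf by blast
  qed
qed

text \<open>The sum of the differences has finite integral, so it is finite almost everywhere, and
  its terms tend to 0 there.\<close>

lemma AE_tendsto_of_L1_summable:
  fixes V :: "nat \<Rightarrow> 'a \<Rightarrow> real"
  assumes [measurable]: "\<And>j. V j \<in> borel_measurable M" "\<phi> \<in> borel_measurable M" "K \<in> sets M"
    and fin: "(\<Sum>j. \<integral>\<^sup>+z\<in>K. ennreal \<bar>V j z - \<phi> z\<bar> \<partial>M) \<noteq> \<infinity>"
  shows "AE z in M. z \<in> K \<longrightarrow> (\<lambda>j. V j z) \<longlonglongrightarrow> \<phi> z"
proof -
  have "(\<integral>\<^sup>+z. (\<Sum>j. ennreal \<bar>V j z - \<phi> z\<bar> * indicator K z) \<partial>M) = (\<Sum>j. \<integral>\<^sup>+z\<in>K. ennreal \<bar>V j z - \<phi> z\<bar> \<partial>M)"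
    by (rule nn_integral_suminf) measurable
  then have "AE z in M. (\<Sum>j. ennreal \<bar>V j z - \<phi> z\<bar> * indicator K z) \<noteq> \<infinity>"
    using fin by (intro nn_integral_noteq_infinite) auto
  then show ?thesis
  proof eventually_elim
    case (elim z)
    show ?case
    proof
      assume z: "z \<in> K"
      have "(\<lambda>j. ennreal \<bar>V j z - \<phi> z\<bar> * indicator K z) \<longlonglongrightarrow> 0"
        by (rule ennreal_suminf_finite_tendsto_0[OF elim])
      then have "(\<lambda>j. ennreal \<bar>V j z - \<phi> z\<bar>) \<longlonglongrightarrow> ennreal 0" using z by simp
      then have "(\<lambda>j. \<bar>V j z - \<phi> z\<bar>) \<longlonglongrightarrow> 0" by (subst (asm) tendsto_ennreal_iff) auto
      then have "(\<lambda>j. V j z - \<phi> z) \<longlonglongrightarrow> 0" by (rule tendsto_rabs_zero_cancel)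
      then show "(\<lambda>j. V j z) \<longlonglongrightarrow> \<phi> z" by (rule LIM_zero_cancel)
    qed
  qed
qed

section \<open>Points of positive density in the singular part, locally\<close>

lemma hausdorff_content_Un:
  assumes "0 \<le> \<delta>"
  shows "hausdorff_content s \<delta> (A \<union> B) \<le> hausdorff_content s \<delta> A + hausdorff_content s \<delta> B"
proof -
  have "hausdorff_content s \<delta> (A \<union> B) \<le> (\<Sum>n. hausdorff_content s \<delta> (binaryset A B n))"
    using hausdorff_content_subadditive[of s \<delta> "binaryset A B"] by (simp add: UN_binaryset_eq)
  also have "\<dots> = hausdorff_content s \<delta> A + hausdorff_content s \<delta> B"
    by (rule suminf_binaryset_eq) (rule hausdorff_content_empty[OF assms])
  finally show ?thesis .
qed

text \<open>Cutting \<open>S\<close> off by a ball in which the boundary has finite measure makes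
  integrability over every compact set immediate.\<close>

lemma indicator_in_L1loc_on:
  fixes \<Omega> :: "'a::euclidean_space set"
  assumes S: "S \<in> sets borel" "S \<subseteq> Gamma_loc \<Omega>"
    and fin: "emeasure (hausdorff_measure (DIM('a) - 1)) (frontier \<Omega> \<inter> ball q r) < \<infinity>"
  shows "indicat_real (S \<inter> ball q r) \<in> L1loc_on \<Omega> S"
proof -
  let ?H = "hausdorff_measure (DIM('a) - 1) :: 'a measure"
  let ?\<phi> = "indicat_real (S \<inter> ball q r)"
  have F: "frontier \<Omega> \<in> sets borel" by simp
  have SF: "S \<subseteq> frontier \<Omega>" using S(2) by (auto simp: Gamma_loc_def)
  have SB: "S \<inter> ball q r \<in> sets borel" using S(1) by auto
  have "?\<phi> \<in> borel_measurable ?H" using SB by (intro borel_measurable_indicator) simp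
  then have m: "?\<phi> \<in> borel_measurable (boundary_measure \<Omega>)"
    unfolding boundary_measure_def by (rule measurable_restrict_space1)
  have i: "set_integrable (boundary_measure \<Omega>) K ?\<phi>" if K: "compact K" "K \<subseteq> Gamma_loc \<Omega>" for K
  proof -
    have X: "K \<inter> (S \<inter> ball q r) \<in> sets borel" using K(1) SB by (auto simp: borel_compact)
    have XF: "K \<inter> (S \<inter> ball q r) \<subseteq> frontier \<Omega>" using SF by auto
    have "emeasure (boundary_measure \<Omega>) (K \<inter> (S \<inter> ball q r)) = emeasure ?H (K \<inter> (S \<inter> ball q r))"
      unfolding boundary_measure_def using F XF by (intro emeasure_restrict_space) auto
    also have "\<dots> \<le> emeasure ?H (frontier \<Omega> \<inter> ball q r)"
      using XF by (intro emeasure_mono) auto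
    finally have "emeasure (boundary_measure \<Omega>) (K \<inter> (S \<inter> ball q r)) < \<infinity>" using fin by simp
    moreover have "K \<inter> (S \<inter> ball q r) \<in> sets (boundary_measure \<Omega>)"
      unfolding boundary_measure_def sets_restrict_space using X XF by (auto intro!: image_eqI[of _ _ "K \<inter> (S \<inter> ball q r)"])
    ultimately have "integrable (boundary_measure \<Omega>) (indicat_real (K \<inter> (S \<inter> ball q r)))"
      by (intro integrable_real_indicator)
    moreover have "indicat_real (K \<inter> (S \<inter> ball q r)) = (\<lambda>x. indicat_real K x *\<^sub>R ?\<phi> x)"
      by (auto simp: fun_eq_iff split: split_indicator)
    ultimately show ?thesis by (simp add: set_integrable_def)
  qed
  show ?thesis
    unfolding L1loc_on_def L1loc_def using m i S(2) by (auto simp: Gamma_inf_def indicator_def)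
qed

text \<open>Three concentric balls are used: \<open>A\<close> lies in the one of radius
  \<open>R / 4\<close>, lines are followed in the one of radius \<open>R\<close>, and finiteness of
  the boundary measure in the one of radius \<open>2 * R\<close> makes the boundary part in the
  closed middle ball a compact subset of \<open>Gamma_loc \<Omega>\<close>.\<close>

theorem singular_part_density_null:
  fixes \<Omega> S :: "'a::euclidean_space set" and q :: 'a
  assumes \<Omega>: "open \<Omega>" and p: "1 \<le> p" and sb: "singular_boundary p \<Omega> S" and R: "0 < R"
    and fin: "emeasure (hausdorff_measure (DIM('a) - 1)) (frontier \<Omega> \<inter> ball q (2 * R)) < \<infinity>"
    and c: "0 < c" "c \<le> 1 / 2"
    and A: "A \<subseteq> S \<inter> ball q (R / 4)"
    and dens: "\<And>y \<eta>. y \<in> A \<Longrightarrow> 0 < \<eta> \<Longrightarrow> \<exists>\<rho>. 0 < \<rho> \<and> \<rho> < \<eta> \<and>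
       c * measure lborel (ball y \<rho>) \<le> measure lborel (\<Omega> \<inter> ball y \<rho>)"
  shows "hausdorff_outer (DIM('a) - 1) A = 0"
proof -
  let ?d = "DIM('a)" and ?s = "DIM('a) - 1"
  let ?H = "hausdorff_measure ?s :: 'a measure" and ?B = "boundary_measure \<Omega>"
  define \<phi> where "\<phi> = indicat_real (S \<inter> ball q (2 * R))"
  define K where "K = frontier \<Omega> \<inter> cball q R"
  have OB[measurable]: "\<Omega> \<in> sets borel" using \<Omega> by simp
  have FB: "frontier \<Omega> \<in> sets borel" by simp
  have S: "S \<in> sets borel" "S \<subseteq> Gamma_loc \<Omega>" and Z: "zero_traces p \<Omega> = L1loc_on \<Omega> S"
    using sb by (auto simp: singular_boundary_def)
  have SF: "S \<subseteq> frontier \<Omega>" using S(2) by (auto simp: Gamma_loc_def)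
  have "\<phi> \<in> zero_traces p \<Omega>"
    unfolding Z \<phi>_def by (rule indicator_in_L1loc_on[OF S fin])
  then have tr: "approx_trace p \<Omega> (\<lambda>_. 0) \<phi>" by (simp add: zero_traces_def)
  then obtain U where U: "\<And>n. U n \<in> W1p_cont p \<Omega>" "\<And>n. U n \<in> L1loc \<Omega>"
    "(\<lambda>n. W1p_norm p \<Omega> (U n)) \<longlonglongrightarrow> 0" "L1loc_tendsto \<Omega> U \<phi>"
    by (auto simp: approx_trace_def)
  have K: "compact K" "K \<subseteq> Gamma_loc \<Omega>"
  proof -
    show "compact K" unfolding K_def by (intro closed_Int_compact) auto
    show "K \<subseteq> Gamma_loc \<Omega>"
    proof
      fix y assume y: "y \<in> K"
      have "ball y R \<subseteq> ball q (2 * R)"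
      proof
        fix x assume "x \<in> ball y R"
        then show "x \<in> ball q (2 * R)" using dist_triangle[of q x y] y by (simp add: K_def)
      qed
      then have "emeasure ?H (frontier \<Omega> \<inter> ball y R) \<le> emeasure ?H (frontier \<Omega> \<inter> ball q (2 * R))"
        using FB by (intro emeasure_mono) auto
      then show "y \<in> Gamma_loc \<Omega>" using y fin R by (auto simp: Gamma_loc_def K_def intro!: exI[of _ R])
    qed
  qed
  have KB: "K \<in> sets borel" using K(1) by (simp add: borel_compact)
  have emB: "emeasure ?B X = hausdorff_outer ?s X" if "X \<in> sets ?B" for X
  proof -
    have X: "X \<in> sets borel" "X \<subseteq> frontier \<Omega>"
      using that FB by (auto simp: boundary_measure_def sets_restrict_space)
    have "emeasure ?B X = emeasure ?H X"
      unfolding boundary_measure_def using FB X by (intro emeasure_restrict_space) auto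
    then show ?thesis using emeasure_hausdorff_measure[OF X(1)] by simp
  qed
  have KS: "K \<in> sets ?B" unfolding boundary_measure_def sets_restrict_space using KB by (auto simp: K_def)
  define \<theta> where "\<theta> = (\<lambda>n. \<integral>\<^sup>+y\<in>K. ennreal \<bar>U n y - \<phi> y\<bar> \<partial>?B)"
  have \<theta>0: "\<theta> \<longlonglongrightarrow> 0" using U(4) K unfolding L1loc_tendsto_def \<theta>_def by blast
  have half: "0 < (1 / 2 :: real) ^ j" for j by simp
  \<comment> \<open>A subsequence is selected for which the trace error on \<open>K\<close> and the
    interior majorant are at most (1/2)^j simultaneously. Summability of the first gives pointwise
    convergence on the boundary, of the second convergence at exit points.\<close>
  have "\<exists>n g f. \<theta> n \<le> ennreal ((1/2) ^ j) \<and> f \<in> borel_measurable borel \<and> (\<forall>b\<in>Basis. AE x in lborel. abs_cont_lines \<Omega> b (U n) (g b) x) \<and>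
         (\<forall>x\<in>\<Omega> \<inter> ball q R. ennreal \<bar>U n x\<bar> \<le> f x) \<and> (\<forall>b\<in>Basis. \<forall>x\<in>\<Omega> \<inter> ball q R. ennreal \<bar>g b x\<bar> \<le> f x) \<and>
         (\<integral>\<^sup>+x. f x \<partial>lborel) \<le> ennreal ((1/2) ^ j)" for j
  proof -
    obtain \<delta> where \<delta>: "0 < \<delta>"
    "\<And>u. u \<in> W1p_cont p \<Omega> \<Longrightarrow> W1p_norm p \<Omega> u < ennreal \<delta> \<Longrightarrow>
       \<exists>g f. f \<in> borel_measurable borel \<and> (\<forall>b\<in>Basis. AE x in lborel. abs_cont_lines \<Omega> b u (g b) x) \<and>
         (\<forall>x\<in>\<Omega> \<inter> ball q R. ennreal \<bar>u x\<bar> \<le> f x) \<and> (\<forall>b\<in>Basis. \<forall>x\<in>\<Omega> \<inter> ball q R. ennreal \<bar>g b x\<bar> \<le> f x) \<and>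
         (\<integral>\<^sup>+x. f x \<partial>lborel) \<le> ennreal ((1/2) ^ j)"
      by (rule W1p_norm_small_majorant[OF \<Omega> p half, of q R j]) (rule that)
    have "\<forall>\<^sub>F n in sequentially. W1p_norm p \<Omega> (U n) < ennreal \<delta>"
      by (rule order_tendstoD(2)[OF U(3)]) (use \<delta>(1) in simp)
    moreover have "\<forall>\<^sub>F n in sequentially. \<theta> n < ennreal ((1/2) ^ j)"
      by (rule order_tendstoD(2)[OF \<theta>0]) simp
    ultimately have ev: "\<forall>\<^sub>F n in sequentially. W1p_norm p \<Omega> (U n) < ennreal \<delta> \<and> \<theta> n < ennreal ((1/2) ^ j)"
      by (rule eventually_conj)
    obtain n where n: "W1p_norm p \<Omega> (U n) < ennreal \<delta>" "\<theta> n < ennreal ((1/2) ^ j)"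
      using eventually_happens[OF ev] by auto
    show ?thesis using \<delta>(2)[OF U(1) n(1)] less_imp_le[OF n(2)] by blast
  qed
  then obtain \<iota> g f where V0: "\<And>j. \<theta> (\<iota> j) \<le> ennreal ((1/2) ^ j)" "\<And>j. f j \<in> borel_measurable borel"
    "\<And>j b. b \<in> Basis \<Longrightarrow> AE x in lborel. abs_cont_lines \<Omega> b (U (\<iota> j)) (g j b) x"
    "\<And>j x. x \<in> \<Omega> \<inter> ball q R \<Longrightarrow> ennreal \<bar>U (\<iota> j) x\<bar> \<le> f j x"
    "\<And>j b x. b \<in> Basis \<Longrightarrow> x \<in> \<Omega> \<inter> ball q R \<Longrightarrow> ennreal \<bar>g j b x\<bar> \<le> f j x"
    "\<And>j. (\<integral>\<^sup>+x. f j x \<partial>lborel) \<le> ennreal ((1/2) ^ j)"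
    by metis
  define V where "V = (\<lambda>j. U (\<iota> j))"
  note [measurable] = V0(2)
  have VC: "continuous_on (closure \<Omega>) (V j)" for j using U(1) by (simp add: V_def W1p_cont_def)
  have VB[measurable]: "V j \<in> borel_measurable ?B" for j using U(2) by (simp add: V_def L1loc_def)
  have \<phi>B[measurable]: "\<phi> \<in> borel_measurable ?B"
    using tr by (simp add: approx_trace_def L1loc_def)
  note [measurable] = KS
  have V\<theta>: "(\<integral>\<^sup>+y\<in>K. ennreal \<bar>V j y - \<phi> y\<bar> \<partial>?B) \<le> ennreal ((1/2) ^ j)" for j
    using V0(1)[of j] by (simp add: \<theta>_def V_def)
  have geo: "(\<Sum>j. c j) \<noteq> \<infinity>" if "\<And>j. c j \<le> ennreal ((1/2) ^ j)" for c :: "nat \<Rightarrow> ennreal"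
  proof -
    have "(\<Sum>j. c j) \<le> (\<Sum>j. ennreal ((1/2) ^ j))" using that by (intro suminf_le) (auto simp: summableI)
    also have "\<dots> = ennreal (\<Sum>j. (1/2) ^ j)" by (intro suminf_ennreal2) (auto intro: summable_geometric)
    finally show ?thesis by (auto simp: top_unique)
  qed
  have "AE y in ?B. y \<in> K \<longrightarrow> (\<lambda>j. V j y) \<longlonglongrightarrow> \<phi> y"
    by (rule AE_tendsto_of_L1_summable) (use geo V\<theta> in auto)
  then obtain N where N: "{y \<in> space ?B. \<not> (y \<in> K \<longrightarrow> (\<lambda>j. V j y) \<longlonglongrightarrow> \<phi> y)} \<subseteq> N" "emeasure ?B N = 0" "N \<in> sets ?B"
    by (rule AE_E)
  have spB: "space ?B = frontier \<Omega>" by (simp add: boundary_measure_def space_restrict_space)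
  have N0: "hausdorff_outer ?s N = 0" using emB[OF N(3)] N(2) by simp
  have VN: "(\<lambda>j. V j y) \<longlonglongrightarrow> \<phi> y" if "y \<in> K" "y \<notin> N" for y
    using N(1) that spB by (auto simp: K_def)
  \<comment> \<open>The points of \<open>K\<close> where the boundary value is still off by 1/4, the
    margin of \<open>clip\<close>. Chebyshev bounds their measure by four times the L1
    error.\<close>
  define E where "E = (\<lambda>j. {y \<in> K. 1 / 4 \<le> \<bar>V j y - \<phi> y\<bar>})"
  have E: "hausdorff_outer ?s (E j) \<le> ennreal (4 * (1/2) ^ j)" for j
  proof -
    have ES: "E j \<in> sets ?B"
    proof -
      have "{y \<in> space ?B. y \<in> K \<and> 1 / 4 \<le> \<bar>V j y - \<phi> y\<bar>} \<in> sets ?B" by measurable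
      moreover have "{y \<in> space ?B. y \<in> K \<and> 1 / 4 \<le> \<bar>V j y - \<phi> y\<bar>} = E j"
        by (auto simp: E_def spB K_def)
      ultimately show ?thesis by (simp only:)
    qed
    have "ennreal (1/4) * emeasure ?B (E j) = (\<integral>\<^sup>+y. ennreal (1/4) * indicator (E j) y \<partial>?B)"
      using ES by (simp add: nn_integral_cmult_indicator)
    also have "\<dots> \<le> (\<integral>\<^sup>+y\<in>K. ennreal \<bar>V j y - \<phi> y\<bar> \<partial>?B)"
    proof (intro nn_integral_mono)
      fix y
      show "ennreal (1/4) * indicator (E j) y \<le> ennreal \<bar>V j y - \<phi> y\<bar> * indicator K y"
        by (cases "y \<in> E j") (auto simp: E_def intro!: ennreal_leI)
    qed
    also have "\<dots> \<le> ennreal ((1/2) ^ j)" by (rule V\<theta>)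
    finally have le: "ennreal (1/4) * emeasure ?B (E j) \<le> ennreal ((1/2) ^ j)" .
    have "emeasure ?B (E j) = ennreal 4 * (ennreal (1/4) * emeasure ?B (E j))"
      by (subst mult.assoc[symmetric], subst ennreal_mult[symmetric]) simp_all
    also have "\<dots> \<le> ennreal 4 * ennreal ((1/2) ^ j)" using le by (rule mult_left_mono) simp
    also have "\<dots> = ennreal (4 * (1/2) ^ j)" by (rule ennreal_mult[symmetric]) auto
    finally show ?thesis using emB[OF ES] by simp
  qed
  have content0: "hausdorff_content ?s \<delta> A = 0" if \<delta>: "0 < \<delta>" for \<delta>
  proof (rule boxing_inequality[OF R \<delta> c, of q])
    fix C \<kappa>0 assume C: "0 < C" "0 < \<kappa>0" and box:
      "\<And>v g A \<kappa>. \<lbrakk>v \<in> borel_measurable borel; g \<in> borel_measurable borel; line_gradient (ball q R) v g;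
        \<And>x. 0 \<le> v x; \<And>x. v x \<le> 1; \<And>x. x \<in> ball q R \<Longrightarrow> ennreal (v x) \<le> g x;
        (\<integral>\<^sup>+x\<in>ball q R. g x \<partial>lborel) \<le> ennreal \<kappa>; 0 < \<kappa>; \<kappa> < \<kappa>0; A \<subseteq> ball q (R / 4);
        \<And>z \<eta>. z \<in> A \<Longrightarrow> 0 < \<eta> \<Longrightarrow> \<exists>\<rho>. 0 < \<rho> \<and> \<rho> < \<eta> \<and>
           c * measure lborel (ball z \<rho>) \<le> measure lborel ({x. v x = 1} \<inter> ball z \<rho>)\<rbrakk>
       \<Longrightarrow> hausdorff_content ?s \<delta> A \<le> ennreal (C * \<kappa>)"
    define L where "L = 2 ^ ?s / unit_ball_vol (real ?s) + 1"
    have L: "0 < L" unfolding L_def by (intro add_nonneg_pos divide_nonneg_nonneg) auto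
    define \<omega> where "\<omega> = unit_ball_vol (real ?d)"
    have \<omega>: "0 < \<omega>" by (simp add: \<omega>_def)
    \<comment> \<open>The summand 2 comes from the slope of \<open>clip\<close>. A bump of radius r
      contributes the volume of the double ball divided by r, that is
      \<open>\<omega> * 2 ^ ?d\<close> times r^(d-1), and these powers sum to at most
      \<open>L * 5\<close> times (1/2)^j.\<close>
    define M where "M = 2 + \<omega> * 2 ^ ?d * L * 5"
    have M: "0 < M" unfolding M_def using \<omega> L by (intro add_pos_nonneg mult_nonneg_nonneg) auto
    have bound: "hausdorff_content ?s \<delta> A \<le> ennreal ((C * M + 4) * (1/2) ^ j)" if j: "M * (1/2) ^ j < \<kappa>0" for j
    proof -
      \<comment> \<open>The boundary points at which the clipped function could jump although the
        sequence tends to 0. Off the null set \<open>N\<close> the limit is \<open>\<phi>\<close>,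
        so \<open>\<phi>\<close> is 0 there and the point lies in \<open>E j\<close>.\<close>
      define G where "G = {y \<in> K. 1 / 4 < V j y \<and> (\<lambda>n. V n y) \<longlonglongrightarrow> 0}"
      have "G \<subseteq> N \<union> E j"
      proof
        fix y assume y: "y \<in> G"
        show "y \<in> N \<union> E j"
        proof (cases "y \<in> N")
          case False
          then have "\<phi> y = 0" using VN[of y] y by (auto simp: G_def intro: LIMSEQ_unique)
          then show ?thesis using y by (auto simp: G_def E_def)
        qed simp
      qed
      then have "hausdorff_outer ?s G \<le> hausdorff_outer ?s N + hausdorff_outer ?s (E j)"
        by (intro order_trans[OF hausdorff_outer_mono hausdorff_outer_Un])
      also have "\<dots> \<le> ennreal (4 * (1/2) ^ j)" using N0 E by simp
      \<comment> \<open>The step from 4 to 5 provides the strict inequality required by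
        \<open>hausdorff_outer_ball_cover\<close>.\<close>
      also have "\<dots> < ennreal (5 * (1/2) ^ j)" by (intro ennreal_lessI) auto
      finally have G5: "hausdorff_outer ?s G < ennreal (5 * (1/2) ^ j)" .
      obtain J z r where r: "\<And>i. i \<in> J \<Longrightarrow> 0 < r i" "\<And>i. i \<in> J \<Longrightarrow> r i \<le> 1" "G \<subseteq> (\<Union>i\<in>J. cball (z i) (r i))"
        "(\<Sum>i. if i \<in> J then ennreal (r i ^ ?s) else 0) \<le> ennreal (L * (5 * (1/2) ^ j))"
        by (rule hausdorff_outer_ball_cover[OF G5 _ zero_less_one, folded L_def]) (simp, rule that)
      define Zt where "Zt = (\<lambda>i x. if i \<in> J then ball_bump (z i) (r i) x else 0)"
      define v where "v = (\<lambda>x. max (if x \<in> \<Omega> then clip (V j x) else 0) (SUP i. Zt i x))"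
      define k where "k = (\<lambda>x. \<Sum>i. if i \<in> J then ennreal (1 / r i) * indicator (ball (z i) (2 * r i)) x else 0)"
      define gg where "gg = (\<lambda>x. 2 * f j x + k x)"
      have Zt01: "0 \<le> Zt i x" "Zt i x \<le> 1" for i x by (auto simp: Zt_def ball_bump_bounds)
      have bdd: "bdd_above (range (\<lambda>i. Zt i x))" for x using Zt01(2) by (intro bdd_aboveI[of _ 1]) auto
      have [measurable]: "Zt i \<in> borel_measurable borel" for i unfolding Zt_def by measurable
      have [measurable]: "k \<in> borel_measurable borel" unfolding k_def by measurable
      have gm: "gg \<in> borel_measurable borel" unfolding gg_def by measurable
      have vm: "v \<in> borel_measurable borel"
      proof -
        have "continuous_on \<Omega> (\<lambda>x. clip (V j x))"
          by (intro clip_continuous continuous_on_subset[OF VC] closure_subset)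
        then have cl: "(\<lambda>x. indicator \<Omega> x *\<^sub>R clip (V j x)) \<in> borel_measurable borel"
          by (rule borel_measurable_continuous_on_indicator[OF OB])
        have "(\<lambda>x. if x \<in> \<Omega> then clip (V j x) else 0) = (\<lambda>x. indicator \<Omega> x *\<^sub>R clip (V j x))" by auto
        then have [measurable]: "(\<lambda>x. if x \<in> \<Omega> then clip (V j x) else 0) \<in> borel_measurable borel"
          using cl by (simp only:)
        have [measurable]: "(\<lambda>x. SUP i. Zt i x) \<in> borel_measurable borel"
          using bdd by (intro borel_measurable_cSUP) auto
        show ?thesis unfolding v_def by measurable
      qed
      have S01: "0 \<le> (SUP i. Zt i x)" "(SUP i. Zt i x) \<le> 1" for x
        using cSUP_upper2[OF bdd _ Zt01(1), of 0 x] Zt01(2) by (auto intro!: cSUP_least)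
      have v0: "0 \<le> v x" for x unfolding v_def using S01(1)[of x] by simp
      have v1: "v x \<le> 1" for x unfolding v_def using S01(2)[of x] clip_bounds(2) by simp
      have vg: "ennreal (v x) \<le> gg x" if x: "x \<in> ball q R" for x
      proof -
        have a: "ennreal (if x \<in> \<Omega> then clip (V j x) else 0) \<le> gg x"
        proof (cases "x \<in> \<Omega>")
          case True
          have "clip (V j x) \<le> 2 * \<bar>V j x\<bar>" unfolding clip_def by auto
          then have "ennreal (clip (V j x)) \<le> ennreal (2 * \<bar>V j x\<bar>)" by (rule ennreal_leI)
          also have "\<dots> = 2 * ennreal \<bar>V j x\<bar>" by (simp add: ennreal_mult)
          also have "\<dots> \<le> 2 * f j x" using V0(4)[of x j] True x by (intro mult_left_mono) (auto simp: V_def)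
          also have "\<dots> \<le> gg x" by (simp add: gg_def)
          finally show ?thesis using True by simp
        qed simp
        have b: "ennreal (Zt i x) \<le> gg x" for i
        proof (cases "i \<in> J \<and> x \<in> ball (z i) (2 * r i)")
          case True
          \<comment> \<open>Radii at most 1 make 1/r at least 1, so the gradient majorant of a bump
            also dominates its values; the boxing inequality asks for both.\<close>
          have "ennreal (Zt i x) \<le> ennreal (1 / r i)"
            using Zt01(2)[of i x] r(1,2)[of i] True by (intro ennreal_leI order_trans[OF Zt01(2)]) (simp add: field_simps)
          also have "\<dots> \<le> k x"
            using True ennreal_le_suminf[of "\<lambda>i. if i \<in> J then ennreal (1 / r i) * indicator (ball (z i) (2 * r i)) x else 0" i]
            by (simp add: k_def)
          also have "\<dots> \<le> gg x" by (simp add: gg_def)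
          finally show ?thesis .
        next
          case False
          then have "Zt i x = 0" using ball_bump_eq_0[OF r(1), of i x "z i"] by (auto simp: Zt_def)
          then show ?thesis by simp
        qed
        show ?thesis
        proof (cases "gg x = \<infinity>")
          case False
          then obtain t where t: "gg x = ennreal t" "0 \<le> t" by (cases "gg x") auto
          have "Zt i x \<le> t" for i using b[of i] t by (simp add: ennreal_le_iff)
          then have "(SUP i. Zt i x) \<le> t" by (intro cSUP_least) auto
          moreover have "(if x \<in> \<Omega> then clip (V j x) else 0) \<le> t" using a t by (simp add: ennreal_le_iff)
          ultimately have "v x \<le> t" by (simp add: v_def)
          then show ?thesis unfolding t by (rule ennreal_leI)
        qed simp
      qed
      have lg: "line_gradient (ball q R) v gg"
        unfolding gg_def
      proof (rule line_gradient_glued[where U = V and g = g and J = J and z = z and r = r and m = j, OF \<Omega> VC V0(2)])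
        show "AE x in lborel. abs_cont_lines \<Omega> b (V n) (g n b) x" if "b \<in> Basis" for n b
          using V0(3)[OF that] by (simp add: V_def)
        show "ennreal \<bar>V n x\<bar> \<le> f n x" if "x \<in> \<Omega> \<inter> ball q R" for n x
          using V0(4)[OF that] by (simp add: V_def)
        show "ennreal \<bar>g n b x\<bar> \<le> f n x" if "b \<in> Basis" "x \<in> \<Omega> \<inter> ball q R" for n b x
          by (rule V0(5)[OF that])
        show "(\<Sum>n. \<integral>\<^sup>+x. f n x \<partial>lborel) \<noteq> \<infinity>" by (rule geo) (rule V0(6))
        show "0 < r i" if "i \<in> J" for i by (rule r(1)[OF that])
        show "V j y \<le> 1 / 4 \<or> (\<exists>i\<in>J. y \<in> cball (z i) (r i))"
          if "y \<in> frontier \<Omega> \<inter> ball q R" "(\<lambda>n. V n y) \<longlonglongrightarrow> 0" for y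
        proof (cases "V j y \<le> 1 / 4")
          case False
          then have "y \<in> G" using that by (auto simp: G_def K_def)
          then show ?thesis using r(3) by blast
        qed simp
        show "v x = max (if x \<in> \<Omega> then clip (V j x) else 0) (SUP i. if i \<in> J then ball_bump (z i) (r i) x else 0)" for x
          by (simp add: v_def Zt_def)
        show "k x = (\<Sum>i. if i \<in> J then ennreal (1 / r i) * indicator (ball (z i) (2 * r i)) x else 0)" for x
          by (simp add: k_def)
      qed
      have kint: "(\<integral>\<^sup>+x. k x \<partial>lborel) \<le> ennreal (\<omega> * 2 ^ ?d * (L * (5 * (1/2) ^ j)))"
      proof -
        have "(\<integral>\<^sup>+x. k x \<partial>lborel) = (\<Sum>i. \<integral>\<^sup>+x. (if i \<in> J then ennreal (1 / r i) * indicator (ball (z i) (2 * r i)) x else 0) \<partial>lborel)"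
          unfolding k_def by (rule nn_integral_suminf) measurable
        also have "\<dots> = (\<Sum>i. ennreal (\<omega> * 2 ^ ?d) * (if i \<in> J then ennreal (r i ^ ?s) else 0))"
        proof (rule suminf_cong)
          fix i
          show "(\<integral>\<^sup>+x. (if i \<in> J then ennreal (1 / r i) * indicator (ball (z i) (2 * r i)) x else 0) \<partial>lborel)
            = ennreal (\<omega> * 2 ^ ?d) * (if i \<in> J then ennreal (r i ^ ?s) else 0)"
          proof (cases "i \<in> J")
            case True
            have ri: "0 < r i" by (rule r(1)[OF True])
            have "(\<integral>\<^sup>+x. (if i \<in> J then ennreal (1 / r i) * indicator (ball (z i) (2 * r i)) x else 0) \<partial>lborel)
              = ennreal (1 / r i) * emeasure lborel (ball (z i) (2 * r i))"
              using True by (simp add: nn_integral_cmult_indicator)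
            also have "emeasure lborel (ball (z i) (2 * r i)) = ennreal (\<omega> * (2 * r i) ^ ?d)"
              using ri by (simp add: emeasure_ball \<omega>_def)
            also have "ennreal (1 / r i) * ennreal (\<omega> * (2 * r i) ^ ?d) = ennreal (1 / r i * (\<omega> * (2 * r i) ^ ?d))"
              using ri \<omega> by (intro ennreal_mult[symmetric]) auto
            also have "1 / r i * (\<omega> * (2 * r i) ^ ?d) = \<omega> * 2 ^ ?d * r i ^ ?s"
            proof -
              have "r i ^ ?d = r i * r i ^ ?s" using power_Suc[of "r i" ?s] by simp
              then show ?thesis using ri by (simp add: power_mult_distrib)
            qed
            also have "ennreal \<dots> = ennreal (\<omega> * 2 ^ ?d) * ennreal (r i ^ ?s)"
              using ri \<omega> by (intro ennreal_mult) auto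
            finally show ?thesis using True by simp
          qed simp
        qed
        also have "\<dots> = ennreal (\<omega> * 2 ^ ?d) * (\<Sum>i. if i \<in> J then ennreal (r i ^ ?s) else 0)" by (rule ennreal_suminf_cmult)
        also have "\<dots> \<le> ennreal (\<omega> * 2 ^ ?d) * ennreal (L * (5 * (1/2) ^ j))" using r(4) by (rule mult_left_mono) simp
        also have "\<dots> = ennreal (\<omega> * 2 ^ ?d * (L * (5 * (1/2) ^ j)))" using \<omega> L by (intro ennreal_mult[symmetric]) auto
        finally show ?thesis .
      qed
      have gint: "(\<integral>\<^sup>+x\<in>ball q R. gg x \<partial>lborel) \<le> ennreal (M * (1/2) ^ j)"
      proof -
        have "(\<integral>\<^sup>+x\<in>ball q R. gg x \<partial>lborel) \<le> (\<integral>\<^sup>+x. 2 * f j x + k x \<partial>lborel)"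
          unfolding gg_def by (intro nn_integral_mono) (auto split: split_indicator)
        also have "\<dots> = 2 * (\<integral>\<^sup>+x. f j x \<partial>lborel) + (\<integral>\<^sup>+x. k x \<partial>lborel)"
          by (subst nn_integral_add) (auto simp: nn_integral_cmult)
        also have "\<dots> \<le> 2 * ennreal ((1/2) ^ j) + ennreal (\<omega> * 2 ^ ?d * (L * (5 * (1/2) ^ j)))"
          by (intro add_mono mult_left_mono V0(6) kint) auto
        also have "\<dots> = ennreal (2 * (1/2) ^ j + \<omega> * 2 ^ ?d * (L * (5 * (1/2) ^ j)))"
          using \<omega> L by (subst ennreal_plus) (auto simp: ennreal_mult)
        also have "2 * (1/2) ^ j + \<omega> * 2 ^ ?d * (L * (5 * (1/2) ^ j)) = M * (1/2) ^ j"
        proof -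
          have "2 * x + w * (L * (5 * x)) = (2 + w * L * 5) * x" for w x :: real by (simp add: algebra_simps)
          then show ?thesis unfolding M_def .
        qed
        finally show ?thesis .
      qed
      \<comment> \<open>At these points \<open>V j\<close> exceeds 3/4 also in a neighbourhood
        relative to the closure of \<Omega>, so the glued function is 1 on \<Omega> nearby and
        inherits the density of \<Omega>. The remaining points of \<open>A\<close> have
        \<open>\<phi>\<close> equal to 1 and lie in \<open>E j\<close>.\<close>
      define A1 where "A1 = {y \<in> A. 3 / 4 < V j y}"
      have A1: "hausdorff_content ?s \<delta> A1 \<le> ennreal (C * (M * (1/2) ^ j))"
      proof (rule box[OF vm gm lg v0 v1 vg gint _ j])
        show "0 < M * (1/2) ^ j" using M by simp
        show "A1 \<subseteq> ball q (R / 4)" using A by (auto simp: A1_def)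
      next
        fix y and \<eta> :: real assume y: "y \<in> A1" and \<eta>: "0 < \<eta>"
        have yc: "y \<in> closure \<Omega>" using y A SF by (auto simp: A1_def frontier_def)
        have "3 / 4 < V j y" using y by (simp add: A1_def)
        then obtain \<delta>' where \<delta>': "0 < \<delta>'" "\<And>x. x \<in> closure \<Omega> \<Longrightarrow> dist x y < \<delta>' \<Longrightarrow> dist (V j x) (V j y) < V j y - 3 / 4"
          using VC[of j, unfolded continuous_on_iff, rule_format, OF yc, of "V j y - 3 / 4"] by auto
        obtain \<rho> where \<rho>: "0 < \<rho>" "\<rho> < min \<eta> \<delta>'" "c * measure lborel (ball y \<rho>) \<le> measure lborel (\<Omega> \<inter> ball y \<rho>)"
          using dens[of y "min \<eta> \<delta>'"] y \<eta> \<delta>' by (auto simp: A1_def)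
        have sub: "\<Omega> \<inter> ball y \<rho> \<subseteq> {x. v x = 1} \<inter> ball y \<rho>"
        proof
          fix x assume x: "x \<in> \<Omega> \<inter> ball y \<rho>"
          then have "x \<in> closure \<Omega>" "dist x y < \<delta>'" using \<rho> closure_subset by (auto simp: dist_commute)
          then have "dist (V j x) (V j y) < V j y - 3 / 4" by (rule \<delta>'(2))
          then have "3 / 4 < V j x" unfolding dist_real_def by linarith
          then have "clip (V j x) = 1" by (simp add: clip_def)
          then have "1 \<le> v x" using x by (simp add: v_def)
          then show "x \<in> {x. v x = 1} \<inter> ball y \<rho>" using v1[of x] x by auto
        qed
        have "measure lborel (\<Omega> \<inter> ball y \<rho>) \<le> measure lborel ({x. v x = 1} \<inter> ball y \<rho>)"
        proof (rule measure_mono_fmeasurable[OF sub])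
          show "\<Omega> \<inter> ball y \<rho> \<in> sets lborel" by simp
          show "{x. v x = 1} \<inter> ball y \<rho> \<in> fmeasurable lborel"
            using vm by (intro fmeasurableI2[OF fmeasurable_ball]) auto
        qed
        then show "\<exists>\<rho>. 0 < \<rho> \<and> \<rho> < \<eta> \<and> c * measure lborel (ball y \<rho>) \<le> measure lborel ({x. v x = 1} \<inter> ball y \<rho>)"
          using \<rho> by (intro exI[of _ \<rho>]) auto
      qed
      have "A - A1 \<subseteq> E j"
      proof
        fix y assume y: "y \<in> A - A1"
        then have "y \<in> K" using A SF R by (auto simp: K_def)
        moreover have "y \<in> S \<inter> ball q (R / 4)" using y A by blast
        then have "\<phi> y = 1" using R by (simp add: \<phi>_def)
        moreover have "V j y \<le> 3 / 4" using y by (auto simp: A1_def)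
        ultimately show "y \<in> E j" by (auto simp: E_def)
      qed
      then have A2: "hausdorff_content ?s \<delta> (A - A1) \<le> ennreal (4 * (1/2) ^ j)"
        using order_trans[OF hausdorff_content_le_outer[OF \<delta>] order_trans[OF hausdorff_outer_mono E]] by blast
      have "A = A1 \<union> (A - A1)" by (auto simp: A1_def)
      then have "hausdorff_content ?s \<delta> A \<le> hausdorff_content ?s \<delta> A1 + hausdorff_content ?s \<delta> (A - A1)"
        using hausdorff_content_Un[of \<delta> ?s A1 "A - A1"] \<delta> by simp
      also have "\<dots> \<le> ennreal (C * (M * (1/2) ^ j)) + ennreal (4 * (1/2) ^ j)" by (intro add_mono A1 A2)
      also have "\<dots> = ennreal (C * (M * (1/2) ^ j) + 4 * (1/2) ^ j)" using C M by (intro ennreal_plus[symmetric]) auto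
      also have "C * (M * (1/2) ^ j) + 4 * (1/2) ^ j = (C * M + 4) * (1/2) ^ j"
        by (simp only: distrib_right mult.assoc)
      finally show ?thesis .
    qed
    \<comment> \<open>Both contributions are multiples of (1/2)^j, and the smallness condition of
      the boxing inequality holds for all large \<open>j\<close>.\<close>
    have pw: "(\<lambda>j. (1 / 2 :: real) ^ j) \<longlonglongrightarrow> 0" by (rule LIMSEQ_power_zero) simp
    have lim: "(\<lambda>j. ennreal ((C * M + 4) * (1/2) ^ j)) \<longlonglongrightarrow> ennreal 0"
      by (intro tendsto_ennrealI tendsto_mult_right_zero pw)
    have "\<forall>\<^sub>F j in sequentially. M * (1/2) ^ j < \<kappa>0"
      by (rule order_tendstoD(2)[OF tendsto_mult_right_zero[OF pw] C(2)])
    then have "\<forall>\<^sub>F j in sequentially. hausdorff_content ?s \<delta> A \<le> ennreal ((C * M + 4) * (1/2) ^ j)"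
      by (rule eventually_mono) (rule bound)
    then have "hausdorff_content ?s \<delta> A \<le> ennreal 0"
      by (intro tendsto_lowerbound[OF lim]) auto
    then show "hausdorff_content ?s \<delta> A = 0" by simp
  qed
  show ?thesis unfolding hausdorff_outer_def using content0 by (auto intro!: antisym SUP_least)
qed

section \<open>Countable decomposition and the density statement\<close>

lemma hausdorff_outer_UN_null:
  assumes "countable I" and "\<And>i. i \<in> I \<Longrightarrow> hausdorff_outer s (A i) = 0"
  shows "hausdorff_outer s (\<Union>i\<in>I. A i) = 0"
proof (cases "I = {}")
  case False
  have "hausdorff_outer s (\<Union>n. A (from_nat_into I n)) \<le> (\<Sum>n. hausdorff_outer s (A (from_nat_into I n)))"
    by (rule hausdorff_outer_subadditive)
  also have "\<dots> = 0" using assms(2) from_nat_into[OF False] by simp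
  also have "(\<Union>n. A (from_nat_into I n)) = (\<Union>i\<in>I. A i)"
  proof -
    have "(\<Union>n. A (from_nat_into I n)) = (\<Union>i\<in>range (from_nat_into I). A i)" by simp
    then show ?thesis unfolding range_from_nat_into[OF False assms(1)] .
  qed
  finally show ?thesis by simp
qed (simp add: hausdorff_outer_empty)

text \<open>Thresholds of the form \<open>1 / (real k + 2)\<close> are countably many, come
  arbitrarily close to 0, and never exceed 1/2, the bound imposed by the boxing inequality.\<close>

lemma upper_density_positive_imp_large_ratio:
  fixes z :: "'a::euclidean_space"
  assumes \<Omega>: "\<Omega> \<in> sets borel" and up: "0 < upper_density \<Omega> z"
  obtains k :: nat where "\<And>\<eta>. 0 < \<eta> \<Longrightarrow> \<exists>\<rho>. 0 < \<rho> \<and> \<rho> < \<eta> \<and>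
    1 / (real k + 2) * measure lborel (ball z \<rho>) \<le> measure lborel (\<Omega> \<inter> ball z \<rho>)"
proof -
  obtain e where e: "0 < ereal e" "ereal e < upper_density \<Omega> z" using ereal_dense2[OF up] by blast
  obtain k where k: "inverse (real (Suc k)) < e" using reals_Archimedean[of e] e(1) by auto
  have "1 / (real k + 2) \<le> inverse (real (Suc k))" by (simp add: field_simps)
  then have "ereal (1 / (real k + 2)) \<le> ereal e" using k by simp
  then have lt: "ereal (1 / (real k + 2)) < upper_density \<Omega> z" using e(2) by (rule le_less_trans)
  show thesis
  proof (rule that[of k], rule ccontr)
    fix \<eta> :: real assume \<eta>: "0 < \<eta>" and no: "\<not> (\<exists>\<rho>. 0 < \<rho> \<and> \<rho> < \<eta> \<and>
      1 / (real k + 2) * measure lborel (ball z \<rho>) \<le> measure lborel (\<Omega> \<inter> ball z \<rho>))"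
    have "\<forall>\<^sub>F \<rho> in at_right 0. density_ratio \<Omega> z \<rho> \<le> ereal (1 / (real k + 2))"
      unfolding eventually_at_right[OF \<eta>]
    proof (intro exI[of _ \<eta>] conjI allI impI \<eta>)
      fix \<rho> :: real assume \<rho>: "0 < \<rho>" "\<rho> < \<eta>"
      then have "measure lborel (\<Omega> \<inter> ball z \<rho>) < 1 / (real k + 2) * measure lborel (ball z \<rho>)"
        using no by auto
      moreover have "measure lebesgue (\<Omega> \<inter> ball z \<rho>) = measure lborel (\<Omega> \<inter> ball z \<rho>)" "measure lebesgue (ball z \<rho>) = measure lborel (ball z \<rho>)"
        using \<Omega> by (auto intro!: measure_completion)
      moreover have "0 < measure lborel (ball z \<rho>)" using content_ball_pos[OF \<rho>(1), of z] by simp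
      ultimately show "density_ratio \<Omega> z \<rho> \<le> ereal (1 / (real k + 2))"
        by (simp add: density_ratio_def pos_divide_le_eq less_imp_le)
    qed
    then have "upper_density \<Omega> z \<le> ereal (1 / (real k + 2))"
      unfolding upper_density_def by (rule Limsup_bounded)
    then show False using lt by simp
  qed
qed

lemma has_density_0I:
  assumes "\<not> 0 < upper_density \<Omega> z"
  shows "has_density \<Omega> z 0"
proof -
  have "0 \<le> lower_density \<Omega> z"
    unfolding lower_density_def
    by (rule Liminf_bounded) (simp add: density_ratio_def)
  moreover have "lower_density \<Omega> z \<le> upper_density \<Omega> z"
    unfolding lower_density_def upper_density_def by (rule Liminf_le_Limsup) simp
  ultimately show ?thesis using assms by (auto simp: has_density_def)
qed

theorem theorem4p15:
  fixes \<Omega> S :: "'a::euclidean_space set" and p :: ennreal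
  assumes "open \<Omega>" and "\<Omega> \<noteq> {}" and "1 \<le> p" and "singular_boundary p \<Omega> S"
  shows "(AE z in hausdorff_measure (DIM('a) - 1). z \<in> S \<longrightarrow> has_density \<Omega> z 0) \<and>
    (\<forall>A \<in> sets borel. A \<subseteq> Gamma_loc \<Omega> \<and>
       (AE z in hausdorff_measure (DIM('a) - 1). z \<in> A \<longrightarrow> upper_density \<Omega> z > 0) \<longrightarrow>
       trace_unique_on S A)"
proof -
  let ?s = "DIM('a) - 1"
  let ?H = "hausdorff_measure ?s :: 'a measure"
  have S: "S \<in> sets borel" "S \<subseteq> Gamma_loc \<Omega>" using assms(4) by (auto simp: singular_boundary_def)
  have OB: "\<Omega> \<in> sets borel" using assms(1) by simp
  have "\<exists>r>0. emeasure ?H (frontier \<Omega> \<inter> ball z r) < \<infinity>" if "z \<in> S" for z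
    using that S(2) by (auto simp: Gamma_loc_def)
  then obtain r where r: "\<And>z. z \<in> S \<Longrightarrow> 0 < r z" "\<And>z. z \<in> S \<Longrightarrow> emeasure ?H (frontier \<Omega> \<inter> ball z (r z)) < \<infinity>"
    by metis
  \<comment> \<open>Lindelof reduces the neighbourhoods of finite boundary measure to countably
    many. Radius \<open>r z / 8\<close> is a quarter of \<open>R = r z / 2\<close>, for which
    \<open>2 * R\<close> is again \<open>r z\<close>.\<close>
  obtain F where F: "F \<subseteq> (\<lambda>z. ball z (r z / 8)) ` S" "countable F" "\<Union>F = (\<Union>z\<in>S. ball z (r z / 8))"
    using Lindelof[of "(\<lambda>z. ball z (r z / 8)) ` S"] by auto
  obtain T where T: "T \<subseteq> S" "countable T" "F = (\<lambda>z. ball z (r z / 8)) ` T"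
    using countable_subset_image[THEN iffD1, OF conjI[OF F(2,1)]] by blast
  \<comment> \<open>On each piece one ball and one density threshold are fixed, as in the local
    result. The pieces need not be Borel, hence the use of the outer measure.\<close>
  define A where "A = (\<lambda>(q, k :: nat). {y \<in> S \<inter> ball q (r q / 8). \<forall>\<eta>>0. \<exists>\<rho>. 0 < \<rho> \<and> \<rho> < \<eta> \<and>
    1 / (real k + 2) * measure lborel (ball y \<rho>) \<le> measure lborel (\<Omega> \<inter> ball y \<rho>)})"
  have A0: "hausdorff_outer ?s (A i) = 0" if mem: "i \<in> T \<times> UNIV" for i
  proof -
    obtain q k where iq: "i = (q, k)" "q \<in> T" using mem by (cases i) auto
    then have i: "i = (q, k)" "q \<in> S" using T(1) by auto
    show ?thesis
    proof (rule singular_part_density_null[OF assms(1,3,4), where q = q and R = "r q / 2" and c = "1 / (real k + 2)"])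
      show "emeasure ?H (frontier \<Omega> \<inter> ball q (2 * (r q / 2))) < \<infinity>" using r(2)[OF i(2)] by simp
      show "A i \<subseteq> S \<inter> ball q (r q / 2 / 4)" by (auto simp: A_def i)
    qed (use r(1)[OF i(2)] in \<open>auto simp: A_def i field_simps\<close>)
  qed
  have sub: "{z \<in> S. 0 < upper_density \<Omega> z} \<subseteq> (\<Union>i\<in>T \<times> UNIV. A i)"
  proof
    fix z assume z: "z \<in> {z \<in> S. 0 < upper_density \<Omega> z}"
    then have "z \<in> \<Union>F" using F(3) r(1) by force
    then obtain q where q: "q \<in> T" "z \<in> ball q (r q / 8)" using T(3) by blast
    obtain k :: nat where "\<And>\<eta>. 0 < \<eta> \<Longrightarrow> \<exists>\<rho>. 0 < \<rho> \<and> \<rho> < \<eta> \<and>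
      1 / (real k + 2) * measure lborel (ball z \<rho>) \<le> measure lborel (\<Omega> \<inter> ball z \<rho>)"
      using upper_density_positive_imp_large_ratio[OF OB] z by blast
    then have "z \<in> A (q, k)" using z q by (simp add: A_def)
    then show "z \<in> (\<Union>i\<in>T \<times> UNIV. A i)" using q by blast
  qed
  moreover have "hausdorff_outer ?s (\<Union>i\<in>T \<times> UNIV. A i) = 0"
    by (rule hausdorff_outer_UN_null[OF _ A0]) (simp_all add: T(2))
  ultimately have "hausdorff_outer ?s {z \<in> S. 0 < upper_density \<Omega> z} = 0"
    using hausdorff_outer_mono[OF sub, of ?s] by simp
  then obtain N where N: "N \<in> null_sets ?H" "{z \<in> S. 0 < upper_density \<Omega> z} \<subseteq> N"
    by (rule hausdorff_outer_zero_imp_null) (rule that)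
  have d: "AE z in ?H. z \<in> S \<longrightarrow> has_density \<Omega> z 0"
    using AE_not_in[OF N(1)]
  proof eventually_elim
    case (elim z)
    then show ?case using N(2) has_density_0I[of \<Omega> z] by blast
  qed
  have "trace_unique_on S B"
    if B: "B \<in> sets borel" "AE z in ?H. z \<in> B \<longrightarrow> upper_density \<Omega> z > 0" for B
  proof -
    \<comment> \<open>Zero density makes the upper density 0, which contradicts positivity at points
      of \<open>B\<close>.\<close>
    have "AE z in ?H. z \<notin> B \<inter> S"
      using d B(2) by eventually_elim (auto simp: has_density_def)
    then have "emeasure ?H {z \<in> space ?H. z \<in> B \<inter> S} = 0" by (rule emeasure_eq_0_AE)
    then show ?thesis by (simp add: trace_unique_on_def Int_def)
  qed
  then show ?thesis using d by blast
qed

end
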